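(* Under the assumptions on the constants, the delay $\tau$, the weights $\delta_1,\delta_2$ and the energy parameters $\overline{\xi},\lambda$ listed in the context, there exist positive constants $H_1,H_2$ such that $$E(t)\le H_1E(0)e^{-H_2t},\qquad t\ge0,$$ for any solution of the piezoelectric beam system with time-varying delay and time-dependent weights described in the context, where $E$ is its energy.
   Context: Let $L>0$ and let $\rho,\alpha,\alpha_1,\gamma,\mu,\beta$ be positive constants with $\alpha=\alpha_1+\gamma^2\beta$. Assumptions on the delay: there are constants $\tau_0,\overline{\tau}>0$ and $d<1$ such that $0<\tau_0\le\tau(t)\le\overline{\tau}$ and $\tau'(t)\le d<1$ for all $t>0$, and $\tau\in W^{2,\infty}([0,T])$ for all $T>0$. Assumptions on the weights: $\delta_1:[0,\infty)\to[0,\infty)$ is non-increasing and of class $C^1$, with constants $M_1>0$, $\delta_0>0$ such that $|\delta_1'(t)/\delta_1(t)|\le M_1$ and $0<\delta_0\le\delta_1(t)$ for all $t\ge0$; $\delta_2:[0,\infty)\to\mathbb{R}$ is of class $C^1$ (not necessarily positive or monotone), with $|\delta_2(t)|\le\beta_0\delta_1(t)$ and $|\delta_2'(t)|\le M_2\delta_1(t)$ for all $t$, for some constants $0<\beta_0<\sqrt{1-d}$ and $M_2>0$. The system is, for $x\in(0,L)$, $r\in(0,1)$, $t>0$, $$\rho v_{tt}-\alpha v_{xx}+\gamma\beta p_{xx}+\delta_1(t)v_t(x,t)+\delta_2(t)z(x,1,t)=0,$$ $$\mu p_{tt}-\beta p_{xx}+\gamma\beta v_{xx}=0,$$ $$\tau(t)z_t(x,r,t)+(1-\tau'(t)r)z_r(x,r,t)=0,$$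 with boundary conditions $v(0,t)=\alpha v_x(L,t)-\gamma\beta p_x(L,t)=0$, $p(0,t)=p_x(L,t)-\gamma v_x(L,t)=0$, $z(x,0,t)=v_t(x,t)$, and initial conditions $(v,p,v_t,p_t)(x,0)=(v_0,p_0,v_1,p_1)(x)$, $z(x,r,0)=g_0(x,-r\tau(0))$. Here $z(x,r,t)=v_t(x,t-\tau(t)r)$. Solutions: let $H^1_*(0,L)=\{u\in H^1(0,L):u(0)=0\}$, $\mathcal{H}=(H^1_*(0,L)\times L^2(0,L))^2\times L^2((0,L)\times(0,1))$, and let $D\subset\mathcal{H}$ be the set of $(v,f,p,h,z)$ in $\left((H^2(0,L)\cap H^1_*(0,L))\times H^1_*(0,L)\right)^2\times L^2((0,L);H^1(0,1))$ with $f=z(\cdot,0)$ in $(0,L)$ and $v_x(L)=p_x(L)=0$. For initial data $(v_0,v_1,p_0,p_1,g_0(\cdot,-\,\cdot\,\tau(0)))\in\mathcal{H}$ the solution $(v,v_t,p,p_t,z)$ is in $C([0,\infty),\mathcal{H})$; if the initial data are in $D$, it is in $C([0,\infty),D)\cap C^1([0,\infty),\mathcal{H})$. Energy: $$E(t)=\frac{\rho}{2}\int_0^L|v_t|^2dx+\frac{\mu}{2}\int_0^L|p_t|^2dx+\frac{\alpha_1}{2}\int_0^L|v_x|^2dx+\frac{\beta}{2}\int_0^L|\gamma v_x-p_x|^2dx+\frac{\xi(t)}{2}\int_{t-\tau(t)}^t\int_0^Le^{\lambda(s-t)}v_t^2(x,s)\,dx\,ds,$$ where $\xi(t)=\overline{\xi}\delta_1(t)$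 is a non-increasing function of class $C^1$ and the constants $\overline{\xi}$ and $\lambda$ are fixed with $$\frac{\beta_0}{\sqrt{1-d}}<\overline{\xi}<2-\frac{\beta_0}{\sqrt{1-d}},\qquad \lambda<\frac{1}{\overline{\tau}}\left|\log\frac{|\delta_2|}{\sqrt{1-d}}\right|,$$ $\delta_2$ being the weight function above. *)

theory Defs
  imports "HOL-Analysis.Analysis"
begin

text \<open>
  Trajectories take time as first argument: \<open>v t x\<close> stands for \<open>v(x,t)\<close> and \<open>z t (x, r)\<close> for
  \<open>z(x,r,t)\<close>; they are constrained on \<open>0 \<le> t\<close> only. The initial history keeps the order
  \<open>g0 x s\<close>, for \<open>s \<in> (-\<tau>(0),0)\<close>. Elements of \<open>L\<^sup>2\<close> are represented by functions, so equations
  between them are stated almost everywhere.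
\<close>

definition L2_on :: "'a::euclidean_space set \<Rightarrow> ('a \<Rightarrow> real) \<Rightarrow> bool" where
  "L2_on S u \<longleftrightarrow> u \<in> borel_measurable (lebesgue_on S) \<and> (\<lambda>x. (u x)\<^sup>2) integrable_on S"

definition L2_sqnorm :: "'a::euclidean_space set \<Rightarrow> ('a \<Rightarrow> real) \<Rightarrow> real" where
  "L2_sqnorm S u = integral S (\<lambda>x. (u x)\<^sup>2)"

text \<open>\<open>u \<in> C([0,\<infinity>), L\<^sup>2(S))\<close>\<close>
definition L2_continuous :: "'a::euclidean_space set \<Rightarrow> (real \<Rightarrow> 'a \<Rightarrow> real) \<Rightarrow> bool" where
  "L2_continuous S u \<longleftrightarrow> (\<forall>t\<ge>0. L2_on S (u t)) \<and>
     (\<forall>t\<ge>0. ((\<lambda>s. L2_sqnorm S (\<lambda>x. u s x - u t x)) \<longlongrightarrow> 0) (at t within {0..}))"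

text \<open>\<open>u \<in> C\<^sup>1([0,\<infinity>), L\<^sup>2(S))\<close> with time derivative \<open>u'\<close>\<close>
definition L2_C1 :: "'a::euclidean_space set \<Rightarrow> (real \<Rightarrow> 'a \<Rightarrow> real) \<Rightarrow> (real \<Rightarrow> 'a \<Rightarrow> real) \<Rightarrow> bool" where
  "L2_C1 S u u' \<longleftrightarrow> L2_continuous S u \<and> L2_continuous S u' \<and>
     (\<forall>t\<ge>0. ((\<lambda>s. L2_sqnorm S (\<lambda>x. (u s x - u t x) / (s - t) - u' t x)) \<longlongrightarrow> 0)
        (at t within {0..}))"

text \<open>
  \<open>u \<in> W\<^sup>1\<^sup>,\<^sup>1(a,b)\<close> with weak derivative \<open>g\<close>, where \<open>u\<close> is the absolutely continuous
  representative on \<open>[a,b]\<close>; boundary values such as \<open>u a\<close> are thus the traces.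
  Then \<open>u \<in> H\<^sup>1(a,b)\<close> means that moreover \<open>g\<close> is in \<open>L\<^sup>2\<close>.
\<close>
definition sobolev_deriv :: "real \<Rightarrow> real \<Rightarrow> (real \<Rightarrow> real) \<Rightarrow> (real \<Rightarrow> real) \<Rightarrow> bool" where
  "sobolev_deriv a b u g \<longleftrightarrow> g absolutely_integrable_on {a..b} \<and>
     (\<forall>x\<in>{a..b}. u x = u a + integral {a..x} g)"

text \<open>
  \<open>u \<in> W\<^sup>2\<^sup>,\<^sup>\<infinity>(0,T)\<close> with first derivative \<open>u'\<close>; boundedness of \<open>u\<close> and \<open>u'\<close> is automatic, as
  they are continuous on \<open>[0,T]\<close>.
\<close>
definition W2_inf :: "real \<Rightarrow> (real \<Rightarrow> real) \<Rightarrow> (real \<Rightarrow> real) \<Rightarrow> bool" where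
  "W2_inf T u u' \<longleftrightarrow> (\<exists>u''. sobolev_deriv 0 T u u' \<and> sobolev_deriv 0 T u' u'' \<and>
     (\<exists>K. AE t in lebesgue_on {0..T}. \<bar>u'' t\<bar> \<le> K))"

definition C1_nonneg :: "(real \<Rightarrow> real) \<Rightarrow> (real \<Rightarrow> real) \<Rightarrow> bool" where
  "C1_nonneg u u' \<longleftrightarrow> (\<forall>t\<ge>0. (u has_real_derivative u' t) (at t within {0..})) \<and>
     continuous_on {0..} u'"

definition rect :: "real \<Rightarrow> (real \<times> real) set" where
  "rect L = {0..L} \<times> {0..1}"

text \<open>The velocity \<open>v\<^sub>t(x,s)\<close>, continued to negative times \<open>s\<close> by the history \<open>g0\<close>.\<close>
definition velocity :: "(real \<Rightarrow> real \<Rightarrow> real) \<Rightarrow> (real \<Rightarrow> real \<Rightarrow> real) \<Rightarrow> real \<Rightarrow> real \<Rightarrow> real" where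
  "velocity g0 vt s x = (if s < 0 then g0 x s else vt s x)"

text \<open>
  A trajectory \<open>(v, v\<^sub>x, v\<^sub>t, p, p\<^sub>x, p\<^sub>t, z)\<close> with values in \<open>\<H>\<close>. The spatial derivatives
  \<open>v\<^sub>x\<close>, \<open>p\<^sub>x\<close> are determined by \<open>v\<close>, \<open>p\<close> up to null sets and carried along only
  because there is no canonical representative.
\<close>
type_synonym beam_traj =
  "(real \<Rightarrow> real \<Rightarrow> real) \<times> (real \<Rightarrow> real \<Rightarrow> real) \<times> (real \<Rightarrow> real \<Rightarrow> real) \<times>
   (real \<Rightarrow> real \<Rightarrow> real) \<times> (real \<Rightarrow> real \<Rightarrow> real) \<times> (real \<Rightarrow> real \<Rightarrow> real) \<times>
   (real \<Rightarrow> real \<times> real \<Rightarrow> real)"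

text \<open>\<open>C([0,\<infinity>), \<H>)\<close>\<close>
fun H_continuous :: "real \<Rightarrow> beam_traj \<Rightarrow> bool" where
  "H_continuous L (v, vx, vt, p, px, pt, z) \<longleftrightarrow>
     (\<forall>t\<ge>0. sobolev_deriv 0 L (v t) (vx t) \<and> v t 0 = 0 \<and>
            sobolev_deriv 0 L (p t) (px t) \<and> p t 0 = 0) \<and>
     L2_continuous {0..L} v \<and> L2_continuous {0..L} vx \<and> L2_continuous {0..L} vt \<and>
     L2_continuous {0..L} p \<and> L2_continuous {0..L} px \<and> L2_continuous {0..L} pt \<and>
     L2_continuous (rect L) z"

text \<open>Square of the product norm of \<open>\<H>\<close> of the difference of two trajectories at time \<open>t\<close>.\<close>
fun H_sqdist :: "real \<Rightarrow> beam_traj \<Rightarrow> beam_traj \<Rightarrow> real \<Rightarrow> real" where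
  "H_sqdist L (v, vx, vt, p, px, pt, z) (v', vx', vt', p', px', pt', z') t =
     L2_sqnorm {0..L} (\<lambda>x. v t x - v' t x) + L2_sqnorm {0..L} (\<lambda>x. vx t x - vx' t x) +
     L2_sqnorm {0..L} (\<lambda>x. vt t x - vt' t x) +
     L2_sqnorm {0..L} (\<lambda>x. p t x - p' t x) + L2_sqnorm {0..L} (\<lambda>x. px t x - px' t x) +
     L2_sqnorm {0..L} (\<lambda>x. pt t x - pt' t x) +
     L2_sqnorm (rect L) (\<lambda>q. z t q - z' t q)"

text \<open>
  \<open>C([0,\<infinity>), D) \<inter> C\<^sup>1([0,\<infinity>), \<H>)\<close>. Besides the components of the trajectory, the
  predicate exposes the spatial derivatives \<open>v\<^sub>x\<^sub>x, v\<^sub>t\<^sub>x, p\<^sub>x\<^sub>x, p\<^sub>t\<^sub>x, z\<^sub>r\<close> and the time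
  derivatives \<open>v\<^sub>t\<^sub>t, p\<^sub>t\<^sub>t, z\<^sub>t\<close>. That \<open>v\<close> is \<open>C\<^sup>1\<close> into \<open>H\<^sup>1\<close> with derivative \<open>v\<^sub>t\<close> is
  expressed by the pairs \<open>(v, v\<^sub>t)\<close> and \<open>(v\<^sub>x, v\<^sub>t\<^sub>x)\<close>.
\<close>
fun strong_regularity ::
  "real \<Rightarrow> beam_traj \<Rightarrow>
   (real \<Rightarrow> real \<Rightarrow> real) \<Rightarrow> (real \<Rightarrow> real \<Rightarrow> real) \<Rightarrow> (real \<Rightarrow> real \<Rightarrow> real) \<Rightarrow>
   (real \<Rightarrow> real \<Rightarrow> real) \<Rightarrow> (real \<Rightarrow> real \<Rightarrow> real) \<Rightarrow> (real \<Rightarrow> real \<Rightarrow> real) \<Rightarrow>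
   (real \<Rightarrow> real \<times> real \<Rightarrow> real) \<Rightarrow> (real \<Rightarrow> real \<times> real \<Rightarrow> real) \<Rightarrow> bool" where
  "strong_regularity L (v, vx, vt, p, px, pt, z) vxx vtx vtt pxx ptx ptt zr zt \<longleftrightarrow>
     (\<forall>t\<ge>0.
        sobolev_deriv 0 L (v t) (vx t) \<and> sobolev_deriv 0 L (vx t) (vxx t) \<and>
        sobolev_deriv 0 L (vt t) (vtx t) \<and> v t 0 = 0 \<and> vt t 0 = 0 \<and>
        sobolev_deriv 0 L (p t) (px t) \<and> sobolev_deriv 0 L (px t) (pxx t) \<and>
        sobolev_deriv 0 L (pt t) (ptx t) \<and> p t 0 = 0 \<and> pt t 0 = 0 \<and>
        (AE x in lebesgue_on {0..L}. sobolev_deriv 0 1 (\<lambda>r. z t (x, r)) (\<lambda>r. zr t (x, r))) \<and>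
        (AE x in lebesgue_on {0..L}. vt t x = z t (x, 0)) \<and>
        vx t L = 0 \<and> px t L = 0) \<and>
     L2_continuous {0..L} vxx \<and> L2_continuous {0..L} pxx \<and> L2_continuous (rect L) zr \<and>
     L2_C1 {0..L} v vt \<and> L2_C1 {0..L} vx vtx \<and> L2_C1 {0..L} vt vtt \<and>
     L2_C1 {0..L} p pt \<and> L2_C1 {0..L} px ptx \<and> L2_C1 {0..L} pt ptt \<and>
     L2_C1 (rect L) z zt"

text \<open>
  Strong solutions of the piezoelectric beam system with history \<open>g0\<close>. At \<open>t = 0\<close> the last
  conjunct is the initial condition \<open>z(x,r,0) = g0(x,-r\<tau>(0))\<close>; in general it is the identity
  \<open>z(x,r,t) = v\<^sub>t(x,t-\<tau>(t)r)\<close> that defines \<open>z\<close>.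
\<close>
fun strong_beam_solution ::
  "real \<Rightarrow> real \<Rightarrow> real \<Rightarrow> real \<Rightarrow> real \<Rightarrow> real \<Rightarrow> (real \<Rightarrow> real) \<Rightarrow> (real \<Rightarrow> real) \<Rightarrow>
   (real \<Rightarrow> real) \<Rightarrow> (real \<Rightarrow> real) \<Rightarrow> (real \<Rightarrow> real \<Rightarrow> real) \<Rightarrow> beam_traj \<Rightarrow> bool" where
  "strong_beam_solution L \<rho> \<alpha> \<gamma> \<mu> \<beta> \<tau> \<tau>' \<delta>1 \<delta>2 g0 (v, vx, vt, p, px, pt, z) \<longleftrightarrow>
     (\<exists>vxx vtx vtt pxx ptx ptt zr zt.
        strong_regularity L (v, vx, vt, p, px, pt, z) vxx vtx vtt pxx ptx ptt zr zt \<and>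
        (\<forall>t>0.
           (AE x in lebesgue_on {0..L}.
              \<rho> * vtt t x - \<alpha> * vxx t x + \<gamma> * \<beta> * pxx t x
                + \<delta>1 t * vt t x + \<delta>2 t * z t (x, 1) = 0) \<and>
           (AE x in lebesgue_on {0..L}.
              \<mu> * ptt t x - \<beta> * pxx t x + \<gamma> * \<beta> * vxx t x = 0) \<and>
           (AE (x, r) in lebesgue_on (rect L).
              \<tau> t * zt t (x, r) + (1 - \<tau>' t * r) * zr t (x, r) = 0) \<and>
           v t 0 = 0 \<and> \<alpha> * vx t L - \<gamma> * \<beta> * px t L = 0 \<and>
           p t 0 = 0 \<and> px t L - \<gamma> * vx t L = 0 \<and>
           (AE x in lebesgue_on {0..L}. z t (x, 0) = vt t x)) \<and>
        (\<forall>t\<ge>0. AE (x, r) in lebesgue_on (rect L).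
           z t (x, r) = velocity g0 vt (t - \<tau> t * r) x))"

text \<open>
  Solutions for initial data \<open>(v0, v1, p0, p1, g0(\<cdot>,-\<cdot>\<tau>(0))) \<in> \<H>\<close>: continuous \<open>\<H>\<close>-valued
  trajectories that are limits in \<open>\<H>\<close>, uniformly on bounded time intervals, of strong solutions
  (the continuous extension of the evolution operators from \<open>D\<close> to \<open>\<H>\<close>). Taking constant
  sequences one sees that strong solutions are included.
\<close>
fun beam_solution ::
  "real \<Rightarrow> real \<Rightarrow> real \<Rightarrow> real \<Rightarrow> real \<Rightarrow> real \<Rightarrow> (real \<Rightarrow> real) \<Rightarrow> (real \<Rightarrow> real) \<Rightarrow>
   (real \<Rightarrow> real) \<Rightarrow> (real \<Rightarrow> real) \<Rightarrow>
   (real \<Rightarrow> real) \<Rightarrow> (real \<Rightarrow> real) \<Rightarrow> (real \<Rightarrow> real) \<Rightarrow> (real \<Rightarrow> real) \<Rightarrow> (real \<Rightarrow> real \<Rightarrow> real) \<Rightarrow>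
   beam_traj \<Rightarrow> bool" where
  "beam_solution L \<rho> \<alpha> \<gamma> \<mu> \<beta> \<tau> \<tau>' \<delta>1 \<delta>2 v0 v1 p0 p1 g0 (v, vx, vt, p, px, pt, z) \<longleftrightarrow>
     H_continuous L (v, vx, vt, p, px, pt, z) \<and>
     (AE x in lebesgue_on {0..L}.
        v 0 x = v0 x \<and> p 0 x = p0 x \<and> vt 0 x = v1 x \<and> pt 0 x = p1 x) \<and>
     (AE (x, r) in lebesgue_on (rect L). z 0 (x, r) = g0 x (- r * \<tau> 0)) \<and>
     (\<exists>U g. (\<forall>n::nat. strong_beam_solution L \<rho> \<alpha> \<gamma> \<mu> \<beta> \<tau> \<tau>' \<delta>1 \<delta>2 (g n) (U n)) \<and>
        (\<forall>T>0. uniform_limit {0..T} (\<lambda>n. H_sqdist L (U n) (v, vx, vt, p, px, pt, z))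
                  (\<lambda>t. 0) sequentially))"

fun beam_energy ::
  "real \<Rightarrow> real \<Rightarrow> real \<Rightarrow> real \<Rightarrow> real \<Rightarrow> real \<Rightarrow> (real \<Rightarrow> real) \<Rightarrow> real \<Rightarrow> (real \<Rightarrow> real) \<Rightarrow>
   (real \<Rightarrow> real \<Rightarrow> real) \<Rightarrow> beam_traj \<Rightarrow> real \<Rightarrow> real" where
  "beam_energy L \<rho> \<mu> \<alpha>1 \<beta> \<gamma> \<xi> lam \<tau> g0 (v, vx, vt, p, px, pt, z) t =
     \<rho> / 2 * integral {0..L} (\<lambda>x. \<bar>vt t x\<bar>\<^sup>2) +
     \<mu> / 2 * integral {0..L} (\<lambda>x. \<bar>pt t x\<bar>\<^sup>2) +
     \<alpha>1 / 2 * integral {0..L} (\<lambda>x. \<bar>vx t x\<bar>\<^sup>2) +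
     \<beta> / 2 * integral {0..L} (\<lambda>x. \<bar>\<gamma> * vx t x - px t x\<bar>\<^sup>2) +
     \<xi> t / 2 * integral {t - \<tau> t..t}
       (\<lambda>s. integral {0..L} (\<lambda>x. exp (lam * (s - t)) * (velocity g0 vt s x)\<^sup>2))"

end

theory Submission
  imports Defs
begin

text \<open>
  For strong solutions the energy is dissipated at a rate comparable to
  \<open>\<parallel>v\<^sub>t\<parallel>\<^sup>2 + \<parallel>z(\<cdot>,1)\<parallel>\<^sup>2 + \<parallel>z\<parallel>\<^sup>2\<close>, where the memory is written in terms of \<open>z\<close> as
  \<open>\<tau>(t) \<integral>\<integral> (1 - \<eta> r) z\<^sup>2\<close> and differentiated by means of the transport equation. The functional
  \<open>K\<rho>\<langle>v,v\<^sub>t\<rangle> - N\<rho>\<langle>v\<^sub>t,p\<rangle> + Q\<mu>\<langle>p\<^sub>t,v\<rangle> - \<mu>\<langle>p,p\<^sub>t\<rangle>\<close>, with suitable \<open>K\<close>, \<open>N\<close>, \<open>Q\<close>, controls the missing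
  terms \<open>\<parallel>v\<^sub>x\<parallel>\<^sup>2 + \<parallel>p\<^sub>x\<parallel>\<^sup>2 + \<parallel>p\<^sub>t\<parallel>\<^sup>2\<close>: the coupling \<open>\<gamma>\<beta>\<close> transfers the damping of \<open>v\<close> to \<open>p\<close>. Adding a
  small multiple of it to the energy gives a Lyapunov functional equivalent to the squared norm of
  \<open>\<H>\<close>. The resulting decay of the norm passes to limits in \<open>\<H>\<close>. The delay term of the energy at time
  \<open>t\<close> is bounded by the decay of \<open>\<parallel>v\<^sub>t(s)\<parallel>\<^sup>2\<close> for \<open>s \<ge> 0\<close> and, while the delay still reaches
  negative times, by the norm of the initial history.
\<close>

subsection \<open>The space of square-integrable functions\<close>

text \<open>Two obstacles shape the argument. First, \<open>\<delta>2\<close> has no sign, so the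
  delayed force may feed energy into the beam. Young's inequality bounds its power by
  \<open>\<delta>1 * \<sigma> / 2\<close> times the squared norms of v_t and, with a factor 1 - d,
  of z(.,1), where sigma = beta0 / sqrt(1 - d). The memory term adds
  \<open>\<delta>1 * \<xi>bar / 2\<close> to the first and removes about as much from the second, so
  sigma < xibar < 2 - sigma makes both balances favourable. Half of the slack xibar - sigma is spent
  on the weight 1 - eta r, whose slope is what dissipates z itself. Second, a limit of strong
  solutions need not have a trace z(.,1), and its energy is written with g0, which
  \<open>beam_solution\<close> ties to z at time 0 only. Hence decay is proved for
  \<open>H_sqnorm\<close>, with constants independent of the solution so that it survives limits.
  The energy is compared with this norm from below at time 0 only, and from above through the past
  values of v_t.\<close>

definition L2_inner :: "'a::euclidean_space set \<Rightarrow> ('a \<Rightarrow> real) \<Rightarrow> ('a \<Rightarrow> real) \<Rightarrow> real" where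
  "L2_inner S u w = integral S (\<lambda>x. u x * w x)"

lemma L2_onD: "L2_on S u \<Longrightarrow> u \<in> borel_measurable (lebesgue_on S)"
  "L2_on S u \<Longrightarrow> (\<lambda>x. (u x)\<^sup>2) integrable_on S"
  by (auto simp: L2_on_def)

lemma L2_on_mult_integrable:
  assumes S: "S \<in> sets lebesgue" and u: "L2_on S u" and w: "L2_on S w"
  shows "(\<lambda>x. u x * w x) absolutely_integrable_on S"
proof (rule measurable_bounded_by_integrable_imp_absolutely_integrable)
  show "(\<lambda>x. u x * w x) \<in> borel_measurable (lebesgue_on S)"
    using u w by (auto dest!: L2_onD(1))
  show "(\<lambda>x. ((u x)\<^sup>2 + (w x)\<^sup>2) / 2) integrable_on S"
    using u w by (auto intro!: integrable_on_divide integrable_add dest!: L2_onD(2))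
  show "norm (u x * w x) \<le> ((u x)\<^sup>2 + (w x)\<^sup>2) / 2" for x
    using sum_squares_bound[of "\<bar>u x\<bar>" "\<bar>w x\<bar>"] by (simp add: abs_mult)
qed (fact S)

lemma L2_on_mult_integrable_on:
  "S \<in> sets lebesgue \<Longrightarrow> L2_on S u \<Longrightarrow> L2_on S w \<Longrightarrow> (\<lambda>x. u x * w x) integrable_on S"
  using L2_on_mult_integrable set_lebesgue_integral_eq_integral(1) by blast

lemma L2_on_add:
  assumes S: "S \<in> sets lebesgue" and u: "L2_on S u" and w: "L2_on S w"
  shows "L2_on S (\<lambda>x. u x + w x)"
proof -
  have "(\<lambda>x. (u x)\<^sup>2 + (w x)\<^sup>2 + 2 * (u x * w x)) integrable_on S"
    using L2_on_mult_integrable_on[OF S u w] u w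
    by (intro integrable_add) (auto dest!: L2_onD)
  then show ?thesis
    using u w by (auto simp: L2_on_def power2_sum mult.assoc)
qed

lemma L2_on_cmult:
  assumes "L2_on S u"
  shows "L2_on S (\<lambda>x. c * u x)"
  using assms by (auto simp: L2_on_def power_mult_distrib intro: integrable_on_mult_right)

lemma L2_on_diff:
  assumes S: "S \<in> sets lebesgue" and u: "L2_on S u" and w: "L2_on S w"
  shows "L2_on S (\<lambda>x. u x - w x)"
  using L2_on_add[OF S u L2_on_cmult[OF w, of "-1"]] by simp

lemma L2_on_bounded_mult:
  assumes S: "S \<in> sets lebesgue" and u: "L2_on S u"
    and k: "k \<in> borel_measurable (lebesgue_on S)" and B: "\<And>x. x \<in> S \<Longrightarrow> \<bar>k x\<bar> \<le> B"
  shows "L2_on S (\<lambda>x. k x * u x)"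
proof -
  have "(\<lambda>x. (k x * u x)\<^sup>2) absolutely_integrable_on S"
  proof (rule measurable_bounded_by_integrable_imp_absolutely_integrable)
    show "(\<lambda>x. (k x * u x)\<^sup>2) \<in> borel_measurable (lebesgue_on S)"
      using L2_onD(1)[OF u] k by measurable
    show "(\<lambda>x. B\<^sup>2 * (u x)\<^sup>2) integrable_on S"
      using u by (auto dest!: L2_onD(2) intro: integrable_on_mult_right)
    show "norm ((k x * u x)\<^sup>2) \<le> B\<^sup>2 * (u x)\<^sup>2" if "x \<in> S" for x
      using B[OF that] by (auto simp: power_mult_distrib intro!: mult_right_mono power2_le_iff_abs_le[THEN iffD2])
  qed (fact S)
  then show ?thesis
    using L2_onD(1)[OF u] k by (auto simp: L2_on_def dest: set_lebesgue_integral_eq_integral(1))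
qed

lemma L2_sqnorm_eq: "L2_sqnorm S u = L2_inner S u u"
  by (simp add: L2_sqnorm_def L2_inner_def power2_eq_square)

lemma L2_inner_commute: "L2_inner S u w = L2_inner S w u"
  by (simp add: L2_inner_def mult.commute)

lemma L2_sqnorm_nonneg: "L2_sqnorm S u \<ge> 0"
  \<comment> \<open>A square that is not integrable has the default integral 0, so no membership in
    L2 is required.\<close>
  unfolding L2_sqnorm_def by (cases "(\<lambda>x. (u x)\<^sup>2) integrable_on S")
    (auto simp: integral_nonneg not_integrable_integral)

lemma L2_inner_add_left:
  assumes "S \<in> sets lebesgue" "L2_on S u" "L2_on S u'" "L2_on S w"
  shows "L2_inner S (\<lambda>x. u x + u' x) w = L2_inner S u w + L2_inner S u' w"
  unfolding L2_inner_def distrib_right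
  by (intro Henstock_Kurzweil_Integration.integral_add L2_on_mult_integrable_on assms)

lemma L2_inner_diff_left:
  assumes "S \<in> sets lebesgue" "L2_on S u" "L2_on S u'" "L2_on S w"
  shows "L2_inner S (\<lambda>x. u x - u' x) w = L2_inner S u w - L2_inner S u' w"
  unfolding L2_inner_def left_diff_distrib
  by (intro Henstock_Kurzweil_Integration.integral_diff L2_on_mult_integrable_on assms)

lemma L2_inner_diff_right:
  assumes "S \<in> sets lebesgue" "L2_on S u" "L2_on S w" "L2_on S w'"
  shows "L2_inner S u (\<lambda>x. w x - w' x) = L2_inner S u w - L2_inner S u w'"
  using L2_inner_diff_left[OF assms(1) assms(3,4,2)] by (simp add: L2_inner_commute)

lemma L2_inner_cmult_left: "L2_inner S (\<lambda>x. c * u x) w = c * L2_inner S u w"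
  by (simp add: L2_inner_def mult.assoc)

lemma L2_inner_cmult_right: "L2_inner S u (\<lambda>x. c * w x) = c * L2_inner S u w"
  by (metis L2_inner_cmult_left L2_inner_commute)

lemma L2_sqnorm_add_cmult:
  assumes "S \<in> sets lebesgue" "L2_on S u" "L2_on S w"
  shows "L2_sqnorm S (\<lambda>x. u x + c * w x) = L2_sqnorm S u + 2 * c * L2_inner S u w + c\<^sup>2 * L2_sqnorm S w"
proof -
  let ?s = "\<lambda>x. u x + c * w x"
  have s: "L2_on S ?s"
    by (intro L2_on_add L2_on_cmult assms)
  have "L2_inner S ?s ?s = L2_inner S u ?s + c * L2_inner S w ?s"
    using L2_inner_add_left[OF assms(1,2) L2_on_cmult[OF assms(3)] s] by (simp add: L2_inner_cmult_left)
  moreover have "L2_inner S f ?s = L2_inner S f u + c * L2_inner S f w" if "L2_on S f" for f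
    using L2_inner_add_left[OF assms(1,2) L2_on_cmult[OF assms(3)] that]
    by (simp add: L2_inner_cmult_left L2_inner_commute[of S f])
  ultimately show ?thesis
    using assms L2_inner_commute[of S w u] by (simp add: L2_sqnorm_eq power2_eq_square algebra_simps)
qed

lemma L2_Cauchy_Schwarz:
  assumes "S \<in> sets lebesgue" "L2_on S u" "L2_on S w"
  shows "(L2_inner S u w)\<^sup>2 \<le> L2_sqnorm S u * L2_sqnorm S w"
proof -
  let ?a = "L2_sqnorm S u" and ?b = "L2_inner S u w" and ?c = "L2_sqnorm S w"
  have q: "0 \<le> ?a + 2 * t * ?b + t\<^sup>2 * ?c" for t
    using L2_sqnorm_nonneg[of S "\<lambda>x. u x + t * w x"] L2_sqnorm_add_cmult[OF assms] by simp
  show ?thesis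
  proof (cases "?c = 0")
    case True
    have "?b = 0"
    proof (rule ccontr)
      assume "?b \<noteq> 0"
      then show False
        \<comment> \<open>With vanishing norm of \<open>w\<close> the quadratic is affine in
          \<open>t\<close>; this \<open>t\<close> gives it the value -1.\<close>
        using q[of "- (?a + 1) / (2 * ?b)"] True by (simp add: field_simps)
    qed
    then show ?thesis using True by simp
  next
    case False
    then have "?c > 0" using L2_sqnorm_nonneg[of S w] by simp
    then show ?thesis
      \<comment> \<open>The minimiser of the quadratic.\<close>
      using q[of "- ?b / ?c"] by (simp add: field_simps power2_eq_square)
  qed
qed

lemma L2_inner_abs_le:
  assumes "S \<in> sets lebesgue" "L2_on S u" "L2_on S w"
  shows "\<bar>L2_inner S u w\<bar> \<le> sqrt (L2_sqnorm S u) * sqrt (L2_sqnorm S w)"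
  using real_sqrt_le_mono[OF L2_Cauchy_Schwarz[OF assms]] by (simp add: real_sqrt_mult)

lemma L2_inner_Young:
  assumes "S \<in> sets lebesgue" "L2_on S u" "L2_on S w" and "c > 0"
  shows "\<bar>L2_inner S u w\<bar> \<le> c / 2 * L2_sqnorm S u + 1 / (2 * c) * L2_sqnorm S w"
proof -
  \<comment> \<open>Expand the squared norm of u + (s/c) w; the choices s = 1 and s = -1 give the
    two halves of the absolute value.\<close>
  have "0 \<le> L2_sqnorm S u + 2 * (s / c) * L2_inner S u w + (s / c)\<^sup>2 * L2_sqnorm S w" for s
    using L2_sqnorm_nonneg[of S "\<lambda>x. u x + s / c * w x"] unfolding L2_sqnorm_add_cmult[OF assms(1-3)] .
  then have "0 \<le> c / 2 * (L2_sqnorm S u + 2 * (s / c) * L2_inner S u w + (s / c)\<^sup>2 * L2_sqnorm S w)" for s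
    using \<open>c > 0\<close> by (intro mult_nonneg_nonneg) auto
  moreover have "c / 2 * (L2_sqnorm S u + 2 * (s / c) * L2_inner S u w + (s / c)\<^sup>2 * L2_sqnorm S w)
      = c / 2 * L2_sqnorm S u + s * L2_inner S u w + s\<^sup>2 / (2 * c) * L2_sqnorm S w" for s
    using \<open>c > 0\<close> by (simp add: field_simps power2_eq_square)
  ultimately have "0 \<le> c / 2 * L2_sqnorm S u + s * L2_inner S u w + s\<^sup>2 / (2 * c) * L2_sqnorm S w" for s
    by metis
  from this[of 1] this[of "-1"] show ?thesis
    by (simp add: abs_le_iff)
qed

text \<open>Stated for an arbitrary filter because it serves continuity in time, difference
  quotients and limits of sequences of solutions. The error is expanded around (u, w), and each of
  its three terms is bounded by Cauchy-Schwarz.\<close>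

lemma L2_inner_tendsto:
  fixes S :: "'a::euclidean_space set"
  assumes S: "S \<in> sets lebesgue"
    and u: "L2_on S u" and w: "L2_on S w"
    and U: "\<forall>\<^sub>F i in F. L2_on S (U i)" and W: "\<forall>\<^sub>F i in F. L2_on S (W i)"
    and Uu: "((\<lambda>i. L2_sqnorm S (\<lambda>x. U i x - u x)) \<longlongrightarrow> 0) F"
    and Ww: "((\<lambda>i. L2_sqnorm S (\<lambda>x. W i x - w x)) \<longlongrightarrow> 0) F"
  shows "((\<lambda>i. L2_inner S (U i) (W i)) \<longlongrightarrow> L2_inner S u w) F"
proof -
  define a where "a i = sqrt (L2_sqnorm S (\<lambda>x. U i x - u x))" for i
  define b where "b i = sqrt (L2_sqnorm S (\<lambda>x. W i x - w x))" for i
  have "(a \<longlongrightarrow> 0) F" "(b \<longlongrightarrow> 0) F"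
    using tendsto_real_sqrt[OF Uu] tendsto_real_sqrt[OF Ww] by (simp_all add: a_def[abs_def] b_def[abs_def])
  then have lim: "((\<lambda>i. a i * b i + a i * sqrt (L2_sqnorm S w) + sqrt (L2_sqnorm S u) * b i) \<longlongrightarrow> 0) F"
    by (auto intro!: tendsto_eq_intros)
  have "\<forall>\<^sub>F i in F. norm (L2_inner S (U i) (W i) - L2_inner S u w)
          \<le> a i * b i + a i * sqrt (L2_sqnorm S w) + sqrt (L2_sqnorm S u) * b i"
    using U W
  proof eventually_elim
    case (elim i)
    note d = L2_on_diff[OF S elim(1) u] L2_on_diff[OF S elim(2) w]
    have "L2_inner S (U i) (W i) - L2_inner S u w =
        L2_inner S (\<lambda>x. U i x - u x) (\<lambda>x. W i x - w x) + L2_inner S (\<lambda>x. U i x - u x) w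
        + L2_inner S u (\<lambda>x. W i x - w x)"
      using elim u w d by (simp add: L2_inner_diff_left L2_inner_diff_right S)
    then show ?case
      using L2_inner_abs_le[OF S d] L2_inner_abs_le[OF S d(1) w] L2_inner_abs_le[OF S u d(2)]
      by (simp add: a_def b_def)
  qed
  from Lim_null_comparison[OF this lim]
  have "((\<lambda>i. L2_inner S (U i) (W i) - L2_inner S u w) \<longlongrightarrow> 0) F"
    by simp
  then show ?thesis by (simp add: LIM_zero_iff)
qed

section \<open>Inner products of curves in L2\<close>

lemma L2_continuousD:
  assumes "L2_continuous S u" "t \<ge> 0"
  shows "L2_on S (u t)"
    and "((\<lambda>s. L2_sqnorm S (\<lambda>x. u s x - u t x)) \<longlongrightarrow> 0) (at t within {0..})"
  using assms by (auto simp: L2_continuous_def)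

lemma eventually_at_within_nonneg:
  "(\<And>s. s \<ge> 0 \<Longrightarrow> s \<noteq> t \<Longrightarrow> P s) \<Longrightarrow> \<forall>\<^sub>F s in at t within {0::real..}. P s"
  by (auto simp: eventually_at intro!: exI[of _ 1])

lemma L2_inner_continuous:
  assumes S: "S \<in> sets lebesgue" and u: "L2_continuous S u" and w: "L2_continuous S w"
  shows "continuous_on {0..} (\<lambda>t. L2_inner S (u t) (w t))"
  unfolding continuous_on_def
  using S u w
  by (auto intro!: L2_inner_tendsto eventually_at_within_nonneg dest: L2_continuousD)

lemma L2_C1D:
  assumes "L2_C1 S u u'"
  shows "L2_continuous S u" "L2_continuous S u'"
    and "t \<ge> 0 \<Longrightarrow> ((\<lambda>s. L2_sqnorm S (\<lambda>x. (u s x - u t x) / (s - t) - u' t x)) \<longlongrightarrow> 0) (at t within {0..})"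
  using assms by (auto simp: L2_C1_def)

text \<open>The difference quotient splits exactly as <Du(s), w(s)> + <u(t), Dw(s)>, with the new
  value of w in one term and the old value of u in the other; continuity of the inner product does
  the rest.\<close>

lemma L2_inner_has_derivative:
  assumes S: "S \<in> sets lebesgue" and u: "L2_C1 S u u'" and w: "L2_C1 S w w'" and t: "t \<ge> 0"
  shows "((\<lambda>t. L2_inner S (u t) (w t)) has_real_derivative
           (L2_inner S (u' t) (w t) + L2_inner S (u t) (w' t))) (at t within {0..})"
proof -
  note u12 = L2_C1D(1,2)[OF u] and w12 = L2_C1D(1,2)[OF w]
  note on = L2_continuousD(1)[OF u12(1)] L2_continuousD(1)[OF u12(2)]
    L2_continuousD(1)[OF w12(1)] L2_continuousD(1)[OF w12(2)]
  define Du where "Du s x = (u s x - u t x) / (s - t)" for s x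
  define Dw where "Dw s x = (w s x - w t x) / (s - t)" for s x
  have Du: "L2_on S (Du s)" and Dw: "L2_on S (Dw s)" if "s \<ge> 0" for s
    unfolding Du_def Dw_def
    using L2_on_cmult[OF L2_on_diff[OF S on(1)[OF that] on(1)[OF t]], of "1 / (s - t)"]
      L2_on_cmult[OF L2_on_diff[OF S on(3)[OF that] on(3)[OF t]], of "1 / (s - t)"] by simp_all
  have "((\<lambda>s. L2_inner S (Du s) (w s)) \<longlongrightarrow> L2_inner S (u' t) (w t)) (at t within {0..})"
    using L2_C1D(3)[OF u t] L2_continuousD(2)[OF w12(1) t]
    by (intro L2_inner_tendsto eventually_at_within_nonneg) (auto simp: Du_def[symmetric] S t on Du)
  moreover have "((\<lambda>s. L2_inner S (u t) (Dw s)) \<longlongrightarrow> L2_inner S (u t) (w' t)) (at t within {0..})"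
    using L2_C1D(3)[OF w t]
    by (intro L2_inner_tendsto eventually_at_within_nonneg)
      (auto simp: Dw_def[symmetric] S t on Dw L2_sqnorm_def)
  ultimately have lim: "((\<lambda>s. L2_inner S (Du s) (w s) + L2_inner S (u t) (Dw s)) \<longlongrightarrow>
      L2_inner S (u' t) (w t) + L2_inner S (u t) (w' t)) (at t within {0..})"
    by (rule tendsto_add)
  have "\<forall>\<^sub>F s in at t within {0..}. L2_inner S (Du s) (w s) + L2_inner S (u t) (Dw s) =
      (L2_inner S (u s) (w s) - L2_inner S (u t) (w t)) / (s - t)"
  proof (rule eventually_at_within_nonneg)
    fix s :: real assume s: "s \<ge> 0" "s \<noteq> t"
    have "L2_inner S (Du s) (w s) = 1 / (s - t) * (L2_inner S (u s) (w s) - L2_inner S (u t) (w s))"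
      using L2_inner_cmult_left[of S "1 / (s - t)" "\<lambda>x. u s x - u t x" "w s"]
      by (simp add: Du_def[abs_def] L2_inner_diff_left S on s t)
    moreover have "L2_inner S (u t) (Dw s) = 1 / (s - t) * (L2_inner S (u t) (w s) - L2_inner S (u t) (w t))"
      using L2_inner_cmult_right[of S "u t" "1 / (s - t)" "\<lambda>x. w s x - w t x"]
      by (simp add: Dw_def[abs_def] L2_inner_diff_right S on s t)
    ultimately show "L2_inner S (Du s) (w s) + L2_inner S (u t) (Dw s) =
      (L2_inner S (u s) (w s) - L2_inner S (u t) (w t)) / (s - t)"
      by (simp add: diff_divide_distrib)
  qed
  with lim show ?thesis
    unfolding has_field_derivative_iff by (rule Lim_transform_eventually)
qed

text \<open>Multiplication by k is a linear operator on L2 of norm at most B, and such operators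
  preserve C^1 curves.\<close>

lemma L2_C1_bounded_mult:
  assumes S: "S \<in> sets lebesgue" and u: "L2_C1 S u u'"
    and k: "k \<in> borel_measurable (lebesgue_on S)" and B: "\<And>x. x \<in> S \<Longrightarrow> \<bar>k x\<bar> \<le> B"
  shows "L2_C1 S (\<lambda>t x. k x * u t x) (\<lambda>t x. k x * u' t x)"
proof -
  note u12 = L2_C1D(1,2)[OF u]
  note on = L2_continuousD(1)[OF u12(1)] L2_continuousD(1)[OF u12(2)]
  have le: "L2_sqnorm S (\<lambda>x. k x * f x) \<le> B\<^sup>2 * L2_sqnorm S f" if f: "L2_on S f" for f
  proof -
    have "integral S (\<lambda>x. (k x * f x)\<^sup>2) \<le> integral S (\<lambda>x. B\<^sup>2 * (f x)\<^sup>2)"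
    proof (rule integral_le)
      show "(\<lambda>x. (k x * f x)\<^sup>2) integrable_on S"
        using L2_onD(2)[OF L2_on_bounded_mult[OF S f k B]] by auto
      show "(k x * f x)\<^sup>2 \<le> B\<^sup>2 * (f x)\<^sup>2" if "x \<in> S" for x
        using B[OF that] by (auto simp: power_mult_distrib intro!: mult_right_mono power2_le_iff_abs_le[THEN iffD2])
    qed (use L2_onD(2)[OF f] in \<open>auto intro: integrable_on_mult_right\<close>)
    then show ?thesis by (simp add: L2_sqnorm_def)
  qed
  have lim: "((\<lambda>s. L2_sqnorm S (\<lambda>x. k x * f s x)) \<longlongrightarrow> 0) (at t within {0..})"
    if "((\<lambda>s. L2_sqnorm S (f s)) \<longlongrightarrow> 0) (at t within {0..})" "\<And>s. s \<ge> 0 \<Longrightarrow> L2_on S (f s)" for f and t :: real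
  proof (rule tendsto_sandwich[where f = "\<lambda>_. 0"])
    show "((\<lambda>s. B\<^sup>2 * L2_sqnorm S (f s)) \<longlongrightarrow> 0) (at t within {0..})"
      using tendsto_mult_right_zero[OF that(1)] by simp
    show "\<forall>\<^sub>F s in at t within {0..}. L2_sqnorm S (\<lambda>x. k x * f s x) \<le> B\<^sup>2 * L2_sqnorm S (f s)"
      by (rule eventually_at_within_nonneg) (use le that(2) in blast)
  qed (simp_all add: L2_sqnorm_nonneg)
  have cont: "L2_continuous S (\<lambda>t x. k x * f t x)" if "L2_continuous S f" for f
    unfolding L2_continuous_def
  proof (intro conjI allI impI)
    fix t :: real assume t: "0 \<le> t"
    show "L2_on S (\<lambda>x. k x * f t x)"
      by (intro L2_on_bounded_mult[OF S _ k B] L2_continuousD(1)[OF that t])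
    have "((\<lambda>s. L2_sqnorm S (\<lambda>x. k x * (f s x - f t x))) \<longlongrightarrow> 0) (at t within {0..})"
      by (intro lim L2_continuousD[OF that] L2_on_diff S t)
    then show "((\<lambda>s. L2_sqnorm S (\<lambda>x. k x * f s x - k x * f t x)) \<longlongrightarrow> 0) (at t within {0..})"
      by (simp add: right_diff_distrib)
  qed
  show ?thesis
    unfolding L2_C1_def
  proof (intro conjI allI impI cont u12)
    fix t :: real assume t: "0 \<le> t"
    have "L2_on S (\<lambda>x. (u s x - u t x) / (s - t) - u' t x)" if "s \<ge> 0" for s
      using L2_on_diff[OF S L2_on_cmult[OF L2_on_diff[OF S on(1)[OF that] on(1)[OF t]], of "1 / (s - t)"] on(2)[OF t]]
      by simp
    from lim[OF L2_C1D(3)[OF u t] this]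
    show "((\<lambda>s. L2_sqnorm S (\<lambda>x. (k x * u s x - k x * u t x) / (s - t) - k x * u' t x)) \<longlongrightarrow> 0)
        (at t within {0..})"
      by (simp add: algebra_simps diff_divide_distrib)
  qed
qed

subsection \<open>Iterated Lebesgue integrals\<close>

text \<open>Gauge integrals may be altered on negligible sets; this turns an almost-everywhere
  statement into such a set.\<close>

lemma AE_lebesgue_onE:
  assumes "AE x in lebesgue_on S. P x" and S: "S \<in> sets lebesgue"
  obtains N where "negligible N" "\<And>x. x \<in> S - N \<Longrightarrow> P x"
proof -
  have "AE x in lebesgue. x \<in> S \<longrightarrow> P x"
    using assms by (simp add: AE_restrict_space_iff)
  then obtain N where "N \<in> null_sets lebesgue" "{x \<in> space lebesgue. \<not> (x \<in> S \<longrightarrow> P x)} \<subseteq> N"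
    by (elim AE_E) (blast intro: null_setsI)
  then show thesis
    by (intro that[of N]) (auto simp: negligible_iff_null_sets)
qed

lemma integral_cong_AE_on:
  fixes f g :: "'a::euclidean_space \<Rightarrow> 'b::banach"
  assumes "AE x in lebesgue_on S. f x = g x" "S \<in> sets lebesgue"
  shows "integral S f = integral S g"
  using AE_lebesgue_onE[OF assms] integral_spike by metis

lemma absolutely_integrable_cong_AE_on:
  fixes f g :: "'a::euclidean_space \<Rightarrow> 'b::euclidean_space"
  assumes "f absolutely_integrable_on S" "AE x in lebesgue_on S. f x = g x" "S \<in> sets lebesgue"
  shows "g absolutely_integrable_on S"
  using AE_lebesgue_onE[OF assms(2,3)] absolutely_integrable_spike[OF assms(1)] by metis

lemma integrable_lebesgue_cong_AE_lborel:
  fixes f g :: "'a::euclidean_space \<Rightarrow> real"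
  assumes f: "integrable lborel f" and eq: "AE x in lborel. g x = f x"
  shows "integrable lebesgue g" and "integral\<^sup>L lebesgue g = integral\<^sup>L lborel f"
proof -
  have [measurable]: "f \<in> borel_measurable lborel" using f by auto
  have m: "f \<in> borel_measurable lebesgue"
    using borel_measurable_integrable[OF f] by (rule measurable_completion)
  have eq': "AE x in lebesgue. f x = g x"
    using eq by (intro AE_completion) auto
  have g: "g \<in> borel_measurable lebesgue"
    using borel_measurable_AE[OF m eq'] .
  have "integrable lebesgue f" using f by (simp add: integrable_completion)
  then show "integrable lebesgue g"
    using integrable_cong_AE[OF m g eq'] by simp
  show "integral\<^sup>L lebesgue g = integral\<^sup>L lborel f"
    using integral_cong_AE[OF m g eq'] by (simp add: integral_completion)
qed

text \<open>Lebesgue measure on the product is the completion of the product of the Borel measures,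
  so Fubini is applied to a Borel function \<open>f\<close> equal to \<open>G\<close> almost
  everywhere. For almost every section the two agree almost everywhere, which carries the
  conclusions back to \<open>G\<close>.\<close>

lemma lebesgue_Fubini:
  fixes G :: "'a::euclidean_space \<times> 'b::euclidean_space \<Rightarrow> real"
  assumes G: "integrable lebesgue G"
  shows "AE x in lebesgue. integrable lebesgue (\<lambda>y. G (x, y))"
    and "integrable lebesgue (\<lambda>x. \<integral>y. G (x, y) \<partial>lebesgue)"
    and "(\<integral>x. \<integral>y. G (x, y) \<partial>lebesgue \<partial>lebesgue) = integral\<^sup>L lebesgue G"
    and "AE y in lebesgue. integrable lebesgue (\<lambda>x. G (x, y))"
    and "integrable lebesgue (\<lambda>y. \<integral>x. G (x, y) \<partial>lebesgue)"
    and "(\<integral>y. \<integral>x. G (x, y) \<partial>lebesgue \<partial>lebesgue) = integral\<^sup>L lebesgue G"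
proof -
  obtain f where f: "f \<in> borel_measurable lborel" and eq: "AE z in lborel. G z = f z"
    using completion_ex_borel_measurable_real[OF borel_measurable_integrable[OF G]] by blast
  have eq': "AE z in lebesgue. G z = f z"
    using eq by (rule AE_completion)
  have fl: "f \<in> borel_measurable lebesgue"
    using f by (rule measurable_completion)
  have "integrable lebesgue f"
    using G integrable_cong_AE[OF borel_measurable_integrable[OF G] fl eq'] by simp
  then have int: "integrable lborel f"
    using f by (simp add: integrable_completion)
  have Gf: "integral\<^sup>L lebesgue G = integral\<^sup>L lborel f"
    using integrable_lebesgue_cong_AE_lborel(2)[OF int eq] .
  have intp: "integrable (lborel \<Otimes>\<^sub>M lborel) (case_prod (\<lambda>x y. f (x, y)))"
    and eqp: "AE z in lborel \<Otimes>\<^sub>M lborel. G z = f z"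
    using int eq unfolding lborel_prod by simp_all
  \<comment> \<open>The exceptional null set is swapped as well, to slice it in the other
    direction.\<close>
  have eqs: "AE z in lborel \<Otimes>\<^sub>M lborel. G (snd z, fst z) = f (snd z, fst z)"
  proof -
    have "AE z in distr (lborel \<Otimes>\<^sub>M lborel) (lborel \<Otimes>\<^sub>M lborel) (\<lambda>(x, y). (y, x)). G z = f z"
      using eqp lborel_pair.distr_pair_swap by metis
    from AE_distrD[OF measurable_pair_swap' this]
    show ?thesis by (auto simp: case_prod_beta)
  qed
  have 1: "AE x in lborel. AE y in lborel. G (x, y) = f (x, y)"
    using lborel_pair.AE_pair[OF eqp] .
  have 2: "AE y in lborel. AE x in lborel. G (x, y) = f (x, y)"
    using lborel_pair.AE_pair[OF eqs] by simp
  note fst = lborel_pair.AE_integrable_fst[OF intp] lborel_pair.integrable_fst[OF intp]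
    lborel_pair.integral_fst[OF intp]
  note snd = lborel_pair.AE_integrable_snd[OF intp] lborel_pair.integrable_snd[OF intp]
    lborel_pair.integral_snd[OF intp]
  have "AE x in lborel. integrable lebesgue (\<lambda>y. G (x, y)) \<and>
      (\<integral>y. G (x, y) \<partial>lebesgue) = (\<integral>y. f (x, y) \<partial>lborel)"
    using 1 fst(1) by eventually_elim (auto intro: integrable_lebesgue_cong_AE_lborel)
  then have a: "AE x in lborel. integrable lebesgue (\<lambda>y. G (x, y))"
    and b: "AE x in lborel. (\<integral>y. G (x, y) \<partial>lebesgue) = (\<integral>y. f (x, y) \<partial>lborel)"
    by auto
  have "AE y in lborel. integrable lebesgue (\<lambda>x. G (x, y)) \<and>
      (\<integral>x. G (x, y) \<partial>lebesgue) = (\<integral>x. f (x, y) \<partial>lborel)"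
    using 2 snd(1) by eventually_elim (auto intro: integrable_lebesgue_cong_AE_lborel)
  then have c: "AE y in lborel. integrable lebesgue (\<lambda>x. G (x, y))"
    and d: "AE y in lborel. (\<integral>x. G (x, y) \<partial>lebesgue) = (\<integral>x. f (x, y) \<partial>lborel)"
    by auto
  show "AE x in lebesgue. integrable lebesgue (\<lambda>y. G (x, y))"
    "AE y in lebesgue. integrable lebesgue (\<lambda>x. G (x, y))"
    using a c by (auto intro: AE_completion)
  show "integrable lebesgue (\<lambda>x. \<integral>y. G (x, y) \<partial>lebesgue)"
    "(\<integral>x. \<integral>y. G (x, y) \<partial>lebesgue \<partial>lebesgue) = integral\<^sup>L lebesgue G"
    using integrable_lebesgue_cong_AE_lborel[OF fst(2) b] fst(3) by (simp_all add: Gf lborel_prod)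
  show "integrable lebesgue (\<lambda>y. \<integral>x. G (x, y) \<partial>lebesgue)"
    "(\<integral>y. \<integral>x. G (x, y) \<partial>lebesgue \<partial>lebesgue) = integral\<^sup>L lebesgue G"
    using integrable_lebesgue_cong_AE_lborel[OF snd(2) d] snd(3) by (simp_all add: Gf lborel_prod)
qed

text \<open>For x in A the integrand is the one defining the integral over B, and for other x it is
  zero. The nested indicators thus translate an iterated integral over the whole space into iterated
  integrals over A and B, in either order of the variables.\<close>

lemma absolutely_integrable_iterated:
  fixes H :: "'a::euclidean_space \<Rightarrow> 'b::euclidean_space \<Rightarrow> real"
  assumes A: "A \<in> sets lebesgue"
    and ae: "AE x in lebesgue. integrable lebesgue (\<lambda>y. indicator A x * (indicator B y * H x y))"
    and int: "integrable lebesgue (\<lambda>x. \<integral>y. indicator A x * (indicator B y * H x y) \<partial>lebesgue)"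
  shows "AE x in lebesgue_on A. H x absolutely_integrable_on B"
    and "(\<lambda>x. integral B (H x)) absolutely_integrable_on A"
    and "integral A (\<lambda>x. integral B (H x)) =
           (\<integral>x. \<integral>y. indicator A x * (indicator B y * H x y) \<partial>lebesgue \<partial>lebesgue)"
proof -
  have "AE x in lebesgue. x \<in> A \<longrightarrow> H x absolutely_integrable_on B"
    using ae by eventually_elim (auto simp: set_integrable_def)
  then show ae': "AE x in lebesgue_on A. H x absolutely_integrable_on B"
    using A by (simp add: AE_restrict_space_iff)
  let ?I = "\<lambda>x. \<integral>y. indicator A x * (indicator B y * H x y) \<partial>lebesgue"
  have I: "set_integrable lebesgue A ?I"
    unfolding set_integrable_def real_scaleR_def
    using int by (rule Bochner_Integration.integrable_cong[THEN iffD1, rotated -1])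
       (auto simp: indicator_def)
  have "AE x in lebesgue_on A. ?I x = integral B (H x)"
  proof -
    have *: "AE x in lebesgue_on A. x \<in> A"
      using A by (simp add: AE_restrict_space_iff)
    show ?thesis
      using ae' *
    proof eventually_elim
      case (elim x)
      then show ?case
        using set_lebesgue_integral_eq_integral(2)[OF elim(1)]
        by (simp add: set_lebesgue_integral_def)
    qed
  qed
  note eq = this
  show "(\<lambda>x. integral B (H x)) absolutely_integrable_on A"
    using absolutely_integrable_cong_AE_on[OF I eq A] .
  have "integral A (\<lambda>x. integral B (H x)) = integral A ?I"
    using integral_cong_AE_on[OF eq A] by simp
  also have "\<dots> = (LINT x:A|lebesgue. ?I x)"
    using set_lebesgue_integral_eq_integral(2)[OF I] by simp
  also have "\<dots> = (\<integral>x. ?I x \<partial>lebesgue)"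
    unfolding set_lebesgue_integral_def
    by (rule Bochner_Integration.integral_cong) (auto simp: indicator_def)
  finally show "integral A (\<lambda>x. integral B (H x)) = (\<integral>x. ?I x \<partial>lebesgue)" .
qed

lemma absolutely_integrable_Fubini:
  fixes F :: "'a::euclidean_space \<times> 'b::euclidean_space \<Rightarrow> real"
  assumes F: "F absolutely_integrable_on A \<times> B" and A: "A \<in> sets lebesgue" and B: "B \<in> sets lebesgue"
  shows "AE x in lebesgue_on A. (\<lambda>y. F (x, y)) absolutely_integrable_on B"
    and "(\<lambda>x. integral B (\<lambda>y. F (x, y))) absolutely_integrable_on A"
    and "integral A (\<lambda>x. integral B (\<lambda>y. F (x, y))) = integral (A \<times> B) F"
    and "AE y in lebesgue_on B. (\<lambda>x. F (x, y)) absolutely_integrable_on A"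
    and "(\<lambda>y. integral A (\<lambda>x. F (x, y))) absolutely_integrable_on B"
    and "integral B (\<lambda>y. integral A (\<lambda>x. F (x, y))) = integral (A \<times> B) F"
proof -
  let ?G = "\<lambda>z. indicator (A \<times> B) z *\<^sub>R F z"
  have G: "integrable lebesgue ?G"
    using F by (simp add: set_integrable_def)
  have I: "integral\<^sup>L lebesgue ?G = integral (A \<times> B) F"
    using set_lebesgue_integral_eq_integral(2)[OF F] by (simp add: set_lebesgue_integral_def)
  have G1: "?G (x, y) = indicator A x * (indicator B y * F (x, y))"
    and G2: "?G (x, y) = indicator B y * (indicator A x * F (x, y))" for x y
    by (auto simp: indicator_def)
  note f = lebesgue_Fubini[OF G, unfolded I]
  from absolutely_integrable_iterated[OF A f(1,2)[unfolded G1]] f(3)[unfolded G1]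
  show "AE x in lebesgue_on A. (\<lambda>y. F (x, y)) absolutely_integrable_on B"
    "(\<lambda>x. integral B (\<lambda>y. F (x, y))) absolutely_integrable_on A"
    "integral A (\<lambda>x. integral B (\<lambda>y. F (x, y))) = integral (A \<times> B) F"
    by simp_all
  from absolutely_integrable_iterated[OF B f(4,5)[unfolded G2]] f(6)[unfolded G2]
  show "AE y in lebesgue_on B. (\<lambda>x. F (x, y)) absolutely_integrable_on A"
    "(\<lambda>y. integral A (\<lambda>x. F (x, y))) absolutely_integrable_on B"
    "integral B (\<lambda>y. integral A (\<lambda>x. F (x, y))) = integral (A \<times> B) F"
    by simp_all
qed

subsection \<open>Absolutely continuous functions\<close>

lemma sobolev_derivD:
  assumes u: "sobolev_deriv a b u g"
  shows "g absolutely_integrable_on {a..b}"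
    and "a \<le> x \<Longrightarrow> x \<le> y \<Longrightarrow> y \<le> b \<Longrightarrow> integral {x..y} g = u y - u x"
    and "continuous_on {a..b} u"
proof -
  show g: "g absolutely_integrable_on {a..b}"
    using u by (simp add: sobolev_deriv_def)
  then have gi: "g integrable_on {a..b}"
    using set_lebesgue_integral_eq_integral(1) by blast
  have eq: "u x = u a + integral {a..x} g" if "x \<in> {a..b}" for x
    using u that unfolding sobolev_deriv_def by blast
  show "integral {x..y} g = u y - u x" if "a \<le> x" "x \<le> y" "y \<le> b"
  proof -
    have "g integrable_on {a..y}"
      using gi by (rule integrable_on_subinterval) (use that in auto)
    from Henstock_Kurzweil_Integration.integral_combine[OF that(1,2) this]
    have "integral {a..x} g + integral {x..y} g = integral {a..y} g" .
    moreover have "u x = u a + integral {a..x} g" "u y = u a + integral {a..y} g"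
      by (rule eq, use that in simp)+
    ultimately show ?thesis by linarith
  qed
  have "continuous_on {a..b} (\<lambda>x. u a + integral {a..x} g)"
    by (intro continuous_intros indefinite_integral_continuous_1 gi)
  then show "continuous_on {a..b} u"
    by (rule continuous_on_eq) (simp add: eq[symmetric])
qed

lemma absolutely_integrable_continuous_mult:
  fixes g w :: "real \<Rightarrow> real"
  assumes "g absolutely_integrable_on {a..b}" "continuous_on {a..b} w"
  shows "(\<lambda>x. w x * g x) absolutely_integrable_on {a..b}"
  using assms
  by (intro absolutely_integrable_bounded_measurable_product_real)
    (auto intro: continuous_imp_measurable_on_sets_lebesgue compact_imp_bounded compact_continuous_image)

text \<open>
  On a short interval around a point the defect of the product rule is small compared to the
  integral of \<open>\<bar>g\<bar> + \<bar>h\<bar>\<close>, and this estimate is additive under concatenation of intervals.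
\<close>
lemma sobolev_deriv_mult:
  assumes u: "sobolev_deriv a b u g" and w: "sobolev_deriv a b w h"
  shows "sobolev_deriv a b (\<lambda>x. u x * w x) (\<lambda>x. g x * w x + u x * h x)"
proof -
  note U = sobolev_derivD[OF u] and W = sobolev_derivD[OF w]
  define k where "k x = g x * w x + u x * h x" for x
  define m where "m x = \<bar>g x\<bar> + \<bar>h x\<bar>" for x
  have gw: "(\<lambda>x. g x * w x) absolutely_integrable_on {a..b}"
    using absolutely_integrable_continuous_mult[OF U(1) W(3)] by (simp add: mult.commute)
  have uh: "(\<lambda>x. u x * h x) absolutely_integrable_on {a..b}"
    using absolutely_integrable_continuous_mult[OF W(1) U(3)] .
  have k: "k absolutely_integrable_on {a..b}"
    unfolding k_def[abs_def] using gw uh by (rule set_integral_add)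
  have int: "f integrable_on {p..q}" if "f absolutely_integrable_on {a..b}" "a \<le> p" "q \<le> b"
    for f :: "real \<Rightarrow> real" and p q
    by (rule integrable_on_subinterval[OF set_lebesgue_integral_eq_integral(1)[OF that(1)]]) (use that in auto)
  have m: "m absolutely_integrable_on {a..b}"
    unfolding m_def[abs_def] using U(1) W(1)
    by (intro set_integral_add) (auto intro: set_integrable_abs)
  have main: "\<bar>u x * w x - u a * w a - integral {a..x} k\<bar> \<le> e * integral {a..x} m"
    if e: "e > 0" and x: "a \<le> x" "x \<le> b" for e x
  proof -
    \<comment> \<open>Being an implication, \<open>P\<close> holds vacuously for subintervals that
      leave [a,b], as the bisection argument ranges over all of them.\<close>
    define P where "P p q \<longleftrightarrow> (a \<le> p \<longrightarrow> p \<le> q \<longrightarrow> q \<le> b \<longrightarrow>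
      \<bar>u q * w q - u p * w p - integral {p..q} k\<bar> \<le> e * integral {p..q} m)" for p q
    have "P a x"
      using x(1)
    proof (induction rule: Bolzano)
      case (trans p q r)
      show ?case
        unfolding P_def
      proof (intro impI)
        assume *: "a \<le> p" "p \<le> r" "r \<le> b"
        have "integral {p..q} k + integral {q..r} k = integral {p..r} k"
          "integral {p..q} m + integral {q..r} m = integral {p..r} m"
          using trans * by (auto intro!: Henstock_Kurzweil_Integration.integral_combine int k m)
        then show "\<bar>u r * w r - u p * w p - integral {p..r} k\<bar> \<le> e * integral {p..r} m"
          using trans * by (auto simp: P_def distrib_left simp flip: \<open>integral {p..q} m + integral {q..r} m = _\<close>)
      qed
    next
      case (local y)
      then have y: "y \<in> {a..b}" using x by auto
      obtain d1 where d1: "d1 > 0" "\<And>s. s \<in> {a..b} \<Longrightarrow> dist s y < d1 \<Longrightarrow> dist (u s) (u y) < e / 2"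
        using U(3) y e unfolding continuous_on_iff by (meson half_gt_zero)
      obtain d2 where d2: "d2 > 0" "\<And>s. s \<in> {a..b} \<Longrightarrow> dist s y < d2 \<Longrightarrow> dist (w s) (w y) < e / 2"
        using W(3) y e unfolding continuous_on_iff by (meson half_gt_zero)
      show ?case
        unfolding P_def
      proof (intro exI[of _ "min d1 d2"] conjI allI impI)
        fix p q assume pq: "p \<le> y \<and> y \<le> q \<and> q - p < min d1 d2" and pq': "a \<le> p" "p \<le> q" "q \<le> b"
        have osc: "\<bar>w q - w s\<bar> \<le> e" "\<bar>u p - u s\<bar> \<le> e" if "s \<in> {p..q}" for s
        proof -
          have "\<bar>s - y\<bar> < d1" "\<bar>p - y\<bar> < d1" "\<bar>s - y\<bar> < d2" "\<bar>q - y\<bar> < d2"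
            "s \<in> {a..b}" "p \<in> {a..b}" "q \<in> {a..b}"
            using that pq pq' by auto
          then show "\<bar>w q - w s\<bar> \<le> e" "\<bar>u p - u s\<bar> \<le> e"
            using d1(2)[of s] d1(2)[of p] d2(2)[of s] d2(2)[of q] unfolding dist_real_def by linarith+
        qed
        have sub: "set_integrable lebesgue {p..q} f" if "f absolutely_integrable_on {a..b}" for f :: "real \<Rightarrow> real"
          by (rule set_integrable_subset[OF that]) (use pq' in auto)
        \<comment> \<open>The increment is (u q - u p) w q + u p (w q - w p), so the defect
          integrand contains only oscillations of u and w on [p,q], each at most e.\<close>
        have "u q * w q - u p * w p = integral {p..q} g * w q + u p * integral {p..q} h"
          unfolding U(2)[OF pq'] W(2)[OF pq'] by (simp add: algebra_simps)
        also have "\<dots> = integral {p..q} (\<lambda>s. g s * w q + u p * h s)"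
          using int[OF U(1), of p q] int[OF W(1), of p q] pq'
          by (subst Henstock_Kurzweil_Integration.integral_add) (auto intro: integrable_on_mult_left integrable_on_mult_right)
        finally have "u q * w q - u p * w p - integral {p..q} k
            = integral {p..q} (\<lambda>s. g s * w q + u p * h s - k s)"
          using int[OF U(1), of p q] int[OF W(1), of p q] int[OF k, of p q] pq'
          by (subst Henstock_Kurzweil_Integration.integral_diff)
            (auto intro!: integrable_add integrable_on_mult_left integrable_on_mult_right)
        also have "norm \<dots> \<le> integral {p..q} (\<lambda>s. e * m s)"
        proof (rule integral_norm_bound_integral)
          show "(\<lambda>s. g s * w q + u p * h s - k s) integrable_on {p..q}"
            using int[OF U(1), of p q] int[OF W(1), of p q] int[OF k, of p q] pq'
            by (auto intro!: integrable_add integrable_diff integrable_on_mult_left integrable_on_mult_right)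
          show "(\<lambda>s. e * m s) integrable_on {p..q}"
            using int[OF m, of p q] pq' by (auto intro!: integrable_on_mult_right)
          fix s assume s: "s \<in> {p..q}"
          have "g s * w q + u p * h s - k s = g s * (w q - w s) + (u p - u s) * h s"
            by (simp add: k_def algebra_simps)
          also have "\<bar>\<dots>\<bar> \<le> \<bar>g s\<bar> * e + e * \<bar>h s\<bar>"
            by (rule order_trans[OF abs_triangle_ineq])
              (auto simp: abs_mult intro!: add_mono mult_left_mono mult_right_mono osc[OF s])
          finally show "norm (g s * w q + u p * h s - k s) \<le> e * m s"
            by (simp add: m_def algebra_simps)
        qed
        finally show "\<bar>u q * w q - u p * w p - integral {p..q} k\<bar> \<le> e * integral {p..q} m"
          by simp
      qed (use d1 d2 in auto)
    qed
    then show ?thesis using x by (simp add: P_def)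
  qed
  have "u x * w x = u a * w a + integral {a..x} k" if x: "x \<in> {a..b}" for x
  proof -
    define M where "M = integral {a..x} m"
    have M: "M \<ge> 0"
      unfolding M_def using x by (intro integral_nonneg int[OF m]) (auto simp: m_def)
    have "\<bar>u x * w x - u a * w a - integral {a..x} k\<bar> \<le> 0 + e" if "e > 0" for e
    proof -
      \<comment> \<open>Dividing by \<open>M + 1\<close> also covers \<open>M = 0\<close>.\<close>
      have "\<bar>u x * w x - u a * w a - integral {a..x} k\<bar> \<le> e / (M + 1) * M"
        using main[of "e / (M + 1)" x] x that M by (auto simp: M_def)
      also have "\<dots> \<le> e"
        using M that by (simp add: field_simps)
      finally show ?thesis by simp
    qed
    then have "\<bar>u x * w x - u a * w a - integral {a..x} k\<bar> \<le> 0"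
      by (rule field_le_epsilon) auto
    then show ?thesis by simp
  qed
  then show ?thesis
    using k unfolding sobolev_deriv_def k_def by blast
qed

lemma sobolev_deriv_smooth:
  assumes "\<And>x. (f has_real_derivative f' x) (at x)" "continuous_on UNIV f'"
  shows "sobolev_deriv a b f f'"
  unfolding sobolev_deriv_def
proof (intro conjI ballI)
  show "f' absolutely_integrable_on {a..b}"
    using continuous_on_subset[OF assms(2)] by (intro absolutely_integrable_continuous_real) auto
  fix x assume "x \<in> {a..b}"
  then have "(f' has_integral f x - f a) {a..x}"
    using has_field_derivative_at_within[OF assms(1)]
    by (intro fundamental_theorem_of_calculus) (auto simp flip: has_real_derivative_iff_has_vector_derivative)
  then show "f x = f a + integral {a..x} f'"
    by (simp add: integral_unique)
qed

text \<open>The two boundary conditions are of different kinds on purpose: u stands for v_x or p_x,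
  which vanish at L, and w for v, v_t, p or p_t, which vanish at 0.\<close>

lemma sobolev_integration_by_parts:
  assumes u: "sobolev_deriv 0 L u g" and w: "sobolev_deriv 0 L w h" and "L > 0" "u L = 0" "w 0 = 0"
  shows "L2_inner {0..L} g w = - L2_inner {0..L} u h"
proof -
  have "(\<lambda>x. w x * g x) absolutely_integrable_on {0..L}" "(\<lambda>x. u x * h x) absolutely_integrable_on {0..L}"
    using sobolev_derivD[OF u] sobolev_derivD[OF w] by (auto intro!: absolutely_integrable_continuous_mult)
  then have "(\<lambda>x. g x * w x) integrable_on {0..L}" "(\<lambda>x. u x * h x) integrable_on {0..L}"
    using set_lebesgue_integral_eq_integral(1) by (auto simp: mult.commute)
  then have "integral {0..L} (\<lambda>x. g x * w x + u x * h x) = L2_inner {0..L} g w + L2_inner {0..L} u h"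
    unfolding L2_inner_def by (rule Henstock_Kurzweil_Integration.integral_add)
  moreover have "integral {0..L} (\<lambda>x. g x * w x + u x * h x) = 0"
    using sobolev_derivD(2)[OF sobolev_deriv_mult[OF u w], of 0 L] assms by simp
  ultimately show ?thesis by simp
qed

lemma L2_on_continuous:
  fixes u :: "real \<Rightarrow> real"
  assumes "continuous_on {a..b} u"
  shows "L2_on {a..b} u"
  unfolding L2_on_def using assms
  by (auto intro!: continuous_imp_measurable_on_sets_lebesgue integrable_continuous_real continuous_intros)

text \<open>Cauchy-Schwarz against the constant 1 bounds u(x)^2 by L times the squared norm of g;
  integrating over (0,L) gives the second factor L.\<close>

lemma Poincare_inequality:
  assumes u: "sobolev_deriv 0 L u g" and u0: "u 0 = 0" and L: "L > 0" and g: "L2_on {0..L} g"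
  shows "L2_on {0..L} u" and "L2_sqnorm {0..L} u \<le> L\<^sup>2 * L2_sqnorm {0..L} g"
proof -
  show u2: "L2_on {0..L} u"
    by (intro L2_on_continuous sobolev_derivD(3)[OF u])
  have "(u x)\<^sup>2 \<le> L * L2_sqnorm {0..L} g" if x: "x \<in> {0..L}" for x
  proof -
    have sub: "(\<lambda>y. (g y)\<^sup>2) integrable_on {0..x}"
      using L2_onD(2)[OF g] by (rule integrable_on_subinterval) (use x in auto)
    have gx: "L2_on {0..x} g"
      using L2_onD(1)[OF g] sub x
      by (auto simp: L2_on_def intro: measurable_restrict_mono[of _ _ "{0..L}"])
    have "L2_inner {0..x} (\<lambda>_. 1) g = u x"
      using sobolev_derivD(2)[OF u, of 0 x] x u0 by (simp add: L2_inner_def)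
    then have "(u x)\<^sup>2 \<le> L2_sqnorm {0..x} (\<lambda>_. 1) * L2_sqnorm {0..x} g"
      using L2_Cauchy_Schwarz[of "{0..x}" "\<lambda>_. 1" g] L2_on_continuous[of 0 x "\<lambda>_. 1"] gx by simp
    also have "L2_sqnorm {0..x} (\<lambda>_. 1) = x"
      using x by (simp add: L2_sqnorm_def)
    also have "L2_sqnorm {0..x} g \<le> L2_sqnorm {0..L} g"
      unfolding L2_sqnorm_def using x L2_onD(2)[OF g] sub by (intro integral_subset_le) auto
    finally show ?thesis
      using x L2_sqnorm_nonneg[of "{0..L}" g] by (smt (verit) atLeastAtMost_iff mult_left_mono mult_right_mono)
  qed
  then have "integral {0..L} (\<lambda>x. (u x)\<^sup>2) \<le> integral {0..L} (\<lambda>x. L * L2_sqnorm {0..L} g)"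
    by (intro integral_le L2_onD(2)[OF u2]) auto
  then show "L2_sqnorm {0..L} u \<le> L\<^sup>2 * L2_sqnorm {0..L} g"
    using L by (simp add: L2_sqnorm_def power2_eq_square mult.assoc)
qed

section \<open>Transport on the rectangle\<close>

lemma rect_sets [simp]: "rect L \<in> sets lebesgue"
proof -
  have "rect L = cbox (0, 0) (L, 1)"
    by (simp add: rect_def cbox_Pair_eq)
  then show ?thesis by simp
qed

lemma L2_on_rect_mult:
  assumes u: "L2_on (rect L) u" and k: "continuous_on UNIV k"
  shows "L2_on (rect L) (\<lambda>q. k (snd q) * u q)"
proof -
  have "compact (k ` {0..1})"
    using k by (intro compact_continuous_image continuous_on_subset[OF k]) auto
  then obtain B where "\<forall>y \<in> k ` {0..1}. norm y \<le> B"
    using compact_imp_bounded bounded_iff by blast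
  then have "\<And>r. r \<in> {0..1} \<Longrightarrow> \<bar>k r\<bar> \<le> B"
    by simp
  then show ?thesis
    by (intro L2_on_bounded_mult[where B = B] u rect_sets continuous_imp_measurable_on_sets_lebesgue
      continuous_on_compose2[OF k] continuous_intros) (auto simp: rect_def)
qed

text \<open>For almost every x the fundamental theorem in r is applied to f(r) z(x,r)^2, and Fubini
  integrates the result over x. Integrability of the outflow z(.,1)^2 is a conclusion, because f(1)
  is nonzero.\<close>

lemma rect_flux:
  assumes z: "L2_on (rect L) z" and zr: "L2_on (rect L) zr"
    and sob: "AE x in lebesgue_on {0..L}. sobolev_deriv 0 1 (\<lambda>r. z (x, r)) (\<lambda>r. zr (x, r))"
    and z0: "(\<lambda>x. (z (x, 0))\<^sup>2) integrable_on {0..L}"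
    and f: "\<And>r. (f has_real_derivative f' r) (at r)" and f': "continuous_on UNIV f'" and f1: "f 1 \<noteq> 0"
  shows "(\<lambda>x. (z (x, 1))\<^sup>2) integrable_on {0..L}"
    and "2 * L2_inner (rect L) (\<lambda>q. f (snd q) * z q) zr + L2_inner (rect L) (\<lambda>q. f' (snd q) * z q) z =
      f 1 * integral {0..L} (\<lambda>x. (z (x, 1))\<^sup>2) - f 0 * integral {0..L} (\<lambda>x. (z (x, 0))\<^sup>2)"
proof -
  have cont: "continuous_on UNIV f"
    using f by (meson DERIV_isCont continuous_at_imp_continuous_on)
  define F where "F q = 2 * (f (snd q) * z q * zr q) + f' (snd q) * z q * z q" for q
  note i1 = L2_on_mult_integrable[OF rect_sets L2_on_rect_mult[OF z cont] zr]
  note i2 = L2_on_mult_integrable[OF rect_sets L2_on_rect_mult[OF z f'] z]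
  have F: "F absolutely_integrable_on {0..L} \<times> {0..1}"
    unfolding F_def[abs_def] using i1 i2 by (intro set_integral_add) (auto simp: rect_def)
  have IF: "integral ({0..L} \<times> {0..1}) F =
      2 * L2_inner (rect L) (\<lambda>q. f (snd q) * z q) zr + L2_inner (rect L) (\<lambda>q. f' (snd q) * z q) z"
    unfolding F_def[abs_def] L2_inner_def
    using set_lebesgue_integral_eq_integral(1)[OF i1] set_lebesgue_integral_eq_integral(1)[OF i2]
    by (subst Henstock_Kurzweil_Integration.integral_add) (auto simp: rect_def intro!: integrable_on_mult_right)
  note fub = absolutely_integrable_Fubini[OF F]
  have "AE x in lebesgue_on {0..L}.
      integral {0..1} (\<lambda>r. F (x, r)) = f 1 * (z (x, 1))\<^sup>2 - f 0 * (z (x, 0))\<^sup>2"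
    using sob
  proof eventually_elim
    case (elim x)
    have "sobolev_deriv 0 1 (\<lambda>r. f r * (z (x, r) * z (x, r)))
       (\<lambda>r. f' r * (z (x, r) * z (x, r)) + f r * (zr (x, r) * z (x, r) + z (x, r) * zr (x, r)))"
      by (intro sobolev_deriv_mult sobolev_deriv_smooth f f' elim)
    moreover have "(\<lambda>r. f' r * (z (x, r) * z (x, r)) + f r * (zr (x, r) * z (x, r) + z (x, r) * zr (x, r)))
       = (\<lambda>r. F (x, r))"
      by (auto simp: F_def fun_eq_iff algebra_simps)
    ultimately show ?case
      using sobolev_derivD(2)[of 0 1 _ _ 0 1] by (fastforce simp: power2_eq_square)
  qed
  note ae = this
  let ?G = "\<lambda>x. f 1 * (z (x, 1))\<^sup>2 - f 0 * (z (x, 0))\<^sup>2"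
  have G: "?G integrable_on {0..L}"
    using absolutely_integrable_cong_AE_on[OF fub(2) ae] set_lebesgue_integral_eq_integral(1) by auto
  \<comment> \<open>The flux is integrable by Fubini; adding the inflow and dividing by
    \<open>f 1\<close> isolates the outflow.\<close>
  have "(\<lambda>x. 1 / f 1 * (?G x + f 0 * (z (x, 0))\<^sup>2)) integrable_on {0..L}"
    using G z0 by (intro integrable_on_mult_right integrable_add)
  then show z1: "(\<lambda>x. (z (x, 1))\<^sup>2) integrable_on {0..L}"
    using f1 by simp
  have "integral ({0..L} \<times> {0..1}) F = integral {0..L} ?G"
    using fub(3) integral_cong_AE_on[OF ae] by simp
  also have "\<dots> = f 1 * integral {0..L} (\<lambda>x. (z (x, 1))\<^sup>2) - f 0 * integral {0..L} (\<lambda>x. (z (x, 0))\<^sup>2)"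
    using z0 z1 by (subst Henstock_Kurzweil_Integration.integral_diff) (auto intro: integrable_on_mult_right)
  finally show "2 * L2_inner (rect L) (\<lambda>q. f (snd q) * z q) zr + L2_inner (rect L) (\<lambda>q. f' (snd q) * z q) z =
      f 1 * integral {0..L} (\<lambda>x. (z (x, 1))\<^sup>2) - f 0 * integral {0..L} (\<lambda>x. (z (x, 0))\<^sup>2)"
    using IF by simp
qed

text \<open>The substitution s = -rT, with Jacobian T, identifies the initial delay variable with
  the history. It also supplies the integrability in time of the spatial norm of g, for which g
  itself carries no assumption.\<close>

lemma history_integral:
  fixes T :: real
  assumes T: "T > 0" and z: "L2_on (rect L) z"
    and ae: "AE (x, r) in lebesgue_on (rect L). z (x, r) = g x (- r * T)"
  shows "((\<lambda>s. integral {0..L} (\<lambda>x. (g x s)\<^sup>2)) has_integral T * L2_sqnorm (rect L) z) {- T..0}"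
proof -
  let ?F = "\<lambda>q. (z q)\<^sup>2" and ?G = "\<lambda>q. (g (fst q) (- snd q * T))\<^sup>2"
  have F: "?F absolutely_integrable_on rect L"
    using L2_on_mult_integrable[OF rect_sets z z] by (simp add: power2_eq_square)
  have eq: "AE q in lebesgue_on (rect L). ?F q = ?G q"
    using ae by eventually_elim auto
  have G: "?G absolutely_integrable_on {0..L} \<times> {0..1}"
    using absolutely_integrable_cong_AE_on[OF F eq rect_sets] by (simp add: rect_def)
  note fub = absolutely_integrable_Fubini[OF G, simplified]
  let ?M = "\<lambda>r. integral {0..L} (\<lambda>x. (g x (- (r * T)))\<^sup>2)"
  have "integral {0..1} ?M = L2_sqnorm (rect L) z"
    using fub(6) integral_cong_AE_on[OF eq rect_sets] by (simp add: L2_sqnorm_def rect_def)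
  then have "(?M has_integral L2_sqnorm (rect L) z) (cbox 0 1)"
    using set_lebesgue_integral_eq_integral(1)[OF fub(5)] by (simp add: has_integral_iff)
  from has_integral_affinity[OF this, of "- 1 / T" 0]
  show "((\<lambda>s. integral {0..L} (\<lambda>x. (g x s)\<^sup>2)) has_integral T * L2_sqnorm (rect L) z) {- T..0}"
    using T image_mult_atLeastAtMost_if[of "- T" 0 1] by simp
qed

subsection \<open>Strong solutions\<close>

lemma weighted_C1:
  assumes "L2_C1 (rect L) z z'"
  shows "L2_C1 (rect L) (\<lambda>t q. (1 - \<eta> * snd q) * z t q) (\<lambda>t q. (1 - \<eta> * snd q) * z' t q)"
proof (rule L2_C1_bounded_mult[OF rect_sets assms, where B = "1 + \<bar>\<eta>\<bar>"])
  show "(\<lambda>q. 1 - \<eta> * snd q) \<in> borel_measurable (lebesgue_on (rect L))"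
    by (intro continuous_imp_measurable_on_sets_lebesgue continuous_intros rect_sets)
  show "\<bar>1 - \<eta> * snd q\<bar> \<le> 1 + \<bar>\<eta>\<bar>" if "q \<in> rect L" for q
  proof -
    have "\<bar>\<eta> * snd q\<bar> \<le> \<bar>\<eta>\<bar>"
      using that by (auto simp: rect_def abs_mult intro!: mult_left_le)
    then show ?thesis by linarith
  qed
qed

section \<open>The delay and the damping weight\<close>

locale beam =
  fixes L \<rho> \<alpha> \<alpha>1 \<gamma> \<mu> \<beta> :: real
    and \<tau> \<tau>' :: "real \<Rightarrow> real" and \<tau>0 \<tau>bar d :: real
    and \<delta>1 \<delta>1' \<delta>2 :: "real \<Rightarrow> real" and \<delta>0 \<beta>0 \<xi>bar :: real
  assumes pos: "L > 0" "\<rho> > 0" "\<alpha>1 > 0" "\<gamma> > 0" "\<mu> > 0" "\<beta> > 0" "\<tau>0 > 0" "\<delta>0 > 0" "\<beta>0 > 0"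
    and \<alpha>_eq: "\<alpha> = \<alpha>1 + \<gamma>\<^sup>2 * \<beta>"
    and d: "d < 1"
    and \<tau>_bounds: "\<And>t. t > 0 \<Longrightarrow> \<tau>0 \<le> \<tau> t" "\<And>t. t > 0 \<Longrightarrow> \<tau> t \<le> \<tau>bar"
    and \<tau>'_le: "\<And>t. t > 0 \<Longrightarrow> \<tau>' t \<le> d"
    and \<tau>_W2: "\<And>T. T > 0 \<Longrightarrow> W2_inf T \<tau> \<tau>'"
    and \<delta>1_C1: "C1_nonneg \<delta>1 \<delta>1'" and \<delta>1_antimono: "antimono_on {0..} \<delta>1"
    and \<delta>1_ge: "\<And>t. t \<ge> 0 \<Longrightarrow> \<delta>0 \<le> \<delta>1 t"
    and \<delta>2_le: "\<And>t. t \<ge> 0 \<Longrightarrow> \<bar>\<delta>2 t\<bar> \<le> \<beta>0 * \<delta>1 t"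
    and \<xi>bar_gt: "\<beta>0 / sqrt (1 - d) < \<xi>bar" and \<xi>bar_less: "\<xi>bar < 2 - \<beta>0 / sqrt (1 - d)"
begin

lemma \<tau>_continuous: "continuous_on {0..} \<tau>"
proof -
  have "isCont \<tau> t" if "t > 0" for t
  proof -
    have "sobolev_deriv 0 (t + 1) \<tau> \<tau>'"
      using \<tau>_W2[of "t + 1"] that by (auto simp: W2_inf_def)
    from sobolev_derivD(3)[OF this] show ?thesis
      using that by (rule_tac continuous_on_interior[of "{0..t + 1}"]) auto
  qed
  moreover have "continuous (at 0 within {0..}) \<tau>"
  proof -
    have "sobolev_deriv 0 1 \<tau> \<tau>'"
      using \<tau>_W2[of 1] by (auto simp: W2_inf_def)
    from sobolev_derivD(3)[OF this] have "continuous (at 0 within {0..1}) \<tau>"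
      by (simp add: continuous_on_eq_continuous_within)
    moreover have "at (0::real) within {0..1} = at 0 within {0..}"
      by (rule at_within_nhd[of _ "{..<1}"]) auto
    ultimately show ?thesis by simp
  qed
  ultimately show ?thesis
    unfolding continuous_on_eq_continuous_within
    by (metis atLeast_iff continuous_at_imp_continuous_at_within order_le_less)
qed

text \<open>\<open>\<tau>'\<close> is itself absolutely continuous, hence continuous, so the weak
  derivative of \<open>\<tau>\<close> is a classical one.\<close>

lemma \<tau>_deriv:
  assumes t: "t > 0"
  shows "(\<tau> has_real_derivative \<tau>' t) (at t)"
proof -
  obtain \<tau>'' where *: "sobolev_deriv 0 (t + 1) \<tau> \<tau>'" "sobolev_deriv 0 (t + 1) \<tau>' \<tau>''"
    using \<tau>_W2[of "t + 1"] t by (auto simp: W2_inf_def)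
  have D: "((\<lambda>x. \<tau> 0 + integral {0..x} \<tau>') has_real_derivative \<tau>' t) (at t within {0..t + 1})"
    using integral_has_real_derivative[OF sobolev_derivD(3)[OF *(2)], of t] t
    by (auto intro!: derivative_eq_intros)
  have eq: "\<tau> x = \<tau> 0 + integral {0..x} \<tau>'" if "x \<in> {0..t + 1}" for x
    using *(1) that unfolding sobolev_deriv_def by blast
  from D have "(\<tau> has_real_derivative \<tau>' t) (at t within {0..t + 1})"
    by (rule has_field_derivative_transform_within[where d = 1]) (use t in \<open>auto intro: eq[symmetric]\<close>)
  then show ?thesis
    using t at_within_interior[of t "{0..t + 1}"] by simp
qed

text \<open>The bounds extend to t = 0 by continuity from the right.\<close>

lemma \<tau>_ge: "\<tau>0 \<le> \<tau> t" and \<tau>_le: "\<tau> t \<le> \<tau>bar" if "t \<ge> 0"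
proof -
  have lim: "(\<tau> \<longlongrightarrow> \<tau> 0) (at_right 0)"
    using \<tau>_continuous by (auto simp: continuous_on_def intro: tendsto_within_subset)
  have ev: "\<forall>\<^sub>F t in at_right 0. \<tau>0 \<le> \<tau> t \<and> \<tau> t \<le> \<tau>bar"
    using \<tau>_bounds by (auto simp: eventually_at_right_field intro!: exI[of _ 1])
  have "\<tau>0 \<le> \<tau> 0" "\<tau> 0 \<le> \<tau>bar"
    using tendsto_lowerbound[OF lim, of \<tau>0] tendsto_upperbound[OF lim, of \<tau>bar] ev
    by (auto simp: eventually_conj_iff)
  then show "\<tau>0 \<le> \<tau> t" "\<tau> t \<le> \<tau>bar"
    using \<tau>_bounds[of t] that by (cases "t = 0"; simp)+
qed

lemma \<tau>bar_pos: "\<tau>bar > 0"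
  using \<tau>_ge[of 0] \<tau>_le[of 0] pos by linarith

text \<open>t - tau(t) is nondecreasing since its derivative is at least 1 - d > 0. Thus the delay
  window never looks back beyond the part of the history that z(.,.,0) records.\<close>

lemma delay_start: "t - \<tau> t \<ge> - \<tau> 0" if "t \<ge> 0"
proof -
  have "0 - \<tau> 0 \<le> t - \<tau> t"
  proof (rule DERIV_nonneg_imp_increasing_open[of 0 t "\<lambda>t. t - \<tau> t"])
    fix x :: real assume "0 < x" "x < t"
    then have "((\<lambda>t. t - \<tau> t) has_real_derivative 1 - \<tau>' x) (at x)"
      by (auto intro!: derivative_eq_intros \<tau>_deriv)
    then show "\<exists>y. ((\<lambda>t. t - \<tau> t) has_real_derivative y) (at x) \<and> 0 \<le> y"
      using \<tau>'_le[of x] d \<open>0 < x\<close> by auto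
  next
    show "continuous_on {0..t} (\<lambda>t. t - \<tau> t)"
      by (intro continuous_intros continuous_on_subset[OF \<tau>_continuous]) auto
  qed (use that in auto)
  then show ?thesis by simp
qed

lemma \<delta>1_deriv:
  assumes t: "t > 0"
  shows "(\<delta>1 has_real_derivative \<delta>1' t) (at t)"
proof -
  have "(\<delta>1 has_real_derivative \<delta>1' t) (at t within {0..})"
    using \<delta>1_C1 t by (simp add: C1_nonneg_def)
  then show ?thesis
    using t at_within_interior[of t "{0..}"] by simp
qed

lemma \<delta>1_continuous: "continuous_on {0..} \<delta>1"
  using \<delta>1_C1 by (auto simp: C1_nonneg_def continuous_on_eq_continuous_within intro: DERIV_continuous)

lemma \<delta>1_le: "\<delta>1 t \<le> \<delta>1 0" if "t \<ge> 0"
  using \<delta>1_antimono that by (auto simp: monotone_on_def)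

lemma \<delta>1'_nonpos:
  assumes t: "t > 0"
  shows "\<delta>1' t \<le> 0"
proof (rule ccontr)
  assume "\<not> \<delta>1' t \<le> 0"
  then obtain e where e: "e > 0" "\<And>h. 0 < h \<Longrightarrow> h < e \<Longrightarrow> \<delta>1 t < \<delta>1 (t + h)"
    using DERIV_pos_inc_right[OF \<delta>1_deriv[OF t]] by auto
  then have "\<delta>1 t < \<delta>1 (t + e / 2)" by auto
  moreover have "\<delta>1 (t + e / 2) \<le> \<delta>1 t"
    using \<delta>1_antimono t e(1) by (auto simp: monotone_on_def)
  ultimately show False by simp
qed

end

section \<open>Energy and multiplier identities for a strong solution\<close>

locale strong_beam = beam +
  fixes v vx vt p px pt vxx vtx vtt pxx ptx ptt :: "real \<Rightarrow> real \<Rightarrow> real"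
    and z zr zt :: "real \<Rightarrow> real \<times> real \<Rightarrow> real"
  assumes reg: "strong_regularity L (v, vx, vt, p, px, pt, z) vxx vtx vtt pxx ptx ptt zr zt"
    and eq_v: "\<And>t. t > 0 \<Longrightarrow> AE x in lebesgue_on {0..L}.
        \<rho> * vtt t x - \<alpha> * vxx t x + \<gamma> * \<beta> * pxx t x + \<delta>1 t * vt t x + \<delta>2 t * z t (x, 1) = 0"
    and eq_p: "\<And>t. t > 0 \<Longrightarrow> AE x in lebesgue_on {0..L}.
        \<mu> * ptt t x - \<beta> * pxx t x + \<gamma> * \<beta> * vxx t x = 0"
    and eq_z: "\<And>t. t > 0 \<Longrightarrow> AE (x, r) in lebesgue_on (rect L).
        \<tau> t * zt t (x, r) + (1 - \<tau>' t * r) * zr t (x, r) = 0"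
begin

abbreviation "ip \<equiv> L2_inner {0..L}"
abbreviation "nrm \<equiv> L2_sqnorm {0..L}"

lemma regD:
  assumes "t \<ge> 0"
  shows "sobolev_deriv 0 L (v t) (vx t)" "sobolev_deriv 0 L (vx t) (vxx t)" "sobolev_deriv 0 L (vt t) (vtx t)"
    "v t 0 = 0" "vt t 0 = 0"
    "sobolev_deriv 0 L (p t) (px t)" "sobolev_deriv 0 L (px t) (pxx t)" "sobolev_deriv 0 L (pt t) (ptx t)"
    "p t 0 = 0" "pt t 0 = 0" "vx t L = 0" "px t L = 0"
    "AE x in lebesgue_on {0..L}. sobolev_deriv 0 1 (\<lambda>r. z t (x, r)) (\<lambda>r. zr t (x, r))"
    "AE x in lebesgue_on {0..L}. vt t x = z t (x, 0)"
  using reg assms by auto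

lemma C1:
  "L2_C1 {0..L} v vt" "L2_C1 {0..L} vx vtx" "L2_C1 {0..L} vt vtt"
  "L2_C1 {0..L} p pt" "L2_C1 {0..L} px ptx" "L2_C1 {0..L} pt ptt" "L2_C1 (rect L) z zt"
  using reg by auto

lemma L2:
  assumes "t \<ge> 0"
  shows "L2_on {0..L} (v t)" "L2_on {0..L} (vx t)" "L2_on {0..L} (vt t)" "L2_on {0..L} (vxx t)"
    "L2_on {0..L} (vtx t)" "L2_on {0..L} (vtt t)"
    "L2_on {0..L} (p t)" "L2_on {0..L} (px t)" "L2_on {0..L} (pt t)" "L2_on {0..L} (pxx t)"
    "L2_on {0..L} (ptx t)" "L2_on {0..L} (ptt t)"
    "L2_on (rect L) (z t)" "L2_on (rect L) (zr t)" "L2_on (rect L) (zt t)"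
  using C1[THEN L2_C1D(1), THEN L2_continuousD(1)[OF _ assms]]
    C1[THEN L2_C1D(2), THEN L2_continuousD(1)[OF _ assms]] reg L2_continuousD(1)[OF _ assms]
  by auto

text \<open>
  The delayed damping force \<open>\<delta>\<^sub>2(t) z(\<cdot>,1,t)\<close>, read off the equation so that no measurability
  of the trace \<open>z(\<cdot>,1,t)\<close> is needed.
\<close>
definition delayed :: "real \<Rightarrow> real \<Rightarrow> real" where
  "delayed t x = \<alpha> * vxx t x - \<gamma> * \<beta> * pxx t x - \<delta>1 t * vt t x - \<rho> * vtt t x"

lemma delayed_L2: "t \<ge> 0 \<Longrightarrow> L2_on {0..L} (delayed t)"
  unfolding delayed_def[abs_def] by (intro L2_on_diff L2_on_cmult L2) auto

text \<open>An identity by the definition of \<open>delayed\<close>; the first beam equation itself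
  enters through \<open>delayed_sqnorm\<close>.\<close>

lemma tested_v:
  assumes t: "t \<ge> 0" and f: "L2_on {0..L} f"
  shows "\<rho> * ip (vtt t) f = \<alpha> * ip (vxx t) f - \<gamma> * \<beta> * ip (pxx t) f - \<delta>1 t * ip (vt t) f - ip (delayed t) f"
  using t f unfolding delayed_def[abs_def]
  by (simp add: L2_inner_diff_left L2_inner_cmult_left L2_on_diff L2_on_cmult L2)

lemma tested_p:
  assumes t: "t > 0" and f: "L2_on {0..L} f"
  shows "\<mu> * ip (ptt t) f = \<beta> * ip (pxx t) f - \<gamma> * \<beta> * ip (vxx t) f"
proof -
  have "ip (\<lambda>x. \<mu> * ptt t x) f = ip (\<lambda>x. \<beta> * pxx t x - \<gamma> * \<beta> * vxx t x) f"
    unfolding L2_inner_def using eq_p[OF t]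
    by (intro integral_cong_AE_on) (auto elim: eventually_mono)
  then show ?thesis
    using t f by (simp add: L2_inner_diff_left L2_inner_cmult_left L2_on_cmult L2)
qed

lemma by_parts:
  assumes t: "t \<ge> 0"
  shows "ip (vxx t) (v t) = - ip (vx t) (vx t)" "ip (vxx t) (vt t) = - ip (vx t) (vtx t)"
    "ip (vxx t) (p t) = - ip (vx t) (px t)" "ip (vxx t) (pt t) = - ip (vx t) (ptx t)"
    "ip (pxx t) (v t) = - ip (px t) (vx t)" "ip (pxx t) (vt t) = - ip (px t) (vtx t)"
    "ip (pxx t) (p t) = - ip (px t) (px t)" "ip (pxx t) (pt t) = - ip (px t) (ptx t)"
  using regD[OF t] pos(1) by (auto intro!: sobolev_integration_by_parts)

lemma ip_deriv:
  assumes "L2_C1 {0..L} f f'" "L2_C1 {0..L} g g'" and t: "t > 0"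
  shows "((\<lambda>t. ip (f t) (g t)) has_real_derivative ip (f' t) (g t) + ip (f t) (g' t)) (at t)"
  using L2_inner_has_derivative[of "{0..L}", OF _ assms(1,2), of t] t at_within_interior[of t "{0..}"]
  by simp

text \<open>The memory-free part of the energy with the square of gamma v_x - p_x expanded and
  alpha1 + gamma^2 beta collected into alpha, so that each term is an inner product of C^1 curves.
  \<open>energy_bounds\<close> folds the square back.\<close>

definition wave_energy :: "real \<Rightarrow> real" where
  "wave_energy t = \<rho> / 2 * ip (vt t) (vt t) + \<mu> / 2 * ip (pt t) (pt t) + \<alpha> / 2 * ip (vx t) (vx t)
     - \<gamma> * \<beta> * ip (vx t) (px t) + \<beta> / 2 * ip (px t) (px t)"

text \<open>Test the first equation with v_t and the second with p_t: after integration by parts the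
  elastic and coupling terms cancel, and only the two damping forces do work.\<close>

lemma wave_energy_deriv:
  assumes t: "t > 0"
  shows "(wave_energy has_real_derivative - \<delta>1 t * nrm (vt t) - ip (delayed t) (vt t)) (at t)"
proof -
  have t0: "t \<ge> 0" using t by simp
  have "(wave_energy has_real_derivative
      \<rho> / 2 * (ip (vtt t) (vt t) + ip (vt t) (vtt t)) + \<mu> / 2 * (ip (ptt t) (pt t) + ip (pt t) (ptt t))
      + \<alpha> / 2 * (ip (vtx t) (vx t) + ip (vx t) (vtx t)) - \<gamma> * \<beta> * (ip (vtx t) (px t) + ip (vx t) (ptx t))
      + \<beta> / 2 * (ip (ptx t) (px t) + ip (px t) (ptx t))) (at t)" (is "(_ has_real_derivative ?D) _")
    unfolding wave_energy_def[abs_def]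
    by (intro derivative_intros DERIV_cmult ip_deriv C1 t)
  moreover have "?D = \<rho> * ip (vtt t) (vt t) + \<mu> * ip (ptt t) (pt t) + \<alpha> * ip (vx t) (vtx t)
      - \<gamma> * \<beta> * (ip (px t) (vtx t) + ip (vx t) (ptx t)) + \<beta> * ip (px t) (ptx t)"
    using L2_inner_commute[of "{0..L}" "vt t" "vtt t"] L2_inner_commute[of "{0..L}" "pt t" "ptt t"]
      L2_inner_commute[of "{0..L}" "vtx t" "vx t"] L2_inner_commute[of "{0..L}" "vtx t" "px t"]
      L2_inner_commute[of "{0..L}" "ptx t" "px t"] by (simp add: algebra_simps)
  moreover have "\<dots> = - \<delta>1 t * nrm (vt t) - ip (delayed t) (vt t)"
    unfolding tested_v[OF t0 L2(3)[OF t0]] tested_p[OF t L2(9)[OF t0]] by_parts[OF t0] L2_sqnorm_eq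
    by (simp add: algebra_simps)
  ultimately show ?thesis by simp
qed

text \<open>The last pairing yields the negative square of p_t, but a positive one of p_x. The
  pairing with N outweighs the latter, since the coupling gamma beta p_xx in the first equation is
  tested with p. The pairing with K yields the negative square of v_x, and the one with Q is free to
  absorb the cross term <v_x, p_x>.\<close>

definition multiplier :: "real \<Rightarrow> real \<Rightarrow> real \<Rightarrow> real \<Rightarrow> real" where
  "multiplier K N Q t = K * \<rho> * ip (v t) (vt t) - N * \<rho> * ip (vt t) (p t) + Q * \<mu> * ip (pt t) (v t)
     - \<mu> * ip (p t) (pt t)"

lemma multiplier_deriv:
  assumes t: "t > 0"
  shows "(multiplier K N Q has_real_derivative
      K * \<rho> * nrm (vt t) + (Q * \<mu> - N * \<rho>) * ip (vt t) (pt t) - \<mu> * nrm (pt t)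
      - (K * \<alpha> - Q * \<gamma> * \<beta>) * nrm (vx t) - (N * \<gamma> * \<beta> - \<beta>) * nrm (px t)
      + (K * \<gamma> * \<beta> + N * \<alpha> - Q * \<beta> - \<gamma> * \<beta>) * ip (vx t) (px t)
      - K * \<delta>1 t * ip (vt t) (v t) - K * ip (delayed t) (v t)
      + N * \<delta>1 t * ip (vt t) (p t) + N * ip (delayed t) (p t)) (at t)"
     (is "(_ has_real_derivative ?R) _")
proof -
  have t0: "t \<ge> 0" using t by simp
  have "(multiplier K N Q has_real_derivative
      K * \<rho> * (ip (vt t) (vt t) + ip (v t) (vtt t)) - N * \<rho> * (ip (vtt t) (p t) + ip (vt t) (pt t))
      + Q * \<mu> * (ip (ptt t) (v t) + ip (pt t) (vt t)) - \<mu> * (ip (pt t) (pt t) + ip (p t) (ptt t))) (at t)"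
    (is "(_ has_real_derivative ?D) _")
    unfolding multiplier_def[abs_def]
    by (intro derivative_intros DERIV_cmult ip_deriv C1 t)
  moreover have "?D = K * \<rho> * ip (vt t) (vt t) + K * (\<rho> * ip (vtt t) (v t)) - N * (\<rho> * ip (vtt t) (p t))
      - N * \<rho> * ip (vt t) (pt t) + Q * (\<mu> * ip (ptt t) (v t)) + Q * \<mu> * ip (vt t) (pt t)
      - \<mu> * ip (pt t) (pt t) - \<mu> * ip (ptt t) (p t)"
    using L2_inner_commute[of "{0..L}" "v t" "vtt t"] L2_inner_commute[of "{0..L}" "pt t" "vt t"]
      L2_inner_commute[of "{0..L}" "p t" "ptt t"] by (simp add: algebra_simps)
  moreover have "\<dots> = ?R"
    unfolding tested_v[OF t0 L2(1)[OF t0]] tested_v[OF t0 L2(7)[OF t0]]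
      tested_p[OF t L2(1)[OF t0]] tested_p[OF t L2(7)[OF t0]] by_parts[OF t0] L2_sqnorm_eq
    using L2_inner_commute[of "{0..L}" "px t" "vx t"] by (simp add: algebra_simps)
  ultimately show ?thesis by simp
qed

text \<open>The weight \<open>1 - \<eta> r\<close> plays the role of \<open>e\<^bsup>-\<lambda>\<tau>r\<^esup>\<close>.\<close>
definition memory :: "real \<Rightarrow> real \<Rightarrow> real" where
  "memory \<eta> t = \<tau> t * L2_inner (rect L) (\<lambda>q. (1 - \<eta> * snd q) * z t q) (z t)"

lemma trace_integrable:
  assumes t: "t \<ge> 0"
  shows "(\<lambda>x. (z t (x, 0))\<^sup>2) integrable_on {0..L}"
    and "integral {0..L} (\<lambda>x. (z t (x, 0))\<^sup>2) = nrm (vt t)"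
proof -
  have ae: "AE x in lebesgue_on {0..L}. (vt t x)\<^sup>2 = (z t (x, 0))\<^sup>2"
    using regD(14)[OF t] by eventually_elim simp
  have "(\<lambda>x. (vt t x)\<^sup>2) absolutely_integrable_on {0..L}"
    using L2_on_mult_integrable[of "{0..L}", OF _ L2(3)[OF t] L2(3)[OF t]] by (simp add: power2_eq_square)
  from absolutely_integrable_cong_AE_on[OF this ae]
  show "(\<lambda>x. (z t (x, 0))\<^sup>2) integrable_on {0..L}"
    using set_lebesgue_integral_eq_integral(1) by auto
  show "integral {0..L} (\<lambda>x. (z t (x, 0))\<^sup>2) = nrm (vt t)"
    using integral_cong_AE_on[OF ae] by (simp add: L2_sqnorm_def)
qed

definition outflow :: "real \<Rightarrow> real" where
  "outflow t = integral {0..L} (\<lambda>x. (z t (x, 1))\<^sup>2)"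

lemma outflow_nonneg: "outflow t \<ge> 0"
  unfolding outflow_def by (cases "(\<lambda>x. (z t (x, 1))\<^sup>2) integrable_on {0..L}")
    (auto simp: integral_nonneg not_integrable_integral)

lemma delayed_sqnorm:
  assumes t: "t > 0"
  shows "nrm (delayed t) = (\<delta>2 t)\<^sup>2 * outflow t"
proof -
  have "nrm (delayed t) = integral {0..L} (\<lambda>x. (\<delta>2 t)\<^sup>2 * (z t (x, 1))\<^sup>2)"
    unfolding L2_sqnorm_def
  proof (rule integral_cong_AE_on)
    show "AE x in lebesgue_on {0..L}. (delayed t x)\<^sup>2 = (\<delta>2 t)\<^sup>2 * (z t (x, 1))\<^sup>2"
      using eq_v[OF t]
    proof eventually_elim
      case (elim x)
      then have "delayed t x = \<delta>2 t * z t (x, 1)" by (simp add: delayed_def)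
      then show ?case by (simp add: power_mult_distrib)
    qed
  qed simp
  then show ?thesis by (simp add: outflow_def)
qed

text \<open>By the transport equation the derivative is a flux with profile f(r) = (1 - tau' r)(1 -
  eta r). Its end values are f(0) = 1, the inflow of v_t, and f(1) = (1 - tau')(1 - eta), the
  outflow. Of the two parts of f', one cancels the term from differentiating the factor tau, and the
  other, from the slope of the weight, is the dissipation of z.\<close>

lemma memory_deriv:
  assumes t: "t > 0" and \<eta>: "\<eta> < 1"
  shows "(memory \<eta> has_real_derivative
     nrm (vt t) - (1 - \<tau>' t) * (1 - \<eta>) * outflow t
     - \<eta> * L2_inner (rect L) (\<lambda>q. (1 - \<tau>' t * snd q) * z t q) (z t)) (at t)"
proof -
  let ?k = "\<lambda>r. 1 - \<eta> * r" and ?a = "\<lambda>r. 1 - \<tau>' t * r"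
  let ?IP = "L2_inner (rect L)"
  have t0: "t \<ge> 0" using t by simp
  have kz: "L2_C1 (rect L) (\<lambda>t q. ?k (snd q) * z t q) (\<lambda>t q. ?k (snd q) * zt t q)"
    by (rule weighted_C1[OF C1(7)])
  have a1: "1 - \<tau>' t \<noteq> 0" using \<tau>'_le[OF t] d by simp
  have sym: "?IP (\<lambda>q. k (snd q) * f q) g = ?IP f (\<lambda>q. k (snd q) * g q)" for k f g
    unfolding L2_inner_def by (simp add: mult.left_commute mult.commute)
  have "((\<lambda>t. ?IP (\<lambda>q. ?k (snd q) * z t q) (z t)) has_real_derivative
      ?IP (\<lambda>q. ?k (snd q) * zt t q) (z t) + ?IP (\<lambda>q. ?k (snd q) * z t q) (zt t)) (at t)"
    using L2_inner_has_derivative[OF rect_sets kz C1(7) t0] t at_within_interior[of t "{0..}"] by simp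
  moreover have "?IP (\<lambda>q. ?k (snd q) * zt t q) (z t) = ?IP (\<lambda>q. ?k (snd q) * z t q) (zt t)"
    using sym[of ?k "zt t" "z t"] by (simp add: L2_inner_commute)
  ultimately have "(memory \<eta> has_real_derivative
      \<tau>' t * ?IP (\<lambda>q. ?k (snd q) * z t q) (z t) + 2 * (\<tau> t * ?IP (\<lambda>q. ?k (snd q) * z t q) (zt t))) (at t)"
    unfolding memory_def[abs_def] using \<tau>_deriv[OF t]
    by (auto intro!: derivative_eq_intros)
  moreover have "\<tau> t * ?IP (\<lambda>q. ?k (snd q) * z t q) (zt t) = - ?IP (\<lambda>q. (?a (snd q) * ?k (snd q)) * z t q) (zr t)"
  proof -
    have "?IP (\<lambda>q. ?k (snd q) * z t q) (\<lambda>q. \<tau> t * zt t q) = ?IP (\<lambda>q. ?k (snd q) * z t q) (\<lambda>q. - 1 * (?a (snd q) * zr t q))"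
      unfolding L2_inner_def
    proof (rule integral_cong_AE_on[OF _ rect_sets])
      show "AE q in lebesgue_on (rect L). ?k (snd q) * z t q * (\<tau> t * zt t q)
          = ?k (snd q) * z t q * (- 1 * (?a (snd q) * zr t q))"
        using eq_z[OF t]
      proof eventually_elim
        case (elim q)
        then have "\<tau> t * zt t q = - 1 * (?a (snd q) * zr t q)" by (simp add: case_prod_beta)
        then show ?case by simp
      qed
    qed
    then show ?thesis
      unfolding L2_inner_cmult_right sym[of ?a, symmetric] by (simp add: mult.assoc)
  qed
  moreover have "2 * ?IP (\<lambda>q. (?a (snd q) * ?k (snd q)) * z t q) (zr t)
      + ?IP (\<lambda>q. (- \<tau>' t * ?k (snd q) - \<eta> * ?a (snd q)) * z t q) (z t)
      = (1 - \<tau>' t) * (1 - \<eta>) * outflow t - nrm (vt t)"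
  proof -
    have D: "((\<lambda>r. ?a r * ?k r) has_real_derivative - \<tau>' t * ?k r - \<eta> * ?a r) (at r)" for r
      by (auto intro!: derivative_eq_intros simp: algebra_simps)
    have "continuous_on UNIV (\<lambda>r. - \<tau>' t * ?k r - \<eta> * ?a r)"
      by (intro continuous_intros)
    from rect_flux(2)[OF L2(13)[OF t0] L2(14)[OF t0] regD(13)[OF t0] trace_integrable(1)[OF t0] D this]
    show ?thesis
      using a1 \<eta> trace_integrable(2)[OF t0] by (simp add: outflow_def)
  qed
  moreover have "?IP (\<lambda>q. (- \<tau>' t * ?k (snd q) - \<eta> * ?a (snd q)) * z t q) (z t)
      = - \<tau>' t * ?IP (\<lambda>q. ?k (snd q) * z t q) (z t) - \<eta> * ?IP (\<lambda>q. ?a (snd q) * z t q) (z t)"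
  proof -
    have "(\<lambda>q. (- \<tau>' t * ?k (snd q) - \<eta> * ?a (snd q)) * z t q)
       = (\<lambda>q. - \<tau>' t * (?k (snd q) * z t q) - \<eta> * (?a (snd q) * z t q))"
      by (simp add: fun_eq_iff algebra_simps)
    moreover have "L2_on (rect L) (\<lambda>q. ?k (snd q) * z t q)" "L2_on (rect L) (\<lambda>q. ?a (snd q) * z t q)"
      by (intro L2_on_rect_mult L2(13) t0 continuous_intros)+
    ultimately show ?thesis
      by (simp only: L2_inner_diff_left[OF rect_sets L2_on_cmult L2_on_cmult L2(13)[OF t0]] L2_inner_cmult_left)
  qed
  ultimately show ?thesis
    by (auto elim!: DERIV_cong)
qed

end

subsection \<open>Lyapunov functional\<close>

text \<open>E dissipates only R, while J dissipates the complementary P at the cost of some R; a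
  small multiple of J is paid for by E. The constants are quantified before E, J and S, so one pair
  serves all solutions.\<close>

lemma Lyapunov_decay:
  fixes a b k c C C' :: real
  assumes pos: "a > 0" "b > 0" "k > 0" "c > 0" "C > 0" "C' > 0"
  shows "\<exists>M>0. \<exists>\<kappa>>0. \<forall>E J S :: real \<Rightarrow> real.
    continuous_on {0..} E \<longrightarrow> continuous_on {0..} J \<longrightarrow>
    (\<forall>t\<ge>0. c * S t \<le> E t \<and> E t \<le> C * S t \<and> \<bar>J t\<bar> \<le> C' * S t) \<longrightarrow>
    (\<forall>t>0. \<exists>DE DJ R P. (E has_real_derivative DE) (at t) \<and> (J has_real_derivative DJ) (at t) \<and>
       DE \<le> - a * R \<and> DJ \<le> - b * P + k * R \<and> 0 \<le> R \<and> 0 \<le> P \<and> S t \<le> R + P) \<longrightarrow>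
    (\<forall>t\<ge>0. S t \<le> M * exp (- \<kappa> * t) * S 0)"
proof -
  \<comment> \<open>\<open>e\<close> is small enough that k R costs at most half of the dissipation
    of E and that e J changes E by at most c S / 2. Then F = E + e J has derivative at most - m S
    and lies between c S / 2 and (C + c / 2) S; \<open>\<kappa>\<close> and \<open>M\<close> are the
    resulting rate and ratio of bounds.\<close>
  define e where "e = min (a / (2 * k)) (c / (2 * C'))"
  define m where "m = min (a / 2) (e * b)"
  define \<kappa> where "\<kappa> = m / (C + c / 2)"
  define M where "M = 2 / c * (C + c / 2)"
  have e: "e > 0" "e * k \<le> a / 2" "e * C' \<le> c / 2"
    using pos by (auto simp: e_def min_def field_simps)
  have m: "m > 0" "m \<le> a / 2" "m \<le> e * b"
    using pos e by (auto simp: m_def)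
  have \<kappa>: "\<kappa> > 0" "\<kappa> * (C + c / 2) = m"
    using m pos by (auto simp: \<kappa>_def)
  have M: "M > 0"
    using pos by (auto simp: M_def)
  show ?thesis
  proof (rule exI[of _ M], intro conjI M, rule exI[of _ \<kappa>], intro conjI allI impI \<kappa>(1))
    fix E J S :: "real \<Rightarrow> real" and t :: real
    assume contE: "continuous_on {0..} E" and contJ: "continuous_on {0..} J"
      and bounds: "\<forall>t\<ge>0. c * S t \<le> E t \<and> E t \<le> C * S t \<and> \<bar>J t\<bar> \<le> C' * S t"
      and deriv: "\<forall>t>0. \<exists>DE DJ R P. (E has_real_derivative DE) (at t) \<and> (J has_real_derivative DJ) (at t) \<and>
       DE \<le> - a * R \<and> DJ \<le> - b * P + k * R \<and> 0 \<le> R \<and> 0 \<le> P \<and> S t \<le> R + P"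
      and t: "0 \<le> t"
    define F where "F s = E s + e * J s" for s
    have F: "c / 2 * S s \<le> F s" "F s \<le> (C + c / 2) * S s" if "s \<ge> 0" for s
    proof -
      have J: "\<bar>J s\<bar> \<le> C' * S s" and E: "c * S s \<le> E s" "E s \<le> C * S s"
        using bounds that by auto
      \<comment> \<open>Nonnegativity of S follows from the bound on the absolute value of
        J.\<close>
      have "C' * S s \<ge> 0" using J by linarith
      then have S: "S s \<ge> 0" using pos by (simp add: zero_le_mult_iff)
      have "\<bar>e * J s\<bar> \<le> e * (C' * S s)"
        using J e by (simp add: abs_mult)
      also have "\<dots> \<le> c / 2 * S s"
        using mult_right_mono[OF e(3) S] by (simp add: mult.assoc)
      finally have "\<bar>e * J s\<bar> \<le> c / 2 * S s" .
      then show "c / 2 * S s \<le> F s" "F s \<le> (C + c / 2) * S s"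
        using E by (simp_all add: F_def distrib_right)
    qed
    have "exp (\<kappa> * t) * F t \<le> exp (\<kappa> * 0) * F 0"
    proof (rule DERIV_nonpos_imp_decreasing_open[OF t])
      show "continuous_on {0..t} (\<lambda>t. exp (\<kappa> * t) * F t)"
        unfolding F_def
        by (intro continuous_intros continuous_on_subset[OF contE] continuous_on_subset[OF contJ]) auto
      fix s :: real assume s: "0 < s" "s < t"
      then obtain DE DJ R P where D: "(E has_real_derivative DE) (at s)" "(J has_real_derivative DJ) (at s)"
        "DE \<le> - a * R" "DJ \<le> - b * P + k * R" "0 \<le> R" "0 \<le> P" "S s \<le> R + P"
        using deriv by blast
      have "e * DJ \<le> e * (- b * P + k * R)"
        using e D by simp
      also have "\<dots> = - (e * b) * P + (e * k) * R"
        by (simp add: algebra_simps)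
      also have "\<dots> \<le> - m * P + a / 2 * R"
        using mult_right_mono[OF m(3) D(6)] mult_right_mono[OF e(2) D(5)] by simp
      finally have "DE + e * DJ \<le> - m * P - a / 2 * R"
        using D(3) by (simp add: field_simps)
      also have "\<dots> \<le> - m * P - m * R"
        using mult_right_mono[OF m(2) D(5)] by simp
      also have "\<dots> \<le> - m * S s"
        using mult_left_mono[OF D(7), of m] m by (simp add: algebra_simps)
      also have "\<dots> \<le> - \<kappa> * F s"
        using mult_left_mono[OF F(2), of s \<kappa>] s \<kappa> by (simp flip: \<kappa>(2) add: mult.assoc)
      finally have le: "\<kappa> * F s + (DE + e * DJ) \<le> 0" by simp
      show "\<exists>y. ((\<lambda>t. exp (\<kappa> * t) * F t) has_real_derivative y) (at s) \<and> y \<le> 0"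
      proof (intro exI conjI)
        show "((\<lambda>t. exp (\<kappa> * t) * F t) has_real_derivative exp (\<kappa> * s) * (\<kappa> * F s + (DE + e * DJ))) (at s)"
          unfolding F_def by (auto intro!: derivative_eq_intros D simp: algebra_simps)
        show "exp (\<kappa> * s) * (\<kappa> * F s + (DE + e * DJ)) \<le> 0"
          using le by (simp add: mult_le_0_iff)
      qed
    qed
    then have "exp (\<kappa> * t) * F t \<le> (C + c / 2) * S 0"
      using F(2)[of 0] by simp
    then have "exp (- \<kappa> * t) * (exp (\<kappa> * t) * F t) \<le> exp (- \<kappa> * t) * ((C + c / 2) * S 0)"
      by (intro mult_left_mono) auto
    moreover have "exp (- \<kappa> * t) * (exp (\<kappa> * t) * F t) = F t"
      by (simp flip: mult.assoc exp_add)
    ultimately have "c / 2 * S t \<le> exp (- \<kappa> * t) * ((C + c / 2) * S 0)"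
      using F(1)[OF t] by linarith
    then show "S t \<le> M * exp (- \<kappa> * t) * S 0"
      using pos by (simp add: M_def field_simps)
  qed
qed

text \<open>The whole factor k is charged to u, so that w receives a share fixed in advance.\<close>

lemma L2_inner_Young_scaled:
  assumes "S \<in> sets lebesgue" "L2_on S u" "L2_on S w" "c > 0"
  shows "\<bar>k * L2_inner S u w\<bar> \<le> k\<^sup>2 / (2 * c) * L2_sqnorm S u + c / 2 * L2_sqnorm S w"
proof -
  have "L2_sqnorm S (\<lambda>x. k * u x) = k\<^sup>2 * L2_sqnorm S u"
    by (simp add: L2_sqnorm_def power_mult_distrib)
  then show ?thesis
    using L2_inner_Young[OF assms(1) L2_on_cmult[OF assms(2), of k] assms(3), of "1 / c"] assms(4)
    by (simp add: L2_inner_cmult_left)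
qed

lemma L2_inner_weight_bounds:
  assumes u: "L2_on (rect L) u" and k: "continuous_on UNIV k"
  shows "(\<And>r. 0 \<le> r \<Longrightarrow> r \<le> 1 \<Longrightarrow> a \<le> k r) \<Longrightarrow>
      a * L2_sqnorm (rect L) u \<le> L2_inner (rect L) (\<lambda>q. k (snd q) * u q) u"
    and "(\<And>r. 0 \<le> r \<Longrightarrow> r \<le> 1 \<Longrightarrow> k r \<le> b) \<Longrightarrow>
      L2_inner (rect L) (\<lambda>q. k (snd q) * u q) u \<le> b * L2_sqnorm (rect L) u"
proof -
  have i: "(\<lambda>q. k (snd q) * u q * u q) integrable_on rect L"
    by (intro L2_on_mult_integrable_on L2_on_rect_mult u k rect_sets)
  have j: "(\<lambda>q. c * (u q)\<^sup>2) integrable_on rect L" for c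
    by (intro integrable_on_mult_right L2_onD(2) u)
  show "a * L2_sqnorm (rect L) u \<le> L2_inner (rect L) (\<lambda>q. k (snd q) * u q) u"
    if "\<And>r. 0 \<le> r \<Longrightarrow> r \<le> 1 \<Longrightarrow> a \<le> k r"
  proof -
    have "integral (rect L) (\<lambda>q. a * (u q)\<^sup>2) \<le> integral (rect L) (\<lambda>q. k (snd q) * u q * u q)"
      by (rule integral_le[OF j i])
        (auto simp: rect_def power2_eq_square mult.assoc intro!: mult_right_mono that)
    then show ?thesis by (simp add: L2_sqnorm_def L2_inner_def)
  qed
  show "L2_inner (rect L) (\<lambda>q. k (snd q) * u q) u \<le> b * L2_sqnorm (rect L) u"
    if "\<And>r. 0 \<le> r \<Longrightarrow> r \<le> 1 \<Longrightarrow> k r \<le> b"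
  proof -
    have "integral (rect L) (\<lambda>q. k (snd q) * u q * u q) \<le> integral (rect L) (\<lambda>q. b * (u q)\<^sup>2)"
      by (rule integral_le[OF i j])
        (auto simp: rect_def power2_eq_square mult.assoc intro!: mult_right_mono that)
    then show ?thesis by (simp add: L2_sqnorm_def L2_inner_def)
  qed
qed

text \<open>v and p vanish at 0, so by Poincare their own norms are controlled by those of v_x and
  p_x.\<close>

fun H_sqnorm :: "real \<Rightarrow> beam_traj \<Rightarrow> real \<Rightarrow> real" where
  "H_sqnorm L (v, vx, vt, p, px, pt, z) t =
     L2_sqnorm {0..L} (vt t) + L2_sqnorm {0..L} (pt t) + L2_sqnorm {0..L} (vx t) + L2_sqnorm {0..L} (px t)
     + L2_sqnorm (rect L) (z t)"

section \<open>Choice of the constants\<close>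

context beam
begin

definition "\<omega> = sqrt (1 - d)"
text \<open>The weight for which Young's inequality charges v_t and sqrt(1 - d) z(.,1) equally. The
  condition on \<open>\<xi>bar\<close> becomes sigma < xibar < 2 - sigma.\<close>

definition "\<sigma> = \<beta>0 / \<omega>"
text \<open>Chosen so that \<open>\<xi>bar * (1 - \<eta>)\<close> is the midpoint of sigma and
  xibar: it still beats sigma at the outflow, and eta is positive.\<close>

definition "\<eta> = (\<xi>bar - \<sigma>) / (2 * \<xi>bar)"
text \<open>The minimum runs over the remaining coefficients of the squared norms of v_t, z(.,1) and
  z; \<open>\<delta>0\<close> bounds their common factor \<open>\<delta>1\<close>.\<close>

definition "dissipation_rate = \<delta>0 * min (1 - \<sigma> / 2 - \<xi>bar / 2)
   (min (\<omega>\<^sup>2 * (\<xi>bar - \<sigma>) / 4) ((\<xi>bar - \<sigma>) / 4 * min 1 (1 - d)))"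

lemma \<omega>: "\<omega> > 0" "\<omega>\<^sup>2 = 1 - d"
  using d by (auto simp: \<omega>_def)

lemma \<sigma>: "\<sigma> > 0" "\<sigma> < \<xi>bar" "\<xi>bar < 2 - \<sigma>"
  using \<xi>bar_gt \<xi>bar_less pos(9) \<omega> by (auto simp: \<sigma>_def \<omega>_def)

lemma \<eta>: "0 < \<eta>" "\<eta> < 1 / 2" "\<xi>bar * (1 - \<eta>) = (\<xi>bar + \<sigma>) / 2" "\<xi>bar * \<eta> = (\<xi>bar - \<sigma>) / 2"
  using \<sigma> by (auto simp: \<eta>_def field_simps)

lemma dissipation_rate: "dissipation_rate > 0"
  using \<sigma> \<omega> d pos by (auto simp: dissipation_rate_def intro!: mult_pos_pos)

text \<open>
  The coefficients of the multiplier functional are chosen such that the indefinite term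
  \<open>\<langle>v\<^sub>x, p\<^sub>x\<rangle>\<close> in its derivative cancels.
\<close>
definition "mult_K = 2 * \<alpha> / \<alpha>1"
definition "mult_N = 2 / \<gamma>"
definition "mult_Q = (mult_K - 1) * \<gamma> + mult_N * \<alpha> / \<beta>"
definition "mult_rate = min (\<mu> / 2) (min (\<gamma>\<^sup>2 * \<beta> / 2) (\<beta> / 2))"
text \<open>The sum of what Young's inequality charges to v_t and z(.,1). The parameters
  \<open>\<gamma>\<^sup>2 * \<beta> / (2 * L\<^sup>2)\<close> and
  \<open>\<beta> / (2 * L\<^sup>2)\<close> are such that, after Poincare, each pairing with v or p
  takes a quarter of the available v_x or p_x term.\<close>

definition "mult_loss = mult_K * \<rho> + (mult_Q * \<mu> - mult_N * \<rho>)\<^sup>2 / (2 * \<mu>)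
   + (mult_K * \<delta>1 0)\<^sup>2 / (2 * (\<gamma>\<^sup>2 * \<beta> / (2 * L\<^sup>2))) + (mult_N * \<delta>1 0)\<^sup>2 / (2 * (\<beta> / (2 * L\<^sup>2)))
   + (mult_K\<^sup>2 / (2 * (\<gamma>\<^sup>2 * \<beta> / (2 * L\<^sup>2))) + mult_N\<^sup>2 / (2 * (\<beta> / (2 * L\<^sup>2)))) * (\<beta>0 * \<delta>1 0)\<^sup>2"
definition "mult_bound = (\<bar>mult_K * \<rho>\<bar> + \<bar>mult_N * \<rho>\<bar> + \<bar>mult_Q * \<mu>\<bar> + \<bar>\<mu>\<bar>) * (1 + L\<^sup>2)"
text \<open>The third and fourth entries come from \<open>coupling_bounds\<close>; the last is
  \<open>\<xi>bar / 2 * \<delta>0 * \<tau>0\<close> times 1/2, a lower bound of 1 - eta r.\<close>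

definition "energy_lower = Min {\<rho> / 2, \<mu> / 2, \<alpha>1 / 4, \<alpha>1 / (\<alpha>1 + 2 * \<beta> * \<gamma>\<^sup>2) * \<beta> / 4, \<xi>bar * \<delta>0 * \<tau>0 / 4}"
definition "energy_upper = \<rho> / 2 + \<mu> / 2 + (\<alpha>1 / 2 + \<beta> * \<gamma>\<^sup>2) + \<beta> + \<xi>bar / 2 * \<delta>1 0 * \<tau>bar"

lemma \<alpha>_pos: "\<alpha> > 0"
  using pos by (auto simp: \<alpha>_eq intro!: add_pos_pos)

lemma mult_pos: "mult_K > 0" "mult_rate > 0" "mult_loss > 0" "mult_bound > 0"
proof -
  show K: "mult_K > 0" "mult_rate > 0"
    using pos \<alpha>_pos by (auto simp: mult_K_def mult_rate_def)
  show "mult_loss > 0"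
    unfolding mult_loss_def using pos K
    by (intro add_pos_nonneg add_nonneg_nonneg mult_nonneg_nonneg divide_nonneg_nonneg) auto
  have "\<bar>\<mu>\<bar> > 0" using pos by simp
  then show "mult_bound > 0"
    unfolding mult_bound_def using pos by (intro mult_pos_pos add_nonneg_pos) (auto intro: add_pos_nonneg)
qed

text \<open>N gamma = 2 leaves beta in front of the p_x term. Inserting the Q that removes the cross
  term turns the v_x coefficient into K alpha1 + gamma^2 beta - 2 alpha, and K alpha1 = 2 alpha
  reduces it to gamma^2 beta.\<close>

lemma mult_coeffs: "mult_K * \<alpha> - mult_Q * \<gamma> * \<beta> = \<gamma>\<^sup>2 * \<beta>" "mult_N * \<gamma> * \<beta> - \<beta> = \<beta>"
  "mult_K * \<gamma> * \<beta> + mult_N * \<alpha> - mult_Q * \<beta> - \<gamma> * \<beta> = 0"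
proof -
  have N: "mult_N * \<gamma> = 2" and NQ: "mult_Q * \<beta> = (mult_K - 1) * \<gamma> * \<beta> + mult_N * \<alpha>" and K: "mult_K * \<alpha>1 = 2 * \<alpha>"
    using pos by (auto simp: mult_N_def mult_Q_def mult_K_def field_simps)
  show "mult_N * \<gamma> * \<beta> - \<beta> = \<beta>" using N by simp
  show "mult_K * \<gamma> * \<beta> + mult_N * \<alpha> - mult_Q * \<beta> - \<gamma> * \<beta> = 0"
    unfolding NQ by (simp add: algebra_simps)
  have "mult_Q * \<gamma> * \<beta> = (mult_Q * \<beta>) * \<gamma>" by simp
  also have "\<dots> = (mult_K - 1) * \<gamma>\<^sup>2 * \<beta> + (mult_N * \<gamma>) * \<alpha>"
    unfolding NQ by (simp add: algebra_simps power2_eq_square)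
  finally have "mult_K * \<alpha> - mult_Q * \<gamma> * \<beta> = mult_K * (\<alpha> - \<gamma>\<^sup>2 * \<beta>) + \<gamma>\<^sup>2 * \<beta> - 2 * \<alpha>"
    unfolding N by (simp add: algebra_simps)
  also have "\<alpha> - \<gamma>\<^sup>2 * \<beta> = \<alpha>1" by (simp add: \<alpha>_eq)
  finally show "mult_K * \<alpha> - mult_Q * \<gamma> * \<beta> = \<gamma>\<^sup>2 * \<beta>"
    using K by simp
qed

lemma energy_lower_pos: "energy_lower > 0"
  using pos \<sigma> by (auto simp: energy_lower_def add_pos_pos)

lemma energy_upper_pos: "energy_upper > 0"
  unfolding energy_upper_def using pos \<sigma> \<delta>1_ge[of 0] \<tau>bar_pos
  by (intro add_pos_nonneg add_nonneg_nonneg) auto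

lemma coupling_sqnorm:
  assumes f: "L2_on {0..L} f" and g: "L2_on {0..L} g"
  shows "L2_sqnorm {0..L} (\<lambda>x. \<gamma> * f x - g x) =
    L2_sqnorm {0..L} g - 2 * \<gamma> * L2_inner {0..L} g f + \<gamma>\<^sup>2 * L2_sqnorm {0..L} f"
proof -
  have "L2_sqnorm {0..L} (\<lambda>x. \<gamma> * f x - g x) = L2_sqnorm {0..L} (\<lambda>x. g x + (- \<gamma>) * f x)"
    by (simp add: L2_sqnorm_def power2_commute)
  then show ?thesis
    using L2_sqnorm_add_cmult[OF _ g f, of "- \<gamma>"] by simp
qed

text \<open>The square of gamma f - g controls g only up to a multiple of the square of f. Therefore
  just a fraction s of it is used, small enough for the loss to be at most half of the alpha1
  term.\<close>

lemma coupling_bounds: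
  assumes f: "L2_on {0..L} f" and g: "L2_on {0..L} g"
  shows "\<alpha>1 / 4 * L2_sqnorm {0..L} f + \<alpha>1 / (\<alpha>1 + 2 * \<beta> * \<gamma>\<^sup>2) * \<beta> / 4 * L2_sqnorm {0..L} g
      \<le> \<alpha>1 / 2 * L2_sqnorm {0..L} f + \<beta> / 2 * L2_sqnorm {0..L} (\<lambda>x. \<gamma> * f x - g x)"
    and "\<beta> / 2 * L2_sqnorm {0..L} (\<lambda>x. \<gamma> * f x - g x)
      \<le> \<beta> * L2_sqnorm {0..L} g + \<beta> * \<gamma>\<^sup>2 * L2_sqnorm {0..L} f"
proof -
  define s where "s = \<alpha>1 / (\<alpha>1 + 2 * \<beta> * \<gamma>\<^sup>2)"
  define X where "X = L2_sqnorm {0..L} f"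
  define Y where "Y = L2_sqnorm {0..L} g"
  define G where "G = L2_sqnorm {0..L} (\<lambda>x. \<gamma> * f x - g x)"
  have nonneg: "X \<ge> 0" "G \<ge> 0" by (auto simp: X_def G_def L2_sqnorm_nonneg)
  have sq: "0 \<le> Y + 2 * c * L2_inner {0..L} g f + c\<^sup>2 * X" for c
    using L2_sqnorm_add_cmult[OF _ g f, of c] L2_sqnorm_nonneg[of "{0..L}" "\<lambda>x. g x + c * f x"]
    by (simp add: X_def Y_def)
  have Geq: "G = Y - 2 * \<gamma> * L2_inner {0..L} g f + \<gamma>\<^sup>2 * X"
    using coupling_sqnorm[OF f g] by (simp add: G_def X_def Y_def)
  \<comment> \<open>Both are completed squares, of g - 2 gamma f and of g + gamma f.\<close>
  have G: "Y / 2 - \<gamma>\<^sup>2 * X \<le> G" "G \<le> 2 * Y + 2 * \<gamma>\<^sup>2 * X"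
    using sq[of "- 2 * \<gamma>"] sq[of \<gamma>] by (auto simp: Geq power2_eq_square algebra_simps)
  have s: "0 < s" "s \<le> 1" "s * \<beta> * \<gamma>\<^sup>2 \<le> \<alpha>1 / 2"
    using pos by (auto simp: s_def field_simps add_pos_pos)
  have "s * (\<beta> / 2) * (Y / 2 - \<gamma>\<^sup>2 * X) \<le> s * (\<beta> / 2) * G"
    using G s pos by (intro mult_left_mono) auto
  also have "\<dots> \<le> 1 * (\<beta> / 2) * G"
    using s pos nonneg by (intro mult_right_mono) auto
  finally have "s * \<beta> / 4 * Y - (s * \<beta> * \<gamma>\<^sup>2) / 2 * X \<le> \<beta> / 2 * G"
    by (simp add: algebra_simps)
  moreover have "(s * \<beta> * \<gamma>\<^sup>2) / 2 * X \<le> (\<alpha>1 / 2) / 2 * X"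
    by (rule mult_right_mono[OF divide_right_mono[OF s(3)] nonneg(1)]) simp
  ultimately have "\<alpha>1 / 4 * X + s * \<beta> / 4 * Y \<le> \<alpha>1 / 2 * X + \<beta> / 2 * G"
    by linarith
  then show "\<alpha>1 / 4 * L2_sqnorm {0..L} f + \<alpha>1 / (\<alpha>1 + 2 * \<beta> * \<gamma>\<^sup>2) * \<beta> / 4 * L2_sqnorm {0..L} g
      \<le> \<alpha>1 / 2 * L2_sqnorm {0..L} f + \<beta> / 2 * L2_sqnorm {0..L} (\<lambda>x. \<gamma> * f x - g x)"
    by (simp only: X_def Y_def G_def s_def)
  have "\<beta> / 2 * G \<le> \<beta> / 2 * (2 * Y + 2 * \<gamma>\<^sup>2 * X)"
    using G pos by (intro mult_left_mono) auto
  then have "\<beta> / 2 * G \<le> \<beta> * Y + \<beta> * \<gamma>\<^sup>2 * X"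
    by (simp add: algebra_simps)
  then show "\<beta> / 2 * L2_sqnorm {0..L} (\<lambda>x. \<gamma> * f x - g x)
      \<le> \<beta> * L2_sqnorm {0..L} g + \<beta> * \<gamma>\<^sup>2 * L2_sqnorm {0..L} f"
    by (simp only: X_def Y_def G_def)
qed

end

section \<open>Estimates along a strong solution\<close>

context strong_beam
begin

definition energy :: "real \<Rightarrow> real" where
  "energy t = wave_energy t + \<xi>bar / 2 * (\<delta>1 t * memory \<eta> t)"

abbreviation "nz t \<equiv> L2_sqnorm (rect L) (z t)"

lemma memory_bounds:
  assumes t: "t \<ge> 0"
  shows "\<tau>0 / 2 * nz t \<le> memory \<eta> t" and "memory \<eta> t \<le> \<tau>bar * nz t"
proof -
  have k: "continuous_on UNIV (\<lambda>r. 1 - \<eta> * r)" by (intro continuous_intros)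
  have r: "1 / 2 \<le> 1 - \<eta> * r" "1 - \<eta> * r \<le> 1" if "0 \<le> r" "r \<le> 1" for r
  proof -
    have "\<eta> * r \<le> \<eta>" using that \<eta>(1) by (simp add: mult_left_le)
    then show "1 / 2 \<le> 1 - \<eta> * r" using \<eta>(2) by linarith
    show "1 - \<eta> * r \<le> 1" using that \<eta>(1) by simp
  qed
  note b = L2_inner_weight_bounds[OF L2(13)[OF t] k]
  have b1: "1 / 2 * nz t \<le> L2_inner (rect L) (\<lambda>q. (1 - \<eta> * snd q) * z t q) (z t)"
    using b(1) r(1) by blast
  have b2: "L2_inner (rect L) (\<lambda>q. (1 - \<eta> * snd q) * z t q) (z t) \<le> 1 * nz t"
    using b(2) r(2) by blast
  have "\<tau>0 * (1 / 2 * nz t) \<le> memory \<eta> t"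
    unfolding memory_def using b1 \<tau>_ge[OF t] pos L2_sqnorm_nonneg[of "rect L" "z t"]
    by (intro mult_mono) auto
  then show "\<tau>0 / 2 * nz t \<le> memory \<eta> t" by simp
  have "memory \<eta> t \<le> \<tau>bar * (1 * nz t)"
    unfolding memory_def using b2 b1 \<tau>_le[OF t] \<tau>bar_pos L2_sqnorm_nonneg[of "rect L" "z t"]
    by (intro mult_mono) auto
  then show "memory \<eta> t \<le> \<tau>bar * nz t" by simp
qed

lemma energy_dissipation:
  assumes t: "t > 0"
  shows "\<exists>D. (energy has_real_derivative D) (at t) \<and>
     D \<le> - dissipation_rate * (nrm (vt t) + outflow t + nz t)"
proof -
  have t0: "t \<ge> 0" using t by simp
  let ?A = "nrm (vt t)" and ?O = "outflow t" and ?Z = "nz t" and ?S = "ip (delayed t) (vt t)"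
  let ?T = "L2_inner (rect L) (\<lambda>q. (1 - \<tau>' t * snd q) * z t q) (z t)"
  let ?d = "\<delta>1 t" and ?m = "min 1 (1 - d)"
  let ?DM = "?A - (1 - \<tau>' t) * (1 - \<eta>) * ?O - \<eta> * ?T"
  have dpos: "?d > 0" using \<delta>1_ge[OF t0] pos by linarith
  have nonneg: "?A \<ge> 0" "?O \<ge> 0" "?Z \<ge> 0"
    by (auto intro: L2_sqnorm_nonneg outflow_nonneg)
  have eta1: "\<eta> < 1" using \<eta> by simp
  have D: "(energy has_real_derivative (- ?d * ?A - ?S)
      + \<xi>bar / 2 * (\<delta>1' t * memory \<eta> t + ?DM * ?d)) (at t)"
    unfolding energy_def[abs_def]
    by (intro derivative_intros DERIV_cmult DERIV_mult wave_energy_deriv \<delta>1_deriv memory_deriv t eta1)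
  \<comment> \<open>Young with parameter \<open>\<delta>1 t * \<sigma>\<close>; since sigma omega =
    beta0, the outflow is charged delta1 sigma omega^2 / 2.\<close>
  have S: "- ?S \<le> ?d * \<sigma> / 2 * ?A + ?d * \<sigma> * \<omega>\<^sup>2 / 2 * ?O"
  proof -
    have c: "?d * \<sigma> > 0" using dpos \<sigma> by simp
    have "\<bar>1 * ?S\<bar> \<le> 1\<^sup>2 / (2 * (?d * \<sigma>)) * nrm (delayed t) + ?d * \<sigma> / 2 * ?A"
      by (rule L2_inner_Young_scaled[OF _ delayed_L2[OF t0] L2(3)[OF t0] c]) auto
    moreover have "nrm (delayed t) \<le> (\<beta>0 * ?d)\<^sup>2 * ?O"
      unfolding delayed_sqnorm[OF t]
      using \<delta>2_le[OF t0] nonneg dpos pos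
      by (intro mult_right_mono) (auto simp: power2_le_iff_abs_le)
    then have "1\<^sup>2 / (2 * (?d * \<sigma>)) * nrm (delayed t) \<le> 1\<^sup>2 / (2 * (?d * \<sigma>)) * ((\<beta>0 * ?d)\<^sup>2 * ?O)"
      using c by (intro mult_left_mono) auto
    moreover have "1\<^sup>2 / (2 * (?d * \<sigma>)) * ((\<beta>0 * ?d)\<^sup>2 * ?O) = ?d * \<sigma> * \<omega>\<^sup>2 / 2 * ?O"
      using dpos \<omega>(1) pos by (simp add: \<sigma>_def field_simps power2_eq_square)
    ultimately show ?thesis by linarith
  qed
  \<comment> \<open>\<open>\<tau>'\<close> has no lower bound: for negative values the weight is at
    least 1, otherwise at least 1 - d.\<close>
  have T: "?m * ?Z \<le> ?T"
  proof (rule L2_inner_weight_bounds(1)[OF L2(13)[OF t0]])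
    show "continuous_on UNIV (\<lambda>r. 1 - \<tau>' t * r)" by (intro continuous_intros)
    fix r :: real assume r: "0 \<le> r" "r \<le> 1"
    show "?m \<le> 1 - \<tau>' t * r"
    proof (cases "\<tau>' t \<le> 0")
      case True
      then have "\<tau>' t * r \<le> 0" using r by (simp add: mult_le_0_iff)
      then show ?thesis by linarith
    next
      case False
      then have "\<tau>' t * r \<le> \<tau>' t" using r by (simp add: mult_left_le)
      then show ?thesis using \<tau>'_le[OF t] by linarith
    qed
  qed
  \<comment> \<open>The memory is nonnegative and \<open>\<delta>1\<close> decreases, so
    differentiating the time weight only helps.\<close>
  have "\<delta>1' t * memory \<eta> t \<le> 0"
  proof -
    have "0 \<le> \<tau>0 / 2 * ?Z" using pos nonneg by simp
    then have "memory \<eta> t \<ge> 0" using memory_bounds(1)[OF t0] by linarith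
    then show ?thesis using \<delta>1'_nonpos[OF t] by (simp add: mult_nonpos_nonneg)
  qed
  moreover have "?DM \<le> ?A - \<omega>\<^sup>2 * (1 - \<eta>) * ?O - \<eta> * (?m * ?Z)"
  proof -
    have "\<omega>\<^sup>2 * (1 - \<eta>) * ?O \<le> (1 - \<tau>' t) * (1 - \<eta>) * ?O"
      using \<tau>'_le[OF t] nonneg eta1 \<omega>(2) by (intro mult_right_mono) auto
    moreover have "\<eta> * (?m * ?Z) \<le> \<eta> * ?T"
      using T \<eta> by (intro mult_left_mono) auto
    ultimately show ?thesis by linarith
  qed
  then have "?DM * ?d \<le> (?A - \<omega>\<^sup>2 * (1 - \<eta>) * ?O - \<eta> * (?m * ?Z)) * ?d"
    using dpos by (intro mult_right_mono) auto
  ultimately have "\<xi>bar / 2 * (\<delta>1' t * memory \<eta> t + ?DM * ?d)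
      \<le> \<xi>bar / 2 * ((?A - \<omega>\<^sup>2 * (1 - \<eta>) * ?O - \<eta> * (?m * ?Z)) * ?d)"
    using \<sigma> by (intro mult_left_mono) auto
  also have "\<dots> = ?d * (\<xi>bar / 2 * ?A - \<omega>\<^sup>2 / 2 * (\<xi>bar * (1 - \<eta>)) * ?O - (\<xi>bar * \<eta>) / 2 * ?m * ?Z)"
    by (simp add: field_simps)
  also have "\<dots> = ?d * (\<xi>bar / 2 * ?A - \<omega>\<^sup>2 / 2 * ((\<xi>bar + \<sigma>) / 2) * ?O - (\<xi>bar - \<sigma>) / 4 * ?m * ?Z)"
    unfolding \<eta>(3,4) by simp
  finally have "(- ?d * ?A - ?S) + \<xi>bar / 2 * (\<delta>1' t * memory \<eta> t + ?DM * ?d)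
      \<le> - ?d * ?A + (?d * \<sigma> / 2 * ?A + ?d * \<sigma> * \<omega>\<^sup>2 / 2 * ?O)
        + ?d * (\<xi>bar / 2 * ?A - \<omega>\<^sup>2 / 2 * ((\<xi>bar + \<sigma>) / 2) * ?O - (\<xi>bar - \<sigma>) / 4 * ?m * ?Z)"
    using S by linarith
  \<comment> \<open>The outflow balance is sigma omega^2 / 2 - omega^2 (xibar + sigma) / 4 = -
    omega^2 (xibar - sigma) / 4.\<close>
  also have "\<dots> = - ?d * ((1 - \<sigma> / 2 - \<xi>bar / 2) * ?A + \<omega>\<^sup>2 * (\<xi>bar - \<sigma>) / 4 * ?O + (\<xi>bar - \<sigma>) / 4 * ?m * ?Z)"
    by (simp add: field_simps)
  also have "\<dots> \<le> - dissipation_rate * (?A + ?O + ?Z)"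
  proof -
    define c where "c = min (1 - \<sigma> / 2 - \<xi>bar / 2) (min (\<omega>\<^sup>2 * (\<xi>bar - \<sigma>) / 4) ((\<xi>bar - \<sigma>) / 4 * ?m))"
    have c: "c \<le> 1 - \<sigma> / 2 - \<xi>bar / 2" "c \<le> \<omega>\<^sup>2 * (\<xi>bar - \<sigma>) / 4" "c \<le> (\<xi>bar - \<sigma>) / 4 * ?m"
      unfolding c_def by (rule min.cobounded1, rule min.coboundedI2[OF min.cobounded1], rule min.coboundedI2[OF min.cobounded2])
    have rate: "dissipation_rate = \<delta>0 * c"
      by (simp add: dissipation_rate_def c_def)
    then have c0: "c \<ge> 0"
      using dissipation_rate pos(8) by (simp add: zero_less_mult_iff)
    have "c * (?A + ?O + ?Z) \<le> (1 - \<sigma> / 2 - \<xi>bar / 2) * ?A + \<omega>\<^sup>2 * (\<xi>bar - \<sigma>) / 4 * ?O + (\<xi>bar - \<sigma>) / 4 * ?m * ?Z"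
      unfolding distrib_left
      by (intro add_mono mult_right_mono[OF c(1) nonneg(1)] mult_right_mono[OF c(2) nonneg(2)]
        mult_right_mono[OF c(3) nonneg(3)])
    from mult_left_mono[OF this less_imp_le[OF dpos]]
    have "?d * (c * (?A + ?O + ?Z)) \<le> ?d * ((1 - \<sigma> / 2 - \<xi>bar / 2) * ?A + \<omega>\<^sup>2 * (\<xi>bar - \<sigma>) / 4 * ?O + (\<xi>bar - \<sigma>) / 4 * ?m * ?Z)" .
    moreover have "\<delta>0 * (c * (?A + ?O + ?Z)) \<le> ?d * (c * (?A + ?O + ?Z))"
      using \<delta>1_ge[OF t0] c0 nonneg by (intro mult_right_mono mult_nonneg_nonneg) auto
    ultimately show ?thesis
      unfolding rate mult_minus_left mult.assoc[of \<delta>0] by linarith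
  qed
  finally show ?thesis
    using D by blast
qed

lemma multiplier_decrease:
  assumes t: "t > 0"
  shows "\<exists>D. (multiplier mult_K mult_N mult_Q has_real_derivative D) (at t) \<and>
     D \<le> - mult_rate * (nrm (vx t) + nrm (px t) + nrm (pt t)) + mult_loss * (nrm (vt t) + outflow t + nz t)"
proof -
  have t0: "t \<ge> 0" using t by simp
  let ?A = "nrm (vt t)" and ?B = "nrm (pt t)" and ?X = "nrm (vx t)" and ?Y = "nrm (px t)"
  let ?O = "outflow t" and ?d = "\<delta>1 t" and ?D = "\<delta>1 0" and ?w = "delayed t"
  let ?K = mult_K and ?N = mult_N and ?Q = mult_Q
  let ?cv = "\<gamma>\<^sup>2 * \<beta> / (2 * L\<^sup>2)" and ?cp = "\<beta> / (2 * L\<^sup>2)"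
  have nonneg: "?A \<ge> 0" "?B \<ge> 0" "?X \<ge> 0" "?Y \<ge> 0" "?O \<ge> 0" "nz t \<ge> 0"
    by (auto intro: L2_sqnorm_nonneg outflow_nonneg)
  have c: "?cv > 0" "?cp > 0" using pos by auto
  have dpos: "?d > 0" using \<delta>1_ge[OF t0] pos by linarith
  have dD: "?d\<^sup>2 \<le> ?D\<^sup>2" using \<delta>1_le[OF t0] dpos by (intro power_mono) auto
  have V: "?cv / 2 * nrm (v t) \<le> \<gamma>\<^sup>2 * \<beta> / 4 * ?X"
    using mult_left_mono[OF Poincare_inequality(2)[OF regD(1)[OF t0] regD(4)[OF t0] pos(1) L2(2)[OF t0]], of "?cv / 2"]
      c pos(1) by simp
  have P: "?cp / 2 * nrm (p t) \<le> \<beta> / 4 * ?Y"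
    using mult_left_mono[OF Poincare_inequality(2)[OF regD(6)[OF t0] regD(9)[OF t0] pos(1) L2(8)[OF t0]], of "?cp / 2"]
      c pos(1) by simp
  have W: "nrm ?w \<le> (\<beta>0 * ?D)\<^sup>2 * ?O"
  proof -
    have "(\<delta>2 t)\<^sup>2 \<le> (\<beta>0 * ?d)\<^sup>2"
      using \<delta>2_le[OF t0] dpos pos by (auto simp: power2_le_iff_abs_le)
    also have "\<dots> \<le> (\<beta>0 * ?D)\<^sup>2"
      using dD by (simp add: power_mult_distrib mult_left_mono)
    finally show ?thesis
      unfolding delayed_sqnorm[OF t] using nonneg by (intro mult_right_mono) auto
  qed
  have young: "\<bar>k * ip f g\<bar> \<le> k\<^sup>2 / (2 * c) * nrm f + c / 2 * nrm g"
    if "L2_on {0..L} f" "L2_on {0..L} g" "c > 0" for k c f g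
    by (rule L2_inner_Young_scaled) (use that in auto)
  have y1: "\<bar>(?Q * \<mu> - ?N * \<rho>) * ip (vt t) (pt t)\<bar> \<le> (?Q * \<mu> - ?N * \<rho>)\<^sup>2 / (2 * \<mu>) * ?A + \<mu> / 2 * ?B"
    by (rule young[OF L2(3)[OF t0] L2(9)[OF t0] pos(5)])
  have y2: "\<bar>?K * ?d * ip (vt t) (v t)\<bar> \<le> (?K * ?D)\<^sup>2 / (2 * ?cv) * ?A + \<gamma>\<^sup>2 * \<beta> / 4 * ?X"
  proof -
    have "(?K * ?d)\<^sup>2 / (2 * ?cv) * ?A \<le> (?K * ?D)\<^sup>2 / (2 * ?cv) * ?A"
      using dD c nonneg pos by (intro mult_right_mono divide_right_mono) (auto simp: power_mult_distrib mult_left_mono)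
    then show ?thesis using young[OF L2(3)[OF t0] L2(1)[OF t0] c(1), of "?K * ?d"] V by linarith
  qed
  have y3: "\<bar>?K * ip ?w (v t)\<bar> \<le> ?K\<^sup>2 / (2 * ?cv) * ((\<beta>0 * ?D)\<^sup>2 * ?O) + \<gamma>\<^sup>2 * \<beta> / 4 * ?X"
  proof -
    have "?K\<^sup>2 / (2 * ?cv) * nrm ?w \<le> ?K\<^sup>2 / (2 * ?cv) * ((\<beta>0 * ?D)\<^sup>2 * ?O)"
      using W c pos by (intro mult_left_mono) auto
    then show ?thesis using young[OF delayed_L2[OF t0] L2(1)[OF t0] c(1), of ?K] V by linarith
  qed
  have y4: "\<bar>?N * ?d * ip (vt t) (p t)\<bar> \<le> (?N * ?D)\<^sup>2 / (2 * ?cp) * ?A + \<beta> / 4 * ?Y"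
  proof -
    have "(?N * ?d)\<^sup>2 / (2 * ?cp) * ?A \<le> (?N * ?D)\<^sup>2 / (2 * ?cp) * ?A"
      using dD c nonneg pos by (intro mult_right_mono divide_right_mono) (auto simp: power_mult_distrib mult_left_mono)
    then show ?thesis using young[OF L2(3)[OF t0] L2(7)[OF t0] c(2), of "?N * ?d"] P by linarith
  qed
  have y5: "\<bar>?N * ip ?w (p t)\<bar> \<le> ?N\<^sup>2 / (2 * ?cp) * ((\<beta>0 * ?D)\<^sup>2 * ?O) + \<beta> / 4 * ?Y"
  proof -
    have "?N\<^sup>2 / (2 * ?cp) * nrm ?w \<le> ?N\<^sup>2 / (2 * ?cp) * ((\<beta>0 * ?D)\<^sup>2 * ?O)"
      using W c pos by (intro mult_left_mono) auto
    then show ?thesis using young[OF delayed_L2[OF t0] L2(7)[OF t0] c(2), of ?N] P by linarith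
  qed
  let ?R = "?K * \<rho> * ?A + (?Q * \<mu> - ?N * \<rho>) * ip (vt t) (pt t) - \<mu> * ?B
      - (?K * \<alpha> - ?Q * \<gamma> * \<beta>) * ?X - (?N * \<gamma> * \<beta> - \<beta>) * ?Y
      + (?K * \<gamma> * \<beta> + ?N * \<alpha> - ?Q * \<beta> - \<gamma> * \<beta>) * ip (vx t) (px t)
      - ?K * ?d * ip (vt t) (v t) - ?K * ip ?w (v t)
      + ?N * ?d * ip (vt t) (p t) + ?N * ip ?w (p t)"
  have "?R = ?K * \<rho> * ?A + (?Q * \<mu> - ?N * \<rho>) * ip (vt t) (pt t) - \<mu> * ?B - \<gamma>\<^sup>2 * \<beta> * ?X - \<beta> * ?Y
      - ?K * ?d * ip (vt t) (v t) - ?K * ip ?w (v t) + ?N * ?d * ip (vt t) (p t) + ?N * ip ?w (p t)"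
    unfolding mult_coeffs by simp
  also have "\<dots> \<le> - (\<mu> / 2) * ?B - \<gamma>\<^sup>2 * \<beta> / 2 * ?X - \<beta> / 2 * ?Y
      + (?K * \<rho> + (?Q * \<mu> - ?N * \<rho>)\<^sup>2 / (2 * \<mu>) + (?K * ?D)\<^sup>2 / (2 * ?cv) + (?N * ?D)\<^sup>2 / (2 * ?cp)) * ?A
      + (?K\<^sup>2 / (2 * ?cv) + ?N\<^sup>2 / (2 * ?cp)) * ((\<beta>0 * ?D)\<^sup>2 * ?O)"
  proof -
    \<comment> \<open>Two quarters of the v_x term and two quarters of the p_x term are consumed,
      and half of the p_t term, so half of each survives.\<close>
    have combine: "a + i1 - \<mu> * B - x - y - i2 - i3 + i4 + i5
        \<le> - (\<mu> / 2) * B - x / 2 - y / 2 + (a + a1 + a2 + a4) + (o3 + o5)"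
      if "\<bar>i1\<bar> \<le> a1 + \<mu> / 2 * B" "\<bar>i2\<bar> \<le> a2 + x / 4" "\<bar>i3\<bar> \<le> o3 + x / 4"
        "\<bar>i4\<bar> \<le> a4 + y / 4" "\<bar>i5\<bar> \<le> o5 + y / 4" for a i1 i2 i3 i4 i5 B x y a1 a2 a4 o3 o5 :: real
      using abs_le_D1[OF that(1)] abs_le_D2[OF that(2)] abs_le_D2[OF that(3)] abs_le_D1[OF that(4)]
        abs_le_D1[OF that(5)] by (simp add: field_simps)
    show ?thesis
      using combine[of "(?Q * \<mu> - ?N * \<rho>) * ip (vt t) (pt t)" _ ?B "?K * ?d * ip (vt t) (v t)" _ "\<gamma>\<^sup>2 * \<beta> * ?X"
          "?K * ip ?w (v t)" _ "?N * ?d * ip (vt t) (p t)" _ "\<beta> * ?Y" "?N * ip ?w (p t)" _ "?K * \<rho> * ?A"] y1 y2 y3 y4 y5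
      unfolding distrib_right by (simp only: times_divide_eq_left)
  qed
  also have "\<dots> \<le> - mult_rate * (?X + ?Y + ?B) + mult_loss * (?A + ?O + nz t)"
  proof -
    have r: "mult_rate \<le> \<mu> / 2" "mult_rate \<le> \<gamma>\<^sup>2 * \<beta> / 2" "mult_rate \<le> \<beta> / 2"
      by (auto simp: mult_rate_def)
    have "mult_rate * (?X + ?Y + ?B) \<le> \<gamma>\<^sup>2 * \<beta> / 2 * ?X + \<beta> / 2 * ?Y + \<mu> / 2 * ?B"
      unfolding distrib_left using r nonneg by (intro add_mono mult_right_mono) auto
    moreover
    define a where "a = ?K * \<rho> + (?Q * \<mu> - ?N * \<rho>)\<^sup>2 / (2 * \<mu>) + (?K * ?D)\<^sup>2 / (2 * ?cv) + (?N * ?D)\<^sup>2 / (2 * ?cp)"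
    define b where "b = (?K\<^sup>2 / (2 * ?cv) + ?N\<^sup>2 / (2 * ?cp)) * (\<beta>0 * ?D)\<^sup>2"
    have ab: "a \<ge> 0" "b \<ge> 0"
      unfolding a_def b_def
      using c pos mult_pos(1) by (auto intro!: add_nonneg_nonneg mult_nonneg_nonneg divide_nonneg_nonneg)
    have "mult_loss = a + b"
      by (simp add: mult_loss_def a_def b_def)
    \<comment> \<open>One common factor a + b for v_t, outflow and z only adds nonnegative terms to
      the bound.\<close>
    then have "mult_loss * (?A + ?O + nz t) = a * ?A + b * ?O + (a * ?O + a * nz t + b * ?A + b * nz t)"
      by (simp add: algebra_simps)
    moreover have "0 \<le> a * ?O + a * nz t + b * ?A + b * nz t"
      using ab nonneg by (intro add_nonneg_nonneg mult_nonneg_nonneg) auto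
    moreover have "(?K\<^sup>2 / (2 * ?cv) + ?N\<^sup>2 / (2 * ?cp)) * ((\<beta>0 * ?D)\<^sup>2 * ?O) = b * ?O"
      by (simp only: b_def mult.assoc)
    ultimately show ?thesis
      unfolding a_def[symmetric] by linarith
  qed
  finally show ?thesis
    using multiplier_deriv[OF t, of ?K ?N ?Q] by blast
qed

abbreviation "S \<equiv> H_sqnorm L (v, vx, vt, p, px, pt, z)"

lemma multiplier_bound:
  assumes t: "t \<ge> 0"
  shows "\<bar>multiplier mult_K mult_N mult_Q t\<bar> \<le> mult_bound * S t"
proof -
  let ?A = "nrm (vt t)" and ?B = "nrm (pt t)" and ?X = "nrm (vx t)" and ?Y = "nrm (px t)"
  let ?K = mult_K and ?N = mult_N and ?Q = mult_Q
  have nonneg: "?A \<ge> 0" "?B \<ge> 0" "?X \<ge> 0" "?Y \<ge> 0" "nz t \<ge> 0"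
    by (auto intro: L2_sqnorm_nonneg)
  have S: "?A \<le> S t" "?B \<le> S t" "?X \<le> S t" "?Y \<le> S t" "S t \<ge> 0"
    using nonneg by auto
  have V: "nrm (v t) \<le> L\<^sup>2 * S t"
    using Poincare_inequality(2)[OF regD(1)[OF t] regD(4)[OF t] pos(1) L2(2)[OF t]]
      mult_left_mono[OF S(3), of "L\<^sup>2"] by (simp del: H_sqnorm.simps)
  have P: "nrm (p t) \<le> L\<^sup>2 * S t"
    using Poincare_inequality(2)[OF regD(6)[OF t] regD(9)[OF t] pos(1) L2(8)[OF t]]
      mult_left_mono[OF S(4), of "L\<^sup>2"] by (simp del: H_sqnorm.simps)
  have young: "\<bar>k * ip f g\<bar> \<le> \<bar>k\<bar> * ((1 + L\<^sup>2) * S t)"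
    if "L2_on {0..L} f" "L2_on {0..L} g" "nrm f + nrm g \<le> (1 + L\<^sup>2) * S t" for k f g
  proof -
    have "\<bar>ip f g\<bar> \<le> 1 / 2 * nrm f + 1 / (2 * 1) * nrm g"
      by (rule L2_inner_Young) (use that in auto)
    also have "\<dots> \<le> (1 + L\<^sup>2) * S t"
      using that(3) L2_sqnorm_nonneg[of "{0..L}" f] L2_sqnorm_nonneg[of "{0..L}" g] by linarith
    finally show ?thesis by (simp add: abs_mult mult_left_mono del: H_sqnorm.simps)
  qed
  have "nrm (v t) + nrm (vt t) \<le> (1 + L\<^sup>2) * S t" "nrm (vt t) + nrm (p t) \<le> (1 + L\<^sup>2) * S t"
    "nrm (pt t) + nrm (v t) \<le> (1 + L\<^sup>2) * S t" "nrm (p t) + nrm (pt t) \<le> (1 + L\<^sup>2) * S t"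
    unfolding distrib_right mult_1 using V P S by linarith+
  note sums = young[OF L2(1)[OF t] L2(3)[OF t] this(1)] young[OF L2(3)[OF t] L2(7)[OF t] this(2)]
    young[OF L2(9)[OF t] L2(1)[OF t] this(3)] young[OF L2(7)[OF t] L2(9)[OF t] this(4)]
  have "\<bar>multiplier mult_K mult_N mult_Q t\<bar>
      \<le> (\<bar>?K * \<rho>\<bar> + \<bar>?N * \<rho>\<bar> + \<bar>?Q * \<mu>\<bar> + \<bar>\<mu>\<bar>) * ((1 + L\<^sup>2) * S t)"
  proof -
    have tri: "\<bar>a - b + c - e\<bar> \<le> \<bar>a\<bar> + \<bar>b\<bar> + \<bar>c\<bar> + \<bar>e\<bar>" for a b c e :: real
      by linarith
    show ?thesis
      unfolding multiplier_def distrib_right[of _ _ "(1 + L\<^sup>2) * S t"]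
      by (rule order_trans[OF tri]) (intro add_mono sums)
  qed
  then show ?thesis by (simp add: mult_bound_def mult.assoc del: H_sqnorm.simps)
qed

lemma energy_bounds:
  assumes t: "t \<ge> 0"
  shows "energy_lower * S t \<le> energy t" and "energy t \<le> energy_upper * S t"
proof -
  let ?A = "nrm (vt t)" and ?B = "nrm (pt t)" and ?X = "nrm (vx t)" and ?Y = "nrm (px t)"
  let ?m = "\<delta>1 t * memory \<eta> t"
  let ?s = "\<alpha>1 / (\<alpha>1 + 2 * \<beta> * \<gamma>\<^sup>2)"
  define G where "G = nrm (\<lambda>x. \<gamma> * vx t x - px t x)"
  have nonneg: "?A \<ge> 0" "?B \<ge> 0" "?X \<ge> 0" "?Y \<ge> 0" "nz t \<ge> 0"
    by (auto intro: L2_sqnorm_nonneg)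
  note G = coupling_bounds[OF L2(2)[OF t] L2(8)[OF t], folded G_def]
  have W: "wave_energy t = \<rho> / 2 * ?A + \<mu> / 2 * ?B + \<alpha>1 / 2 * ?X + \<beta> / 2 * G"
  proof -
    have Geq: "G = ?Y - 2 * \<gamma> * ip (px t) (vx t) + \<gamma>\<^sup>2 * ?X"
      unfolding G_def by (rule coupling_sqnorm[OF L2(2)[OF t] L2(8)[OF t]])
    then show ?thesis
      unfolding wave_energy_def Geq L2_sqnorm_eq
      using L2_inner_commute[of "{0..L}" "vx t" "px t"] by (simp add: \<alpha>_eq field_simps)
  qed
  have m1: "\<delta>0 * (\<tau>0 / 2 * nz t) \<le> ?m"
    using memory_bounds(1)[OF t] \<delta>1_ge[OF t] pos nonneg by (intro mult_mono) auto
  then have "\<xi>bar / 2 * (\<delta>0 * (\<tau>0 / 2 * nz t)) \<le> \<xi>bar / 2 * ?m"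
    using \<sigma> by (intro mult_left_mono) auto
  also have "\<xi>bar / 2 * (\<delta>0 * (\<tau>0 / 2 * nz t)) = \<xi>bar * \<delta>0 * \<tau>0 / 4 * nz t"
    by simp
  finally have low: "\<rho> / 2 * ?A + \<mu> / 2 * ?B + \<alpha>1 / 4 * ?X + ?s * \<beta> / 4 * ?Y + \<xi>bar * \<delta>0 * \<tau>0 / 4 * nz t \<le> energy t"
    using G(1) unfolding energy_def W by linarith
  have el: "energy_lower \<le> \<rho> / 2" "energy_lower \<le> \<mu> / 2" "energy_lower \<le> \<alpha>1 / 4"
    "energy_lower \<le> ?s * \<beta> / 4" "energy_lower \<le> \<xi>bar * \<delta>0 * \<tau>0 / 4"
    unfolding energy_lower_def by (rule Min_le; simp)+
  have "energy_lower * S t \<le> \<rho> / 2 * ?A + \<mu> / 2 * ?B + \<alpha>1 / 4 * ?X + ?s * \<beta> / 4 * ?Y + \<xi>bar * \<delta>0 * \<tau>0 / 4 * nz t"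
    unfolding H_sqnorm.simps distrib_left using el nonneg by (intro add_mono mult_right_mono) auto
  then show "energy_lower * S t \<le> energy t" using low by linarith
  have "?m \<le> \<delta>1 0 * (\<tau>bar * nz t)"
    using memory_bounds[OF t] \<delta>1_le[OF t] \<delta>1_ge[of 0] pos nonneg
    by (intro mult_mono) (auto intro: order_trans[of _ "\<tau>0 / 2 * nz t"])
  then have "\<xi>bar / 2 * ?m \<le> \<xi>bar / 2 * (\<delta>1 0 * (\<tau>bar * nz t))"
    using \<sigma> by (intro mult_left_mono) auto
  then have "energy t \<le> \<rho> / 2 * ?A + \<mu> / 2 * ?B + (\<alpha>1 / 2 + \<beta> * \<gamma>\<^sup>2) * ?X + \<beta> * ?Y + \<xi>bar / 2 * \<delta>1 0 * \<tau>bar * nz t"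
    using G(2) unfolding energy_def W by (simp add: algebra_simps)
  also have "\<dots> \<le> energy_upper * S t"
    unfolding H_sqnorm.simps distrib_left using nonneg pos \<sigma> \<delta>1_ge[of 0] \<tau>bar_pos
    by (intro add_mono mult_right_mono) (auto simp: energy_upper_def)
  finally show "energy t \<le> energy_upper * S t" .
qed

lemma energy_continuous: "continuous_on {0..} energy"
proof -
  have kz: "L2_C1 (rect L) (\<lambda>t q. (1 - \<eta> * snd q) * z t q) (\<lambda>t q. (1 - \<eta> * snd q) * zt t q)"
    by (rule weighted_C1[OF C1(7)])
  show ?thesis
    unfolding energy_def[abs_def] wave_energy_def[abs_def] memory_def[abs_def]
    by (intro continuous_intros L2_inner_continuous \<delta>1_continuous \<tau>_continuous rect_sets
      C1[THEN L2_C1D(1)] L2_C1D(1)[OF kz]) auto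
qed

lemma multiplier_continuous: "continuous_on {0..} (multiplier K N Q)"
  unfolding multiplier_def[abs_def]
  by (intro continuous_intros L2_inner_continuous C1[THEN L2_C1D(1)]) auto

end

context beam
begin

lemma strong_decay:
  "\<exists>M>0. \<exists>\<kappa>>0. \<forall>g0 U. strong_beam_solution L \<rho> \<alpha> \<gamma> \<mu> \<beta> \<tau> \<tau>' \<delta>1 \<delta>2 g0 U \<longrightarrow>
     (\<forall>t\<ge>0. H_sqnorm L U t \<le> M * exp (- \<kappa> * t) * H_sqnorm L U 0)"
proof -
  from Lyapunov_decay[OF dissipation_rate mult_pos(2,3) energy_lower_pos energy_upper_pos mult_pos(4)]
  obtain M \<kappa> where M: "M > 0" "\<kappa> > 0" and decay: "\<And>E J S :: real \<Rightarrow> real.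
    continuous_on {0..} E \<Longrightarrow> continuous_on {0..} J \<Longrightarrow>
    (\<forall>t\<ge>0. energy_lower * S t \<le> E t \<and> E t \<le> energy_upper * S t \<and> \<bar>J t\<bar> \<le> mult_bound * S t) \<Longrightarrow>
    (\<forall>t>0. \<exists>DE DJ R P. (E has_real_derivative DE) (at t) \<and> (J has_real_derivative DJ) (at t) \<and>
       DE \<le> - dissipation_rate * R \<and> DJ \<le> - mult_rate * P + mult_loss * R \<and> 0 \<le> R \<and> 0 \<le> P \<and> S t \<le> R + P) \<Longrightarrow>
    (\<forall>t\<ge>0. S t \<le> M * exp (- \<kappa> * t) * S 0)"
    by metis
  have "\<forall>t\<ge>0. H_sqnorm L U t \<le> M * exp (- \<kappa> * t) * H_sqnorm L U 0"
    if sol: "strong_beam_solution L \<rho> \<alpha> \<gamma> \<mu> \<beta> \<tau> \<tau>' \<delta>1 \<delta>2 g0 U" for g0 U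
  proof -
    obtain v vx vt p px pt z where U: "U = (v, vx, vt, p, px, pt, z)" by (rule prod_cases7)
    from sol[unfolded U strong_beam_solution.simps] obtain vxx vtx vtt pxx ptx ptt zr zt where
      reg: "strong_regularity L (v, vx, vt, p, px, pt, z) vxx vtx vtt pxx ptx ptt zr zt"
      and eqs: "\<forall>t>0.
           (AE x in lebesgue_on {0..L}.
              \<rho> * vtt t x - \<alpha> * vxx t x + \<gamma> * \<beta> * pxx t x
                + \<delta>1 t * vt t x + \<delta>2 t * z t (x, 1) = 0) \<and>
           (AE x in lebesgue_on {0..L}.
              \<mu> * ptt t x - \<beta> * pxx t x + \<gamma> * \<beta> * vxx t x = 0) \<and>
           (AE (x, r) in lebesgue_on (rect L).
              \<tau> t * zt t (x, r) + (1 - \<tau>' t * r) * zr t (x, r) = 0)"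
      by blast
    interpret strong_beam L \<rho> \<alpha> \<alpha>1 \<gamma> \<mu> \<beta> \<tau> \<tau>' \<tau>0 \<tau>bar d \<delta>1 \<delta>1' \<delta>2 \<delta>0 \<beta>0 \<xi>bar
        v vx vt p px pt vxx vtx vtt pxx ptx ptt z zr zt
      by unfold_locales (use reg eqs in blast)+
    show ?thesis
      unfolding U
    proof (rule decay[OF energy_continuous multiplier_continuous[of mult_K mult_N mult_Q]])
      show "\<forall>t\<ge>0. energy_lower * S t \<le> energy t \<and> energy t \<le> energy_upper * S t \<and>
          \<bar>multiplier mult_K mult_N mult_Q t\<bar> \<le> mult_bound * S t"
        using energy_bounds multiplier_bound by blast
      show "\<forall>t>0. \<exists>DE DJ R P. (energy has_real_derivative DE) (at t) \<and>
          (multiplier mult_K mult_N mult_Q has_real_derivative DJ) (at t) \<and>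
          DE \<le> - dissipation_rate * R \<and> DJ \<le> - mult_rate * P + mult_loss * R \<and> 0 \<le> R \<and> 0 \<le> P \<and> S t \<le> R + P"
      proof (intro allI impI)
        fix t :: real assume t: "t > 0"
        \<comment> \<open>R is what the energy dissipates, P what the multiplier recovers; together
          they contain every summand of S.\<close>
        let ?R = "nrm (vt t) + outflow t + nz t" and ?P = "nrm (vx t) + nrm (px t) + nrm (pt t)"
        have "0 \<le> ?R" "0 \<le> ?P" "S t \<le> ?R + ?P"
          using outflow_nonneg by (auto intro!: add_nonneg_nonneg L2_sqnorm_nonneg)
        then show "\<exists>DE DJ R P. (energy has_real_derivative DE) (at t) \<and>
          (multiplier mult_K mult_N mult_Q has_real_derivative DJ) (at t) \<and>
          DE \<le> - dissipation_rate * R \<and> DJ \<le> - mult_rate * P + mult_loss * R \<and> 0 \<le> R \<and> 0 \<le> P \<and> S t \<le> R + P"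
          using energy_dissipation[OF t] multiplier_decrease[OF t] by blast
      qed
    qed
  qed
  then show ?thesis using M by blast
qed

end

subsection \<open>Weak solutions\<close>

fun H_L2 :: "real \<Rightarrow> beam_traj \<Rightarrow> real \<Rightarrow> bool" where
  "H_L2 L (v, vx, vt, p, px, pt, z) t \<longleftrightarrow>
     L2_on {0..L} (v t) \<and> L2_on {0..L} (vx t) \<and> L2_on {0..L} (vt t) \<and>
     L2_on {0..L} (p t) \<and> L2_on {0..L} (px t) \<and> L2_on {0..L} (pt t) \<and> L2_on (rect L) (z t)"

lemma H_sqnorm_tendsto:
  assumes Us: "\<And>n. H_L2 L (Us n) t" and U: "H_L2 L U t"
    and lim: "(\<lambda>n. H_sqdist L (Us n) U t) \<longlonglongrightarrow> 0"
  shows "(\<lambda>n. H_sqnorm L (Us n) t) \<longlonglongrightarrow> H_sqnorm L U t"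
proof -
  obtain v vx vt p px pt z where Ueq: "U = (v, vx, vt, p, px, pt, z)" by (rule prod_cases7)
  define V where "V n = fst (Us n)" for n
  define Vx where "Vx n = fst (snd (Us n))" for n
  define Vt where "Vt n = fst (snd (snd (Us n)))" for n
  define P where "P n = fst (snd (snd (snd (Us n))))" for n
  define Px where "Px n = fst (snd (snd (snd (snd (Us n)))))" for n
  define Pt where "Pt n = fst (snd (snd (snd (snd (snd (Us n))))))" for n
  define Z where "Z n = snd (snd (snd (snd (snd (snd (Us n))))))" for n
  have Us_eq: "Us n = (V n, Vx n, Vt n, P n, Px n, Pt n, Z n)" for n
    by (simp add: V_def Vx_def Vt_def P_def Px_def Pt_def Z_def)
  have conv: "(\<lambda>n. L2_sqnorm S (f n)) \<longlonglongrightarrow> L2_sqnorm S g"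
    if "S \<in> sets lebesgue" "\<And>n. L2_on S (f n)" "L2_on S g"
      "\<And>n. L2_sqnorm S (\<lambda>x. f n x - g x) \<le> H_sqdist L (Us n) U t"
    for S :: "'a::euclidean_space set" and f g
  proof -
    have 0: "(\<lambda>n. L2_sqnorm S (\<lambda>x. f n x - g x)) \<longlonglongrightarrow> 0"
      by (rule tendsto_sandwich[OF _ _ tendsto_const lim]) (auto simp: L2_sqnorm_nonneg that(4))
    show ?thesis
      unfolding L2_sqnorm_eq by (rule L2_inner_tendsto) (use that 0 in auto)
  qed
  show ?thesis
    unfolding Us_eq Ueq H_sqnorm.simps
    by (intro tendsto_add conv)
      (use Us[unfolded Us_eq] U[unfolded Ueq] in \<open>auto simp: Us_eq Ueq intro!: add_increasing add_increasing2 L2_sqnorm_nonneg\<close>)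
qed

lemma strong_H_L2:
  assumes "strong_beam_solution L \<rho> \<alpha> \<gamma> \<mu> \<beta> \<tau> \<tau>' \<delta>1 \<delta>2 g0 U" "t \<ge> 0"
  shows "H_L2 L U t"
proof -
  obtain v vx vt p px pt z where U: "U = (v, vx, vt, p, px, pt, z)" by (rule prod_cases7)
  from assms(1)[unfolded U strong_beam_solution.simps] obtain vxx vtx vtt pxx ptx ptt zr zt where
    reg: "strong_regularity L (v, vx, vt, p, px, pt, z) vxx vtx vtt pxx ptx ptt zr zt"
    by blast
  then have "L2_C1 {0..L} v vt" "L2_C1 {0..L} vx vtx" "L2_C1 {0..L} vt vtt"
    "L2_C1 {0..L} p pt" "L2_C1 {0..L} px ptx" "L2_C1 {0..L} pt ptt" "L2_C1 (rect L) z zt"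
    by auto
  then show ?thesis
    unfolding U by (auto intro: L2_continuousD(1)[OF L2_C1D(1)] assms(2))
qed

lemma H_sqnorm_nonneg: "H_sqnorm L U t \<ge> 0"
  by (cases "(L, U, t)" rule: H_sqnorm.cases) (auto intro!: add_nonneg_nonneg L2_sqnorm_nonneg)

context beam
begin

text \<open>The strong estimate has the same constants along the whole approximating sequence, so it
  passes to the limit at time t and at time 0.\<close>

lemma weak_decay:
  "\<exists>M>0. \<exists>\<kappa>>0. \<forall>v0 v1 p0 p1 g0 U. beam_solution L \<rho> \<alpha> \<gamma> \<mu> \<beta> \<tau> \<tau>' \<delta>1 \<delta>2 v0 v1 p0 p1 g0 U \<longrightarrow>
     (\<forall>t\<ge>0. H_sqnorm L U t \<le> M * exp (- \<kappa> * t) * H_sqnorm L U 0)"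
proof -
  obtain M \<kappa> where M: "M > 0" "\<kappa> > 0" and decay:
    "\<And>g0 U t. strong_beam_solution L \<rho> \<alpha> \<gamma> \<mu> \<beta> \<tau> \<tau>' \<delta>1 \<delta>2 g0 U \<Longrightarrow> t \<ge> 0 \<Longrightarrow>
       H_sqnorm L U t \<le> M * exp (- \<kappa> * t) * H_sqnorm L U 0"
    using strong_decay by metis
  have "H_sqnorm L U t \<le> M * exp (- \<kappa> * t) * H_sqnorm L U 0"
    if sol: "beam_solution L \<rho> \<alpha> \<gamma> \<mu> \<beta> \<tau> \<tau>' \<delta>1 \<delta>2 v0 v1 p0 p1 g0 U" and t: "t \<ge> 0" for v0 v1 p0 p1 g0 U t
  proof -
    obtain v vx vt p px pt z where U: "U = (v, vx, vt, p, px, pt, z)" by (rule prod_cases7)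
    from sol[unfolded U beam_solution.simps] obtain Us g where
      H: "H_continuous L (v, vx, vt, p, px, pt, z)"
      and Us: "\<And>n::nat. strong_beam_solution L \<rho> \<alpha> \<gamma> \<mu> \<beta> \<tau> \<tau>' \<delta>1 \<delta>2 (g n) (Us n)"
      and unif: "\<And>T. T > 0 \<Longrightarrow> uniform_limit {0..T} (\<lambda>n. H_sqdist L (Us n) (v, vx, vt, p, px, pt, z)) (\<lambda>t. 0) sequentially"
      by blast
    have lim: "(\<lambda>n. H_sqnorm L (Us n) s) \<longlonglongrightarrow> H_sqnorm L U s" if s: "s \<ge> 0" for s
    proof (rule H_sqnorm_tendsto)
      show "H_L2 L (Us n) s" for n using strong_H_L2[OF Us s] .
      show "H_L2 L U s"
        unfolding U using H s by (auto intro: L2_continuousD(1))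
      show "(\<lambda>n. H_sqdist L (Us n) U s) \<longlonglongrightarrow> 0"
        \<comment> \<open>The interval [0, s + 1] is nondegenerate even for s = 0.\<close>
        using tendsto_uniform_limitI[OF unif[of "s + 1"], of s] s unfolding U by simp
    qed
    show ?thesis
      by (rule LIMSEQ_le[OF lim[OF t] tendsto_mult_left[OF lim[of 0], of "M * exp (- \<kappa> * t)"]])
        (use decay[OF Us t] in auto)
  qed
  then show ?thesis using M by blast
qed

section \<open>Comparison of the norm with the energy\<close>

text \<open>
  The weight \<open>e\<^bsup>lam(s-t)\<^esup>\<close> only changes constants, since the memory reaches back at most \<open>\<tau>bar\<close>.
\<close>
lemma initial_energy_bound:
  assumes sol: "beam_solution L \<rho> \<alpha> \<gamma> \<mu> \<beta> \<tau> \<tau>' \<delta>1 \<delta>2 v0 v1 p0 p1 g0 U"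
  shows "min energy_lower (\<xi>bar * \<delta>0 * \<tau>0 / 2 * exp (- \<bar>lam\<bar> * \<tau>bar)) * H_sqnorm L U 0
    \<le> beam_energy L \<rho> \<mu> \<alpha>1 \<beta> \<gamma> (\<lambda>t. \<xi>bar * \<delta>1 t) lam \<tau> g0 U 0"
proof -
  obtain v vx vt p px pt z where U: "U = (v, vx, vt, p, px, pt, z)" by (rule prod_cases7)
  have H: "H_continuous L (v, vx, vt, p, px, pt, z)"
    and z0: "AE (x, r) in lebesgue_on (rect L). z 0 (x, r) = g0 x (- r * \<tau> 0)"
    using sol unfolding U by auto
  have L2: "L2_on {0..L} (vx 0)" "L2_on {0..L} (px 0)" "L2_on (rect L) (z 0)"
    using H by (auto intro: L2_continuousD(1))
  have \<tau>: "\<tau> 0 > 0" "\<tau>0 \<le> \<tau> 0" "\<tau> 0 \<le> \<tau>bar" using \<tau>_ge[of 0] \<tau>_le[of 0] pos by auto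
  let ?N = "\<lambda>s. integral {0..L} (\<lambda>x. (g0 x s)\<^sup>2)" and ?e = "exp (- \<bar>lam\<bar> * \<tau>bar)"
  let ?A = "L2_sqnorm {0..L} (vt 0)" and ?B = "L2_sqnorm {0..L} (pt 0)" and ?X = "L2_sqnorm {0..L} (vx 0)"
    and ?Y = "L2_sqnorm {0..L} (px 0)" and ?Z = "L2_sqnorm (rect L) (z 0)"
  let ?G = "L2_sqnorm {0..L} (\<lambda>x. \<gamma> * vx 0 x - px 0 x)"
  define mem where "mem = integral {- \<tau> 0..0} (\<lambda>s. integral {0..L} (\<lambda>x. exp (lam * s) * (velocity g0 vt s x)\<^sup>2))"
  note hist = history_integral[OF \<tau>(1) L2(3) z0]
  have Npos: "?N s \<ge> 0" for s
    using L2_sqnorm_nonneg[of "{0..L}" "\<lambda>x. g0 x s"] by (simp add: L2_sqnorm_def)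
  have "?e * (\<tau> 0 * ?Z) \<le> mem"
  proof -
    \<comment> \<open>Nonnegativity upgrades integrability to absolute integrability, which
      multiplication by the exponential preserves.\<close>
    have Nabs: "?N absolutely_integrable_on {- \<tau> 0..0}"
      using hist Npos by (intro nonnegative_absolutely_integrable_1) (auto simp: has_integral_iff)
    have i: "(\<lambda>s. exp (lam * s) * ?N s) integrable_on {- \<tau> 0..0}"
      by (intro set_lebesgue_integral_eq_integral(1) absolutely_integrable_continuous_mult[OF Nabs] continuous_intros)
    have "mem = integral {- \<tau> 0..0} (\<lambda>s. exp (lam * s) * ?N s)"
      unfolding mem_def
      \<comment> \<open>At the single time s = 0 \<open>velocity\<close> is v_t and not the
        history.\<close>
      by (rule integral_spike[of "{0}"]) (auto simp: velocity_def)
    moreover have "integral {- \<tau> 0..0} (\<lambda>s. ?e * ?N s) \<le> integral {- \<tau> 0..0} (\<lambda>s. exp (lam * s) * ?N s)"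
    proof (rule integral_le[OF _ i])
      show "(\<lambda>s. ?e * ?N s) integrable_on {- \<tau> 0..0}"
        using hist by (auto simp: has_integral_iff intro: integrable_on_mult_right)
      fix s assume s: "s \<in> {- \<tau> 0..0}"
      have "\<bar>lam * s\<bar> \<le> \<bar>lam\<bar> * \<tau>bar"
        using s \<tau> unfolding abs_mult by (intro mult_left_mono) auto
      then show "?e * ?N s \<le> exp (lam * s) * ?N s"
        using Npos by (intro mult_right_mono) auto
    qed
    moreover have "integral {- \<tau> 0..0} (\<lambda>s. ?e * ?N s) = ?e * (\<tau> 0 * ?Z)"
      using hist by (simp add: has_integral_iff)
    ultimately show ?thesis by simp
  qed
  moreover have "?e * (\<tau>0 * ?Z) \<le> ?e * (\<tau> 0 * ?Z)"
    using \<tau> by (intro mult_left_mono mult_right_mono L2_sqnorm_nonneg) auto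
  ultimately have mem: "?e * (\<tau>0 * ?Z) \<le> mem" by linarith
  have "\<delta>0 * (?e * (\<tau>0 * ?Z)) \<le> \<delta>1 0 * mem"
    using mem \<delta>1_ge[of 0] pos by (intro mult_mono) (auto intro!: mult_nonneg_nonneg L2_sqnorm_nonneg)
  then have "\<xi>bar / 2 * (\<delta>0 * (?e * (\<tau>0 * ?Z))) \<le> \<xi>bar / 2 * (\<delta>1 0 * mem)"
    using \<sigma> by (intro mult_left_mono) auto
  then have mem': "\<xi>bar * \<delta>0 * \<tau>0 / 2 * ?e * ?Z \<le> \<xi>bar * \<delta>1 0 / 2 * mem"
    by (simp add: mult_ac)
  let ?c = "min energy_lower (\<xi>bar * \<delta>0 * \<tau>0 / 2 * ?e)"
  have el: "energy_lower \<le> \<rho> / 2" "energy_lower \<le> \<mu> / 2" "energy_lower \<le> \<alpha>1 / 4"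
    "energy_lower \<le> \<alpha>1 / (\<alpha>1 + 2 * \<beta> * \<gamma>\<^sup>2) * \<beta> / 4"
    unfolding energy_lower_def by (rule Min_le; simp)+
  have "?c * H_sqnorm L U 0 \<le> \<rho> / 2 * ?A + \<mu> / 2 * ?B + \<alpha>1 / 4 * ?X
      + \<alpha>1 / (\<alpha>1 + 2 * \<beta> * \<gamma>\<^sup>2) * \<beta> / 4 * ?Y + \<xi>bar * \<delta>0 * \<tau>0 / 2 * ?e * ?Z"
    unfolding U H_sqnorm.simps distrib_left
    by (intro add_mono mult_right_mono[OF min.coboundedI1] mult_right_mono[OF min.coboundedI2] el
      L2_sqnorm_nonneg order_refl)
  also have "\<dots> \<le> \<rho> / 2 * ?A + \<mu> / 2 * ?B + \<alpha>1 / 2 * ?X + \<beta> / 2 * ?G + \<xi>bar * \<delta>1 0 / 2 * mem"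
    using mem' coupling_bounds(1)[OF L2(1,2)] by linarith
  also have "\<dots> = beam_energy L \<rho> \<mu> \<alpha>1 \<beta> \<gamma> (\<lambda>t. \<xi>bar * \<delta>1 t) lam \<tau> g0 U 0"
    by (simp add: U L2_sqnorm_def mem_def)
  finally show ?thesis .
qed

text \<open>For s >= 0 the norm of v_t(s) has decayed up to time s, and s is within taubar of t,
  which costs the factor exp(kappa taubar). Negative s occur only for t < taubar, where a constant
  bound by the initial history is itself bounded by a multiple of exp(- kappa t).\<close>

lemma memory_upper_bound:
  assumes sol: "beam_solution L \<rho> \<alpha> \<gamma> \<mu> \<beta> \<tau> \<tau>' \<delta>1 \<delta>2 v0 v1 p0 p1 g0 U" and U: "U = (v, vx, vt, p, px, pt, z)"
    and decay: "\<And>t. t \<ge> 0 \<Longrightarrow> H_sqnorm L U t \<le> M * exp (- \<kappa> * t) * H_sqnorm L U 0"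
    and M: "M > 0" "\<kappa> > 0" and t: "t \<ge> 0"
  shows "integral {t - \<tau> t..t} (\<lambda>s. integral {0..L} (\<lambda>x. exp (lam * (s - t)) * (velocity g0 vt s x)\<^sup>2))
    \<le> exp (\<bar>lam\<bar> * \<tau>bar) * \<tau>bar * exp (\<kappa> * \<tau>bar) * (M + 1) * exp (- \<kappa> * t) * H_sqnorm L U 0"
proof -
  have H: "H_continuous L (v, vx, vt, p, px, pt, z)"
    and z0: "AE (x, r) in lebesgue_on (rect L). z 0 (x, r) = g0 x (- r * \<tau> 0)"
    using sol unfolding U by auto
  have L2: "L2_on (rect L) (z 0)"
    using H by (auto intro: L2_continuousD(1))
  have \<tau>0: "\<tau> 0 > 0" "\<tau> 0 \<le> \<tau>bar" using \<tau>_ge[of 0] \<tau>_le[of 0] pos by auto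
  have \<tau>t: "\<tau> t > 0" "\<tau> t \<le> \<tau>bar" using \<tau>_ge[OF t] \<tau>_le[OF t] pos by auto
  let ?N = "\<lambda>s. integral {0..L} (\<lambda>x. (g0 x s)\<^sup>2)" and ?S = "H_sqnorm L U 0"
  have Npos: "?N s \<ge> 0" for s
    using L2_sqnorm_nonneg[of "{0..L}" "\<lambda>x. g0 x s"] by (simp add: L2_sqnorm_def)
  have Spos: "?S \<ge> 0" by (rule H_sqnorm_nonneg)
  define \<Lambda> where "\<Lambda> = exp (\<bar>lam\<bar> * \<tau>bar)"
  define c where "c = M * exp (\<kappa> * \<tau>bar) * exp (- \<kappa> * t) * ?S"
  define f where "f s = integral {0..L} (\<lambda>x. exp (lam * (s - t)) * (velocity g0 vt s x)\<^sup>2)" for s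
  \<comment> \<open>The history norm is extended by zero so that one function can be integrated over
    windows that straddle time 0.\<close>
  define G where "G s = (if s \<in> {- \<tau> 0..0} then ?N s else 0)" for s
  have c: "c \<ge> 0" using M Spos by (simp add: c_def)
  have \<Lambda>: "\<Lambda> > 0" by (simp add: \<Lambda>_def)
  have f_le: "f s \<le> \<Lambda> * (G s + c)" and f_le': "s \<ge> 0 \<Longrightarrow> f s \<le> \<Lambda> * c" if s: "s \<in> {t - \<tau> t..t}" for s
  proof -
    have "\<bar>lam * (s - t)\<bar> \<le> \<bar>lam\<bar> * \<tau>bar"
      using s \<tau>t unfolding abs_mult by (intro mult_left_mono) auto
    then have e: "exp (lam * (s - t)) \<le> \<Lambda>" by (simp add: \<Lambda>_def)
    show 1: "f s \<le> \<Lambda> * c" if s0: "s \<ge> 0"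
    proof -
      have "L2_sqnorm {0..L} (vt s) \<le> H_sqnorm L U s"
        unfolding U by (auto intro!: add_increasing2 add_nonneg_nonneg L2_sqnorm_nonneg)
      also have "\<dots> \<le> M * exp (- \<kappa> * s) * ?S" by (rule decay[OF s0])
      also have "\<dots> \<le> M * exp (\<kappa> * \<tau>bar + - \<kappa> * t) * ?S"
      proof -
        have "\<kappa> * (t - s) \<le> \<kappa> * \<tau>bar"
          using s \<tau>t M by (intro mult_left_mono) auto
        then show ?thesis
          using M Spos by (intro mult_right_mono mult_left_mono) (auto simp: algebra_simps)
      qed
      finally have "L2_sqnorm {0..L} (vt s) \<le> c"
        unfolding exp_add by (simp add: c_def mult.assoc)
      moreover have "f s = exp (lam * (s - t)) * L2_sqnorm {0..L} (vt s)"
        using s0 by (simp add: f_def velocity_def L2_sqnorm_def)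
      ultimately show ?thesis
        using e \<Lambda> by (simp add: mult_mono L2_sqnorm_nonneg)
    qed
    show "f s \<le> \<Lambda> * (G s + c)"
    proof (cases "s \<ge> 0")
      case True
      have "\<Lambda> * c \<le> \<Lambda> * (G s + c)"
        using \<Lambda> Npos by (intro mult_left_mono) (auto simp: G_def)
      then show ?thesis using 1[OF True] by linarith
    next
      case False
      then have "s \<in> {- \<tau> 0..0}"
        using s delay_start[OF t] by auto
      then have "f s = exp (lam * (s - t)) * G s"
        using False by (simp add: f_def velocity_def G_def)
      also have "\<dots> \<le> \<Lambda> * (G s + c)"
        using e c \<Lambda> Npos by (intro mult_mono) (auto simp: G_def)
      finally show ?thesis .
    qed
  qed
  have goal: "\<Lambda> * (\<tau>bar * c) + \<Lambda> * (\<tau>bar * (exp (\<kappa> * \<tau>bar) * exp (- \<kappa> * t) * ?S))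
     = exp (\<bar>lam\<bar> * \<tau>bar) * \<tau>bar * exp (\<kappa> * \<tau>bar) * (M + 1) * exp (- \<kappa> * t) * ?S" (is "_ = ?R")
    by (simp add: c_def \<Lambda>_def algebra_simps)
  have rest: "0 \<le> \<Lambda> * (\<tau>bar * (exp (\<kappa> * \<tau>bar) * exp (- \<kappa> * t) * ?S))"
    using \<Lambda> Spos \<tau>bar_pos by simp
  have first: "\<Lambda> * (c * \<tau> t) \<le> \<Lambda> * (\<tau>bar * c)"
    unfolding mult.commute[of \<tau>bar] using \<Lambda> c \<tau>t by (intro mult_left_mono) auto
  have "integral {t - \<tau> t..t} f \<le> ?R"
  \<comment> \<open>Nothing guarantees that \<open>f\<close> is integrable in s; if it is not, its
    integral is 0 and the bound is trivial.\<close>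
  proof (cases "f integrable_on {t - \<tau> t..t}")
    case False
    have "0 \<le> \<Lambda> * (\<tau>bar * c)" using \<Lambda> c \<tau>bar_pos by simp
    then show ?thesis
      using False goal rest by (simp add: not_integrable_integral)
  next
    case f: True
    show ?thesis
    \<comment> \<open>From taubar on, the window contains no negative times.\<close>
    proof (cases "t \<ge> \<tau>bar")
      case True
      have "integral {t - \<tau> t..t} f \<le> integral {t - \<tau> t..t} (\<lambda>s. \<Lambda> * c)"
        using True \<tau>t by (intro integral_le f f_le') auto
      also have "\<dots> = \<Lambda> * (c * \<tau> t)"
        using \<tau>t by simp
      finally show ?thesis using goal rest first by linarith
    next
      case False
      have G: "(G has_integral \<tau> 0 * L2_sqnorm (rect L) (z 0)) {- \<tau> 0..t}"
        unfolding G_def using t history_integral[OF \<tau>0(1) L2 z0]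
        by (subst has_integral_restrict) auto
      have Gi: "G integrable_on {t - \<tau> t..t}"
        using G by (intro integrable_on_subinterval[OF has_integral_integrable[OF G]]) (use delay_start[OF t] in auto)
      have "integral {t - \<tau> t..t} G \<le> integral {- \<tau> 0..t} G"
        using delay_start[OF t] Gi G Npos by (intro integral_subset_le) (auto simp: G_def)
      also have "\<dots> = \<tau> 0 * L2_sqnorm (rect L) (z 0)"
        using G by (rule integral_unique)
      also have "\<dots> \<le> \<tau>bar * ?S"
        using \<tau>0 unfolding U
        by (intro mult_mono) (auto intro!: add_increasing add_nonneg_nonneg L2_sqnorm_nonneg)
      also have "\<dots> \<le> \<tau>bar * (exp (\<kappa> * \<tau>bar) * exp (- \<kappa> * t) * ?S)"
      proof -
        have "1 \<le> exp (\<kappa> * \<tau>bar) * exp (- \<kappa> * t)"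
          using False M unfolding exp_add[symmetric] by (simp add: algebra_simps)
        from mult_right_mono[OF this Spos] show ?thesis
          using \<tau>bar_pos by (intro mult_left_mono) auto
      qed
      finally have IG: "integral {t - \<tau> t..t} G \<le> \<tau>bar * (exp (\<kappa> * \<tau>bar) * exp (- \<kappa> * t) * ?S)" .
      have "integral {t - \<tau> t..t} f \<le> integral {t - \<tau> t..t} (\<lambda>s. \<Lambda> * (G s + c))"
        by (intro integral_le f f_le integrable_on_mult_right integrable_add Gi) auto
      also have "\<dots> = \<Lambda> * (integral {t - \<tau> t..t} G + c * \<tau> t)"
      proof -
        have "integral {t - \<tau> t..t} (\<lambda>s. G s + c) = integral {t - \<tau> t..t} G + integral {t - \<tau> t..t} (\<lambda>s. c)"
          by (rule Henstock_Kurzweil_Integration.integral_add) (auto intro: Gi)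
        then show ?thesis using \<tau>t by simp
      qed
      also have "\<dots> = \<Lambda> * integral {t - \<tau> t..t} G + \<Lambda> * (c * \<tau> t)"
        by (simp add: distrib_left)
      also have "\<dots> \<le> \<Lambda> * (\<tau>bar * (exp (\<kappa> * \<tau>bar) * exp (- \<kappa> * t) * ?S)) + \<Lambda> * (\<tau>bar * c)"
        using IG \<Lambda> first by (intro add_mono mult_left_mono) auto
      finally show ?thesis using goal by linarith
    qed
  qed
  then show ?thesis by (simp add: f_def[abs_def])
qed

lemma beam_energy_decay:
  "\<exists>H1>0. \<exists>H2>0. \<forall>v0 v1 p0 p1 g0 U.
     beam_solution L \<rho> \<alpha> \<gamma> \<mu> \<beta> \<tau> \<tau>' \<delta>1 \<delta>2 v0 v1 p0 p1 g0 U \<longrightarrow>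
     (\<forall>t\<ge>0. beam_energy L \<rho> \<mu> \<alpha>1 \<beta> \<gamma> (\<lambda>t. \<xi>bar * \<delta>1 t) lam \<tau> g0 U t
        \<le> H1 * beam_energy L \<rho> \<mu> \<alpha>1 \<beta> \<gamma> (\<lambda>t. \<xi>bar * \<delta>1 t) lam \<tau> g0 U 0 * exp (- H2 * t))"
proof -
  obtain M \<kappa> where M: "M > 0" "\<kappa> > 0" and decay: "\<And>v0 v1 p0 p1 g0 U t.
     beam_solution L \<rho> \<alpha> \<gamma> \<mu> \<beta> \<tau> \<tau>' \<delta>1 \<delta>2 v0 v1 p0 p1 g0 U \<Longrightarrow> t \<ge> 0 \<Longrightarrow>
     H_sqnorm L U t \<le> M * exp (- \<kappa> * t) * H_sqnorm L U 0"
    using weak_decay by metis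
  \<comment> \<open>\<open>c\<close> bounds the initial energy from below and \<open>h\<close> the
    energy at time t from above, both in terms of \<open>H_sqnorm\<close> at time 0;
    \<open>m\<close> is the share of the delay integral. This gives \<open>h / c\<close> and
    \<open>\<kappa>\<close> as the constants of the theorem.\<close>
  define c where "c = min energy_lower (\<xi>bar * \<delta>0 * \<tau>0 / 2 * exp (- \<bar>lam\<bar> * \<tau>bar))"
  define m where "m = exp (\<bar>lam\<bar> * \<tau>bar) * \<tau>bar * exp (\<kappa> * \<tau>bar) * (M + 1)"
  define h where "h = energy_upper * M + \<xi>bar * \<delta>1 0 / 2 * m"
  have c: "c > 0" using energy_lower_pos \<sigma> pos by (simp add: c_def)
  have \<delta>: "\<delta>1 0 > 0" using \<delta>1_ge[of 0] pos by simp
  have m: "m > 0" using M \<tau>bar_pos by (simp add: m_def)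
  have h: "h > 0"
    unfolding h_def using energy_upper_pos M \<sigma> \<delta> m by (intro add_pos_pos) auto
  have main: "beam_energy L \<rho> \<mu> \<alpha>1 \<beta> \<gamma> (\<lambda>t. \<xi>bar * \<delta>1 t) lam \<tau> g0 U t
        \<le> h / c * beam_energy L \<rho> \<mu> \<alpha>1 \<beta> \<gamma> (\<lambda>t. \<xi>bar * \<delta>1 t) lam \<tau> g0 U 0 * exp (- \<kappa> * t)"
    if sol: "beam_solution L \<rho> \<alpha> \<gamma> \<mu> \<beta> \<tau> \<tau>' \<delta>1 \<delta>2 v0 v1 p0 p1 g0 U" and t: "t \<ge> 0" for v0 v1 p0 p1 g0 U t
  proof -
    obtain v vx vt p px pt z where U: "U = (v, vx, vt, p, px, pt, z)" by (rule prod_cases7)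
    have H: "H_continuous L (v, vx, vt, p, px, pt, z)" using sol unfolding U by auto
    have L2: "L2_on {0..L} (vx t)" "L2_on {0..L} (px t)"
      using H t by (auto intro: L2_continuousD(1))
    let ?A = "L2_sqnorm {0..L} (vt t)" and ?B = "L2_sqnorm {0..L} (pt t)" and ?X = "L2_sqnorm {0..L} (vx t)"
      and ?Y = "L2_sqnorm {0..L} (px t)" and ?S = "H_sqnorm L U"
    let ?G = "L2_sqnorm {0..L} (\<lambda>x. \<gamma> * vx t x - px t x)"
    let ?e = "exp (- \<kappa> * t)"
    define mem where "mem = integral {t - \<tau> t..t} (\<lambda>s. integral {0..L} (\<lambda>x. exp (lam * (s - t)) * (velocity g0 vt s x)\<^sup>2))"
    have S0: "?S 0 \<ge> 0" by (rule H_sqnorm_nonneg)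
    have mem: "mem \<le> m * (?e * ?S 0)"
      using memory_upper_bound[OF sol U decay[OF sol] M t] by (simp add: mem_def m_def mult.assoc)
    have "\<delta>1 t * mem \<le> \<delta>1 0 * (m * (?e * ?S 0))"
    proof -
      have "\<delta>1 t * mem \<le> \<delta>1 t * (m * (?e * ?S 0))"
        using mem \<delta>1_ge[OF t] pos by (intro mult_left_mono) auto
      also have "\<dots> \<le> \<delta>1 0 * (m * (?e * ?S 0))"
        using \<delta>1_le[OF t] m S0 by (intro mult_right_mono) auto
      finally show ?thesis .
    qed
    then have mem': "\<xi>bar / 2 * (\<delta>1 t * mem) \<le> \<xi>bar / 2 * (\<delta>1 0 * (m * (?e * ?S 0)))"
      using \<sigma> by (intro mult_left_mono) auto
    have "beam_energy L \<rho> \<mu> \<alpha>1 \<beta> \<gamma> (\<lambda>t. \<xi>bar * \<delta>1 t) lam \<tau> g0 U t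
        = \<rho> / 2 * ?A + \<mu> / 2 * ?B + \<alpha>1 / 2 * ?X + \<beta> / 2 * ?G + \<xi>bar / 2 * (\<delta>1 t * mem)"
      by (simp add: U L2_sqnorm_def mem_def)
    also have "\<dots> \<le> \<rho> / 2 * ?A + \<mu> / 2 * ?B + (\<alpha>1 / 2 + \<beta> * \<gamma>\<^sup>2) * ?X + \<beta> * ?Y
        + \<xi>bar / 2 * (\<delta>1 0 * (m * (?e * ?S 0)))"
      using mem' coupling_bounds(2)[OF L2] by (simp add: distrib_right)
    also have "\<rho> / 2 * ?A + \<mu> / 2 * ?B + (\<alpha>1 / 2 + \<beta> * \<gamma>\<^sup>2) * ?X + \<beta> * ?Y \<le> energy_upper * ?S t"
    proof -
      \<comment> \<open>The zero term stands for z, so that the sum matches the five summands of the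
        norm.\<close>
      have "\<rho> / 2 * ?A + \<mu> / 2 * ?B + (\<alpha>1 / 2 + \<beta> * \<gamma>\<^sup>2) * ?X + \<beta> * ?Y + 0 * L2_sqnorm (rect L) (z t) \<le> energy_upper * ?S t"
        unfolding U H_sqnorm.simps distrib_left[of energy_upper] using pos \<sigma> \<delta> \<tau>bar_pos
        by (intro add_mono mult_right_mono L2_sqnorm_nonneg) (auto simp: energy_upper_def)
      then show ?thesis by simp
    qed
    also have "energy_upper * ?S t \<le> energy_upper * (M * ?e * ?S 0)"
      using decay[OF sol t] energy_upper_pos by (intro mult_left_mono) auto
    finally have "beam_energy L \<rho> \<mu> \<alpha>1 \<beta> \<gamma> (\<lambda>t. \<xi>bar * \<delta>1 t) lam \<tau> g0 U t \<le> h * ?e * ?S 0"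
      by (simp add: h_def algebra_simps)
    also have "\<dots> = h / c * ?e * (c * ?S 0)"
      using c by simp
    also have "\<dots> \<le> h / c * ?e * beam_energy L \<rho> \<mu> \<alpha>1 \<beta> \<gamma> (\<lambda>t. \<xi>bar * \<delta>1 t) lam \<tau> g0 U 0"
      using initial_energy_bound[OF sol, of lam] h c by (intro mult_left_mono) (auto simp: c_def)
    finally show ?thesis by (simp add: mult_ac)
  qed
  show ?thesis
  proof (rule exI[of _ "h / c"], rule conjI)
    show "h / c > 0" using h c by simp
  qed (use M main in blast)
qed

end

theorem theorem4p1:
  fixes L \<rho> \<alpha> \<alpha>1 \<gamma> \<mu> \<beta> :: real
    and \<tau> \<tau>' :: "real \<Rightarrow> real" and \<tau>0 \<tau>bar d :: real
    and \<delta>1 \<delta>1' \<delta>2 \<delta>2' :: "real \<Rightarrow> real" and M1 M2 \<delta>0 \<beta>0 :: real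
    and \<xi>bar lam :: real
  assumes "L > 0" "\<rho> > 0" "\<alpha> > 0" "\<alpha>1 > 0" "\<gamma> > 0" "\<mu> > 0" "\<beta> > 0"
    and "\<alpha> = \<alpha>1 + \<gamma>\<^sup>2 * \<beta>"
    and "\<tau>0 > 0" "\<tau>bar > 0" "d < 1"
    and "\<forall>t>0. \<tau>0 \<le> \<tau> t \<and> \<tau> t \<le> \<tau>bar \<and> \<tau>' t \<le> d"
    and "\<forall>T>0. W2_inf T \<tau> \<tau>'"
    and "C1_nonneg \<delta>1 \<delta>1'" "antimono_on {0..} \<delta>1"
    and "M1 > 0" "\<delta>0 > 0"
    and "\<forall>t\<ge>0. \<bar>\<delta>1' t / \<delta>1 t\<bar> \<le> M1 \<and> \<delta>0 \<le> \<delta>1 t"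
    and "C1_nonneg \<delta>2 \<delta>2'"
    and "0 < \<beta>0" "\<beta>0 < sqrt (1 - d)" "M2 > 0"
    and "\<forall>t\<ge>0. \<bar>\<delta>2 t\<bar> \<le> \<beta>0 * \<delta>1 t \<and> \<bar>\<delta>2' t\<bar> \<le> M2 * \<delta>1 t"
    and "\<beta>0 / sqrt (1 - d) < \<xi>bar" "\<xi>bar < 2 - \<beta>0 / sqrt (1 - d)"
    and "\<forall>t\<ge>0. \<delta>2 t \<noteq> 0 \<longrightarrow> lam < 1 / \<tau>bar * \<bar>ln (\<bar>\<delta>2 t\<bar> / sqrt (1 - d))\<bar>"
  shows "\<exists>H1>0. \<exists>H2>0. \<forall>v0 v1 p0 p1 g0 U.
           beam_solution L \<rho> \<alpha> \<gamma> \<mu> \<beta> \<tau> \<tau>' \<delta>1 \<delta>2 v0 v1 p0 p1 g0 U \<longrightarrow>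
           (\<forall>t\<ge>0. beam_energy L \<rho> \<mu> \<alpha>1 \<beta> \<gamma> (\<lambda>t. \<xi>bar * \<delta>1 t) lam \<tau> g0 U t
                  \<le> H1 * beam_energy L \<rho> \<mu> \<alpha>1 \<beta> \<gamma> (\<lambda>t. \<xi>bar * \<delta>1 t) lam \<tau> g0 U 0 * exp (- H2 * t))"
proof -
  interpret beam L \<rho> \<alpha> \<alpha>1 \<gamma> \<mu> \<beta> \<tau> \<tau>' \<tau>0 \<tau>bar d \<delta>1 \<delta>1' \<delta>2 \<delta>0 \<beta>0 \<xi>bar
    using assms by unfold_locales auto
  show ?thesis by (rule beam_energy_decay)
qed

end
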